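(* Let $0<\alpha<\frac{\log 3}{4\log 2}$, $s>\frac{\log 3}{2\log 2}-2\alpha$ and $\nu>0$. There is an absolute constant $M_{\alpha,s}>0$ depending only on $\alpha$ and $s$ such that the following holds. Suppose $u^0\in\dot H^s_{\mathcal M}$ satisfies $$\|u^0\|_{\dot H^{\frac{\log 3}{2\log 2}-2\alpha}}<M_{\alpha,s}\,\nu.$$ Then there exists a global smooth solution $u\in C\big([0,+\infty);\dot H^s_{\mathcal M}\big)$ of the Fourier-restricted hypodissipative Navier--Stokes equation with initial data $u^0$, and for all $0<t<+\infty$, $$\|u(\cdot,t)\|_{\dot H^{\frac{\log 3}{2\log 2}-2\alpha}}\le\|u^0\|_{\dot H^{\frac{\log 3}{2\log 2}-2\alpha}},\qquad \|u(\cdot,t)\|_{\dot H^s}\le\|u^0\|_{\dot H^s}.$$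
   Context: Function spaces: $\mathbb T^3=\mathbb R^3/\mathbb Z^3$, $\hat u(k)=\int_{\mathbb T^3}u(x)e^{-2\pi i k\cdot x}\,dx$ for $k\in\mathbb Z^3$. For $s\ge0$, $\dot H^s=\dot H^s(\mathbb T^3;\mathbb R^3)$ is the space of mean-zero $L^2$ vector fields with $\|u\|_{\dot H^s}^2=\sum_{k\ne0}(4\pi^2|k|^2)^s|\hat u(k)|^2<\infty$. $(-\Delta)^\alpha$ is the Fourier multiplier $(4\pi^2|k|^2)^\alpha$. Frequencies: let $\sigma=(1,1,1)$. For integers $m\ge0$ let $k^m=2^{2m}\sigma+3^m(1,0,-1)$, $h^m=2^{2m+1}\sigma+3^m(1,1,-2)$, $j^m=2^{2m+1}\sigma+3^m(2,-1,-1)$. For $v\in\mathbb R^3$, $\mathcal P[v]$ is the set of all vectors obtained by permuting the entries of $v$. Let $\mathcal M^+_{2m}=\mathcal P[k^m]$, $\mathcal M^+_{2m+1}=\mathcal P[h^m]\cup\mathcal P[j^m]$, $\mathcal M^+=\bigcup_{n\ge0}\mathcal M_n^+$, $\mathcal M=\mathcal M^+\cup(-\mathcal M^+)$. For $k\in\mathcal M$ let $P_k^\perp(\sigma)=\sigma-\frac{k\cdot\sigma}{|k|^2}k$ and $v^k=P_k^\perp(\sigma)/|P_k^\perp(\sigma)|$. Constraint space: $\dot H^s_{\mathcal M}$ is the set of $u\in\dot H^s(\mathbb T^3;\mathbb R^3)$ with $\operatorname{supp}\hat u\subset\mathcal M$ and $\hat u(k)\in\operatorname{span}\{v^k\}$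 (complex multiples of $v^k$) for all $k\in\mathcal M$. The projection $\mathbb P_{\mathcal M}$ is given by $\widehat{\mathbb P_{\mathcal M}w}(k)=(v^k\cdot\hat w(k))v^k$ for $k\in\mathcal M$ and $0$ for $k\notin\mathcal M$; $(u\cdot\nabla)u=\nabla\cdot(u\otimes u)$ in the sense of distributions. Equation: the Fourier-restricted hypodissipative Navier--Stokes equation is $\partial_tu+\nu(-\Delta)^\alpha u+\mathbb P_{\mathcal M}((u\cdot\nabla)u)=0$. A solution $u\in C([0,T);\dot H^s_{\mathcal M})$ (with $s\ge0$, $s>\frac{\log3}{2\log2}-2\alpha$) is understood as a mild solution: for all $0<t<T$, $u(\cdot,t)=e^{-\nu t(-\Delta)^\alpha}u^0-\int_0^te^{-\nu(t-\tau)(-\Delta)^\alpha}\mathbb P_{\mathcal M}((u\cdot\nabla)u)(\cdot,\tau)\,d\tau$. "Smooth" means $C^\infty$ on $(0,+\infty)\times\mathbb T^3$. *)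

theory Defs
  imports "HOL-Analysis.Analysis"
begin

section \<open>Functions on the torus and their Fourier coefficients\<close>

text \<open>A function on the torus is a function on \<open>real ^ 3\<close> that is 1-periodic in every
  coordinate; integrals are taken over the unit cube.\<close>

definition periodic :: "(real ^ 3 \<Rightarrow> 'b) \<Rightarrow> bool" where
  "periodic u \<longleftrightarrow> (\<forall>x. \<forall>j. u (x + axis j 1) = u x)"

abbreviation torus :: "(real ^ 3) measure" where
  "torus \<equiv> lebesgue_on (cbox 0 1)"

definition rvec :: "int ^ 3 \<Rightarrow> real ^ 3" where
  "rvec k = (\<chi> j. of_int (k $ j))"

definition cvec :: "real ^ 3 \<Rightarrow> complex ^ 3" where
  "cvec v = (\<chi> j. of_real (v $ j))"

definition fchar :: "int ^ 3 \<Rightarrow> real ^ 3 \<Rightarrow> complex" where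
  "fchar k x = exp (- (2 * of_real pi * \<i> * of_real (rvec k \<bullet> x)))"

definition fourier :: "(real ^ 3 \<Rightarrow> real ^ 3) \<Rightarrow> int ^ 3 \<Rightarrow> complex ^ 3" where
  "fourier u k = (\<chi> i. LINT x|torus. of_real (u x $ i) * fchar k x)"

text \<open>The symbol of the fractional Laplacian; at \<open>k = 0\<close> it vanishes since \<open>0 powr a = 0\<close>.\<close>

definition lap_symbol :: "real \<Rightarrow> int ^ 3 \<Rightarrow> real" where
  "lap_symbol a k = (4 * pi\<^sup>2 * (norm (rvec k))\<^sup>2) powr a"

text \<open>The elements of \<open>Hdot s\<close> are representatives of almost-everywhere classes.\<close>

definition Hdot :: "real \<Rightarrow> (real ^ 3 \<Rightarrow> real ^ 3) set" where
  "Hdot s = {u. periodic u \<and> u \<in> borel_measurable torus \<and>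
     integrable torus (\<lambda>x. (norm (u x))\<^sup>2) \<and> (LINT x|torus. u x) = 0 \<and>
     (\<lambda>k. lap_symbol s k * (norm (fourier u k))\<^sup>2) summable_on (UNIV - {0})}"

definition Hdot_norm :: "real \<Rightarrow> (real ^ 3 \<Rightarrow> real ^ 3) \<Rightarrow> real" where
  "Hdot_norm s u = sqrt (\<Sum>\<^sub>\<infinity>k\<in>UNIV - {0}. lap_symbol s k * (norm (fourier u k))\<^sup>2)"


section \<open>The restricted frequency set and the constraint space\<close>

definition sigma :: "int ^ 3" where
  "sigma = vector [1, 1, 1]"

definition kfreq :: "nat \<Rightarrow> int ^ 3" where
  "kfreq m = 2 ^ (2 * m) *s sigma + 3 ^ m *s vector [1, 0, -1]"

definition hfreq :: "nat \<Rightarrow> int ^ 3" where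
  "hfreq m = 2 ^ (2 * m + 1) *s sigma + 3 ^ m *s vector [1, 1, -2]"

definition jfreq :: "nat \<Rightarrow> int ^ 3" where
  "jfreq m = 2 ^ (2 * m + 1) *s sigma + 3 ^ m *s vector [2, -1, -1]"

definition perms :: "int ^ 3 \<Rightarrow> (int ^ 3) set" where
  "perms v = {\<chi> i. v $ p i | p. p permutes UNIV}"

definition Mplus_level :: "nat \<Rightarrow> (int ^ 3) set" where
  "Mplus_level n = (if even n then perms (kfreq (n div 2))
                    else perms (hfreq (n div 2)) \<union> perms (jfreq (n div 2)))"

definition Mplus :: "(int ^ 3) set" where
  "Mplus = (\<Union>n. Mplus_level n)"

definition Mfreq :: "(int ^ 3) set" where
  "Mfreq = Mplus \<union> uminus ` Mplus"

definition Pperp_sigma :: "int ^ 3 \<Rightarrow> real ^ 3" where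
  "Pperp_sigma k = rvec sigma - ((rvec k \<bullet> rvec sigma) / (norm (rvec k))\<^sup>2) *\<^sub>R rvec k"

definition vfreq :: "int ^ 3 \<Rightarrow> real ^ 3" where
  "vfreq k = Pperp_sigma k /\<^sub>R norm (Pperp_sigma k)"

definition HdotM :: "real \<Rightarrow> (real ^ 3 \<Rightarrow> real ^ 3) set" where
  "HdotM s = {u \<in> Hdot s. {k. fourier u k \<noteq> 0} \<subseteq> Mfreq \<and>
     (\<forall>k\<in>Mfreq. \<exists>c :: complex. fourier u k = c *s cvec (vfreq k))}"


section \<open>The equation\<close>

text \<open>Periodic distributions enter the equation through their Fourier coefficients, on which
  the projection and the semigroup are defined.\<close>

type_synonym coeffs = "int ^ 3 \<Rightarrow> complex ^ 3"

definition proj_M :: "coeffs \<Rightarrow> coeffs" where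
  "proj_M w k = (if k \<in> Mfreq
     then (\<Sum>i\<in>UNIV. of_real (vfreq k $ i) * w k $ i) *s cvec (vfreq k) else 0)"

text \<open>\<open>semigroup \<alpha> r\<close> is \<open>exp (- r (-\<Delta>)\<^sup>\<alpha>)\<close>; the viscosity is part of \<open>r\<close>.\<close>

definition semigroup :: "real \<Rightarrow> real \<Rightarrow> coeffs \<Rightarrow> coeffs" where
  "semigroup \<alpha> r w k = exp (- r * lap_symbol \<alpha> k) *\<^sub>R w k"

text \<open>The distribution \<open>\<nabla> \<cdot> (u \<otimes> u)\<close>, whose \<open>i\<close>-th component is \<open>\<Sum>j. \<partial>\<^sub>j (u\<^sub>j u\<^sub>i)\<close>, applied to
  a test function \<open>\<phi>\<close>.\<close>

definition div_tensor :: "(real ^ 3 \<Rightarrow> real ^ 3) \<Rightarrow> (real ^ 3 \<Rightarrow> complex) \<Rightarrow> complex ^ 3" where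
  "div_tensor u \<phi> = (\<chi> i. - (\<Sum>j\<in>UNIV. LINT x|torus.
     of_real (u x $ j * u x $ i) * frechet_derivative \<phi> (at x) (axis j 1)))"

definition advection :: "(real ^ 3 \<Rightarrow> real ^ 3) \<Rightarrow> coeffs" where
  "advection u k = div_tensor u (fchar k)"

text \<open>Membership in \<open>C([0,\<infinity>); HdotM s)\<close>.\<close>

definition continuous_HdotM :: "real \<Rightarrow> (real \<Rightarrow> real ^ 3 \<Rightarrow> real ^ 3) \<Rightarrow> bool" where
  "continuous_HdotM s u \<longleftrightarrow> (\<forall>t\<ge>0. u t \<in> HdotM s \<and>
     ((\<lambda>r. Hdot_norm s (\<lambda>x. u r x - u t x)) \<longlongrightarrow> 0) (at t within {0..}))"

text \<open>The Duhamel formula is an identity of periodic distributions: both sides are compared,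
  and the time integral is taken, in every Fourier coefficient.\<close>

definition global_mild_solution ::
  "real \<Rightarrow> real \<Rightarrow> real \<Rightarrow> (real ^ 3 \<Rightarrow> real ^ 3) \<Rightarrow> (real \<Rightarrow> real ^ 3 \<Rightarrow> real ^ 3) \<Rightarrow> bool" where
  "global_mild_solution \<alpha> \<nu> s u0 u \<longleftrightarrow> continuous_HdotM s u \<and> u 0 = u0 \<and>
     (\<forall>t>0. \<forall>k.
        set_integrable lborel {0..t}
          (\<lambda>\<tau>. semigroup \<alpha> (\<nu> * (t - \<tau>)) (proj_M (advection (u \<tau>))) k) \<and>
        fourier (u t) k = semigroup \<alpha> (\<nu> * t) (fourier u0) k
          - (LBINT \<tau>:{0..t}. semigroup \<alpha> (\<nu> * (t - \<tau>)) (proj_M (advection (u \<tau>))) k))"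

text \<open>Differentiability of order \<open>n\<close> with continuous derivatives, meant for open \<open>S\<close> in finite
  dimension, where continuity of all directional derivatives is continuity of the derivative.\<close>

fun Ck_on :: "nat \<Rightarrow> 'a::real_normed_vector set \<Rightarrow> ('a \<Rightarrow> 'b::real_normed_vector) \<Rightarrow> bool" where
  "Ck_on 0 S f \<longleftrightarrow> continuous_on S f"
| "Ck_on (Suc n) S f \<longleftrightarrow> (\<forall>x\<in>S. f differentiable (at x)) \<and>
     (\<forall>v. Ck_on n S (\<lambda>x. frechet_derivative f (at x) v))"

definition smooth_on :: "'a::real_normed_vector set \<Rightarrow> ('a \<Rightarrow> 'b::real_normed_vector) \<Rightarrow> bool" where
  "smooth_on S f \<longleftrightarrow> (\<forall>n. Ck_on n S f)"

definition crit_exp :: "real \<Rightarrow> real" where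
  "crit_exp \<alpha> = ln 3 / (2 * ln 2) - 2 * \<alpha>"

end

theory Submission
  imports Defs
begin

text \<open>The component of a frequency along \<open>\<sigma>\<close> is \<open>\<plusminus> 2 ^ n\<close> on the \<open>n\<close>-th shell, so a triad
  \<open>p + q = k\<close> in \<open>Mfreq\<close> joins neighbouring shells only, and there the advection couples with strength
  \<open>O(3 ^ (n / 2))\<close>. The equation becomes a quadratic system for scalar amplitudes, with damping
  \<open>\<nu> * 4 ^ (\<alpha> * n)\<close> and finitely many interactions for each frequency. If the critical norm is small compared
  with \<open>\<nu>\<close>, then a frequency envelope of the initial data is a supersolution of the stationary majorant
  equation, so that Picard iteration converges globally in time. Since \<open>2 * \<alpha> \<le> 1\<close>, the damping rates are
  subadditive along triads; half of the damping therefore survives as the decay factor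
  \<open>exp (- \<nu> * 4 ^ (\<alpha> * n) * t / 2)\<close>, and the solution is smooth for \<open>t > 0\<close>. The envelope
  also dominates the weighted sums uniformly in time, which gives continuity in the Sobolev norm. The
  nonlinear energy flux is bounded by the critical norm times the dissipation, hence the norms do not increase.\<close>

section \<open>The frequency shells\<close>

text \<open>Since 3 ^ (n / 2) = 4 ^ (n * \<open>crit_rate\<close>), the amplitude at which advection
  on shell n balances the damping has order \<nu> * 4 ^ (- n * (\<open>crit_rate\<close> -
  \<alpha>)), and this scaling fixes the critical exponent. The coupling is weak for a geometric
  reason: the distance of a frequency from the line of \<sigma> grows only like 3 ^ (n / 2), while
  its length grows like 2 ^ n, so neighbouring frequencies are nearly parallel and
  \<open>vfreq p\<close> is nearly orthogonal to all of them. The data may vanish on a shell whose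
  neighbours are large, yet every shell is fed by its neighbours. A supersolution therefore has to
  vary slowly, which is why the data are replaced by an envelope. Its ratio must beat the Sobolev
  weight, so it depends on s, and with it the smallness constant. Pointwise the envelope is
  controlled by the critical norm alone. This also suffices for the norm of order s, because only
  one of the three factors of the flux is measured by the envelope. No cancellation in the energy
  transfer is used, so all Sobolev orders from 0 to s are treated alike.\<close>

lemma perms_finite: "finite (perms v)"
proof -
  have "perms v = (\<lambda>p. \<chi> i. v $ p i) ` {p. p permutes UNIV}"
    by (auto simp: perms_def)
  then show ?thesis by (simp add: finite_permutations)
qed

lemma perms_card: "card (perms v) \<le> 6"
proof -
  have "perms v = (\<lambda>p. \<chi> i. v $ p i) ` {p. p permutes UNIV}"
    by (auto simp: perms_def)
  moreover have "card {p :: 3 \<Rightarrow> 3. p permutes UNIV} = 6"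
    using card_permutations[of "UNIV :: 3 set" 3] by (simp add: fact_numeral)
  ultimately show ?thesis
    by (metis card_image_le finite_permutations finite_code)
qed

definition shell :: "nat \<Rightarrow> (int ^ 3) set" where
  "shell n = Mplus_level n \<union> uminus ` Mplus_level n"

lemma finite_shell: "finite (shell n)"
  by (simp add: shell_def Mplus_level_def perms_finite)

text \<open>An odd level consists of two permutation classes with at most 6 elements each; the sign
  doubles the 12.\<close>

lemma card_shell: "card (shell n) \<le> 24"
proof -
  have "card (Mplus_level n) \<le> 12"
    using perms_card[of "kfreq (n div 2)"] perms_card[of "hfreq (n div 2)"]
      perms_card[of "jfreq (n div 2)"] card_Un_le[of "perms (hfreq (n div 2))" "perms (jfreq (n div 2))"]
    by (simp add: Mplus_level_def)
  moreover have "card (uminus ` Mplus_level n) \<le> card (Mplus_level n)"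
    by (rule card_image_le) (simp add: Mplus_level_def perms_finite)
  ultimately show ?thesis
    using card_Un_le[of "Mplus_level n" "uminus ` Mplus_level n"] by (simp add: shell_def)
qed

lemma Mfreq_eq: "Mfreq = (\<Union>n. shell n)"
  by (auto simp: Mfreq_def Mplus_def shell_def)

lemma shell_subset: "shell n \<subseteq> Mfreq"
  by (auto simp: Mfreq_eq)

lemma uminus_shell: "k \<in> shell n \<Longrightarrow> - k \<in> shell n"
  by (auto simp: shell_def)

lemma uminus_shell_iff: "- k \<in> shell n \<longleftrightarrow> k \<in> shell n"
  using uminus_shell[of k n] uminus_shell[of "-k" n] by auto

lemma uminus_image_shell: "uminus ` shell n = shell n"
proof -
  have "x \<in> uminus ` shell n" if "x \<in> shell n" for x
    using uminus_shell[OF that] by (intro image_eqI[of x uminus "-x"]) simp_all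
  then show ?thesis by (auto intro: uminus_shell)
qed

lemma perms_sum:
  assumes "k \<in> perms v"
  shows "(\<Sum>i\<in>UNIV. f (k $ i)) = (\<Sum>i\<in>UNIV. f (v $ i))"
proof -
  obtain p where p: "p permutes UNIV" "k = (\<chi> i. v $ p i)" using assms by (auto simp: perms_def)
  show ?thesis using sum.permute[OF p(1), of "\<lambda>i. f (v $ i)"] by (simp add: p(2) o_def)
qed

text \<open>Besides finiteness and symmetry, the only properties of the frequencies that the proof uses:
  the component along \<open>\<sigma>\<close> and the length depend only on the level (up to sign).\<close>

lemma Mplus_level_sums:
  assumes "k \<in> Mplus_level n"
  shows "(\<Sum>i\<in>UNIV. k $ i) = 3 * 2 ^ n" and "(\<Sum>i\<in>UNIV. (k $ i)\<^sup>2) = 3 * 4 ^ n + 2 * 3 ^ n"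
proof -
  define m where "m = n div 2"
  \<comment> \<open>In x and y all entries are linear, and the claims become polynomial identities
    in which the mixed terms cancel, such as (x + y)^2 + x^2 + (x - y)^2 = 3 x^2 + 2 y^2.\<close>
  define x y :: int where "x = 2 ^ (2 * m)" and "y = 3 ^ m"
  have "(4::int) ^ (2 * m) = (2 ^ 2) ^ (2 * m)" by simp
  also have "\<dots> = x\<^sup>2" unfolding x_def by (simp only: power_mult[symmetric] mult.commute)
  finally have 4: "(4::int) ^ (2 * m) = x\<^sup>2" .
  have 3: "(3::int) ^ (2 * m) = y\<^sup>2" unfolding y_def by (simp only: power_mult[symmetric] mult.commute)
  have xy: "(2::int) ^ (2 * m) = x" "(3::int) ^ m = y" by (simp_all only: x_def y_def)
  have k: "kfreq m $ 1 = x + y" "kfreq m $ 2 = x" "kfreq m $ 3 = x - y"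
    and h: "hfreq m $ 1 = 2 * x + y" "hfreq m $ 2 = 2 * x + y" "hfreq m $ 3 = 2 * x - 2 * y"
    and j: "jfreq m $ 1 = 2 * x + 2 * y" "jfreq m $ 2 = 2 * x - y" "jfreq m $ 3 = 2 * x - y"
    by (simp_all add: kfreq_def hfreq_def jfreq_def sigma_def power_add xy)
  have e: "(2::int) ^ (2 * m + 1) = 2 * x" "(3::int) ^ (2 * m + 1) = 3 * y\<^sup>2" "(4::int) ^ (2 * m + 1) = 4 * x\<^sup>2"
    unfolding power_add power_one_right 3 4 xy by simp_all
  have "(\<Sum>i\<in>UNIV. k $ i) = 3 * 2 ^ n \<and> (\<Sum>i\<in>UNIV. (k $ i)\<^sup>2) = 3 * 4 ^ n + 2 * 3 ^ n"
  proof (cases "even n")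
    case True
    then have n: "n = 2 * m" by (simp add: m_def)
    have "k \<in> perms (kfreq m)" using assms True by (simp add: Mplus_level_def m_def)
    then have *: "(\<Sum>i\<in>UNIV. f (k $ i)) = (\<Sum>i\<in>UNIV. f (kfreq m $ i))" for f :: "int \<Rightarrow> int"
      by (rule perms_sum)
    show ?thesis
      unfolding *[of "\<lambda>x. x"] *[of "\<lambda>x. x\<^sup>2"] n
      by (simp only: sum_3 k e 3 4 xy) (simp add: power2_eq_square algebra_simps)
  next
    case False
    then have n: "n = 2 * m + 1" by (simp add: m_def)
    have "k \<in> perms (hfreq m) \<or> k \<in> perms (jfreq m)" using assms False by (auto simp: Mplus_level_def m_def)
    then show ?thesis
    proof
      assume "k \<in> perms (hfreq m)"
      then have *: "(\<Sum>i\<in>UNIV. f (k $ i)) = (\<Sum>i\<in>UNIV. f (hfreq m $ i))" for f :: "int \<Rightarrow> int"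
        by (rule perms_sum)
      show ?thesis
        unfolding *[of "\<lambda>x. x"] *[of "\<lambda>x. x\<^sup>2"] n
        by (simp only: sum_3 h e 3 4 xy) (simp add: power2_eq_square algebra_simps)
    next
      assume "k \<in> perms (jfreq m)"
      then have *: "(\<Sum>i\<in>UNIV. f (k $ i)) = (\<Sum>i\<in>UNIV. f (jfreq m $ i))" for f :: "int \<Rightarrow> int"
        by (rule perms_sum)
      show ?thesis
        unfolding *[of "\<lambda>x. x"] *[of "\<lambda>x. x\<^sup>2"] n
        by (simp only: sum_3 j e 3 4 xy) (simp add: power2_eq_square algebra_simps)
    qed
  qed
  then show "(\<Sum>i\<in>UNIV. k $ i) = 3 * 2 ^ n" "(\<Sum>i\<in>UNIV. (k $ i)\<^sup>2) = 3 * 4 ^ n + 2 * 3 ^ n" by auto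
qed

lemma shell_sums:
  assumes "k \<in> shell n"
  shows "(\<Sum>i\<in>UNIV. k $ i) = 3 * 2 ^ n \<or> (\<Sum>i\<in>UNIV. k $ i) = - (3 * 2 ^ n)"
    and "(\<Sum>i\<in>UNIV. (k $ i)\<^sup>2) = 3 * 4 ^ n + 2 * 3 ^ n"
proof -
  consider "k \<in> Mplus_level n" | "- k \<in> Mplus_level n" using assms by (auto simp: shell_def)
  then have "((\<Sum>i\<in>UNIV. k $ i) = 3 * 2 ^ n \<or> (\<Sum>i\<in>UNIV. k $ i) = - (3 * 2 ^ n)) \<and>
    (\<Sum>i\<in>UNIV. (k $ i)\<^sup>2) = 3 * 4 ^ n + 2 * 3 ^ n"
    by cases (use Mplus_level_sums[of k n] Mplus_level_sums[of "-k" n] in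
      \<open>simp_all add: sum_negf equation_minus_iff\<close>)
  then show "(\<Sum>i\<in>UNIV. k $ i) = 3 * 2 ^ n \<or> (\<Sum>i\<in>UNIV. k $ i) = - (3 * 2 ^ n)"
    and "(\<Sum>i\<in>UNIV. (k $ i)\<^sup>2) = 3 * 4 ^ n + 2 * 3 ^ n" by auto
qed

lemma shell_level_unique:
  assumes "k \<in> shell m" "k \<in> shell n"
  shows "m = n"
proof -
  have "(2::int) ^ m = 2 ^ n" 
    using shell_sums(1)[OF assms(1)] shell_sums(1)[OF assms(2)] zero_less_power[of "2::int" m]
      zero_less_power[of "2::int" n] by linarith
  then show ?thesis by simp
qed

lemma zero_notin_shell: "0 \<notin> shell n"
  using shell_sums(1)[of 0 n] by auto

lemma zero_notin_Mfreq: "0 \<notin> Mfreq"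
  by (simp add: Mfreq_eq zero_notin_shell)

text \<open>Off \<open>Mfreq\<close> the value is unspecified, but it is still a natural number and
  still the same for k and - k (\<open>level_uminus\<close>), so that quantities built from it keep
  their sign and symmetry for every k.\<close>

definition level :: "int ^ 3 \<Rightarrow> nat" where
  "level k = (THE n. k \<in> shell n)"

lemma level_eq: "k \<in> shell n \<Longrightarrow> level k = n"
  unfolding level_def by (rule the_equality) (auto dest: shell_level_unique)

lemma level_shell: "k \<in> Mfreq \<Longrightarrow> k \<in> shell (level k)"
  by (auto simp: Mfreq_eq level_eq)

text \<open>For a \<le> b the sum exceeds 2 ^ b, so it is at least 2 ^ (b + 1), while it is at most
  2 * 2 ^ b. Equality must hold throughout.\<close>

lemma two_power_add:
  assumes "(2::int) ^ a + 2 ^ b = 2 ^ c"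
  shows "a = b" "c = Suc a"
proof -
  have *: "a = b \<and> c = Suc a" if le: "a \<le> b" and eq: "(2::int) ^ a + 2 ^ b = 2 ^ c" for a b c
  proof -
    have "(2::int) ^ b < 2 ^ c" using eq zero_less_power[of "2::int" a] by linarith
    then have "Suc b \<le> c" by simp
    then have 1: "(2::int) ^ Suc b \<le> 2 ^ c" by (rule power_increasing) simp
    have 2: "(2::int) ^ a \<le> 2 ^ b" using le by simp
    have "(2::int) ^ a = 2 ^ b" "(2::int) ^ c = 2 ^ Suc b" using 1 2 eq unfolding power_Suc by linarith+
    then show ?thesis by (simp del: power_Suc)
  qed
  show "a = b" "c = Suc a" using *[of a b c] *[of b a c] assms by (cases "a \<le> b"; simp add: add.commute)+
qed

text \<open>Summing the entries turns the triad into an identity between signed powers of two.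
  Moving the negative terms across leaves one power as the sum of the other two, so the highest
  shell lies exactly one above the other two, which coincide.\<close>

lemma triad_levels:
  assumes "p \<in> shell a" "q \<in> shell b" "p + q \<in> shell c"
  shows "(a = b \<and> c = Suc a) \<or> (b = c \<and> a = Suc c) \<or> (a = c \<and> b = Suc c)"
proof -
  have s: "(\<Sum>i\<in>UNIV. (p + q) $ i) = (\<Sum>i\<in>UNIV. p $ i) + (\<Sum>i\<in>UNIV. q $ i)"
    by (simp add: sum.distrib)
  have pos: "(2::int) ^ a > 0" "(2::int) ^ b > 0" "(2::int) ^ c > 0" by simp_all
  consider "(2::int) ^ a + 2 ^ b = 2 ^ c" | "(2::int) ^ b + 2 ^ c = 2 ^ a" | "(2::int) ^ a + 2 ^ c = 2 ^ b"
    using shell_sums(1)[OF assms(1)] shell_sums(1)[OF assms(2)] shell_sums(1)[OF assms(3)] s pos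
    by linarith
  then show ?thesis
    by cases (auto dest: two_power_add)
qed

section \<open>Lengths, angles and directions of the frequencies\<close>

lemma rvec_uminus: "rvec (- k) = - rvec k"
  and rvec_add: "rvec (k + l) = rvec k + rvec l"
  and rvec_zero: "rvec 0 = 0"
  by (simp_all add: rvec_def vec_eq_iff)

lemma rvec_eq_0_iff: "rvec k = 0 \<longleftrightarrow> k = 0"
  by (simp add: rvec_def vec_eq_iff)

lemma rvec_sigma: "rvec k \<bullet> rvec sigma = of_int (\<Sum>i\<in>UNIV. k $ i)"
  by (simp add: rvec_def inner_vec_def sum_3 sigma_def)

lemma sigma_sigma: "rvec sigma \<bullet> rvec sigma = 3"
  by (simp add: rvec_def inner_vec_def sum_3 sigma_def)

lemma inner_rvec_sigma_shell:
  assumes "k \<in> shell n"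
  shows "(rvec k \<bullet> rvec sigma)\<^sup>2 = 9 * 4 ^ n"
proof -
  have 1: "((2::real) ^ n)\<^sup>2 = 4 ^ n" by (simp add: power2_eq_square flip: power_mult_distrib)
  have "rvec k \<bullet> rvec sigma = 3 * 2 ^ n \<or> rvec k \<bullet> rvec sigma = - (3 * 2 ^ n)"
    using shell_sums(1)[OF assms] unfolding rvec_sigma by (elim disjE) simp_all
  then show ?thesis by (elim disjE) (simp_all add: power_mult_distrib 1)
qed

lemma norm_rvec_shell:
  assumes "k \<in> shell n"
  shows "(norm (rvec k))\<^sup>2 = 3 * 4 ^ n + 2 * 3 ^ n"
proof -
  have "(norm (rvec k))\<^sup>2 = of_int (\<Sum>i\<in>UNIV. (k $ i)\<^sup>2)"
    unfolding power2_norm_eq_inner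
    by (simp add: rvec_def inner_vec_def power2_eq_square)
  then show ?thesis using shell_sums(2)[OF assms] by simp
qed

text \<open>Pythagoras: the squared length of k is 3 * 4 ^ n along \<sigma> plus 2 * 3 ^ n across
  it. The value, of order (3 / 4) ^ n, is three times the squared sine of the angle between k and
  \<sigma>.\<close>

lemma norm_Pperp_sigma:
  assumes "k \<in> shell n"
  shows "(norm (Pperp_sigma k))\<^sup>2 = 6 * 3 ^ n / (3 * 4 ^ n + 2 * 3 ^ n)"
proof -
  define N where "N = (3 * 4 ^ n + 2 * 3 ^ n :: real)"
  have N: "N > 0" unfolding N_def by (intro add_pos_pos) auto
  have k: "(norm (rvec k))\<^sup>2 = N" "rvec k \<bullet> rvec k = N"
    using norm_rvec_shell[OF assms] by (simp_all add: N_def power2_norm_eq_inner)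
  have "(norm (Pperp_sigma k))\<^sup>2 = 3 - (rvec k \<bullet> rvec sigma)\<^sup>2 / N"
    unfolding power2_norm_eq_inner Pperp_sigma_def using N
    by (simp add: inner_diff_left inner_diff_right k sigma_sigma inner_commute power2_eq_square)
  also have "\<dots> = (3 * N - 9 * 4 ^ n) / N" using N inner_rvec_sigma_shell[OF assms]
    by (simp add: field_simps)
  also have "\<dots> = 6 * 3 ^ n / N" by (simp add: N_def)
  finally show ?thesis by (simp add: N_def)
qed

lemma Pperp_sigma_nz: "k \<in> shell n \<Longrightarrow> Pperp_sigma k \<noteq> 0"
  using norm_Pperp_sigma[of k n] by (auto simp: divide_eq_0_iff add_nonneg_eq_0_iff)

lemma norm_vfreq: "k \<in> Mfreq \<Longrightarrow> norm (vfreq k) = 1"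
  using Pperp_sigma_nz by (auto simp: vfreq_def Mfreq_eq)

lemma vfreq_uminus: "vfreq (- k) = vfreq k"
  by (simp add: vfreq_def Pperp_sigma_def rvec_uminus)

text \<open>Decompose \<open>k\<close> along \<open>\<sigma>\<close>: the parallel part is tested against \<open>\<sigma> \<bullet> vfreq p = |Pperp_sigma p|\<close>,
  and the perpendicular part has length \<open>sqrt (2 * 3 ^ n)\<close>.\<close>

lemma inner_vfreq_bound:
  assumes p: "p \<in> shell a" and k: "k \<in> shell n" and le: "n \<le> Suc a"
  shows "\<bar>rvec k \<bullet> vfreq p\<bar> \<le> 6 * sqrt (3 ^ a)"
proof -
  define P where "P = Pperp_sigma p"
  have Pn: "norm P > 0" using Pperp_sigma_nz[OF p] by (simp add: P_def)
  have pp: "rvec p \<bullet> rvec p \<noteq> 0" using p zero_notin_shell by (auto simp: rvec_eq_0_iff)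
  have orth: "rvec p \<bullet> P = 0" using pp
    by (simp add: P_def Pperp_sigma_def inner_diff_right power2_norm_eq_inner)
  have "P \<bullet> P = rvec sigma \<bullet> P - ((rvec p \<bullet> rvec sigma) / (norm (rvec p))\<^sup>2) * (rvec p \<bullet> P)"
    by (subst (1) P_def) (simp add: Pperp_sigma_def inner_diff_left)
  then have sP: "rvec sigma \<bullet> P = (norm P)\<^sup>2" using orth by (simp add: power2_norm_eq_inner)
  define e where "e = (rvec k \<bullet> rvec sigma) / 3"
  define r where "r = rvec k - e *\<^sub>R rvec sigma"
  have e2: "e\<^sup>2 = 4 ^ n" using inner_rvec_sigma_shell[OF k] by (simp add: e_def power_divide)
  have "(norm r)\<^sup>2 = (norm (rvec k))\<^sup>2 - 3 * e\<^sup>2"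
    unfolding power2_norm_eq_inner r_def
    by (simp add: inner_diff_left inner_diff_right sigma_sigma inner_commute e_def power2_eq_square)
  then have "(norm r)\<^sup>2 = 2 * 3 ^ n" using e2 norm_rvec_shell[OF k] by simp
  also have "\<dots> \<le> 2 * 3 ^ Suc a" using le power_increasing[OF le, of "3::real"] by simp
  also have "\<dots> \<le> (3 * sqrt (3 ^ a))\<^sup>2" by (simp add: power_mult_distrib)
  finally have r: "norm r \<le> 3 * sqrt (3 ^ a)" by (rule power2_le_imp_le) simp
  have "(e * norm P)\<^sup>2 = 4 ^ n * (6 * 3 ^ a / (3 * 4 ^ a + 2 * 3 ^ a))"
    using e2 norm_Pperp_sigma[OF p] by (simp add: P_def power_mult_distrib)
  \<comment> \<open>This equals 8 * 3 ^ a, and the squared perpendicular part was at most 6 * 3 ^ a.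
    Both are rounded up to 9 * 3 ^ a, and the two square roots add up to the factor 6.\<close>
  also have "\<dots> \<le> 4 ^ Suc a * (6 * 3 ^ a / (3 * 4 ^ a))"
    using le by (intro mult_mono power_increasing divide_left_mono mult_pos_pos) (auto intro: add_pos_pos)
  also have "\<dots> \<le> (3 * sqrt (3 ^ a))\<^sup>2" by (simp add: power_mult_distrib)
  finally have "\<bar>e * norm P\<bar>\<^sup>2 \<le> (3 * sqrt (3 ^ a))\<^sup>2" by simp
  then have e: "\<bar>e * norm P\<bar> \<le> 3 * sqrt (3 ^ a)" by (rule power2_le_imp_le) simp
  have "rvec k \<bullet> vfreq p = e * (rvec sigma \<bullet> vfreq p) + r \<bullet> vfreq p"
    by (simp add: r_def inner_diff_left)
  moreover have "rvec sigma \<bullet> vfreq p = norm P" using Pn sP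
    by (simp add: vfreq_def P_def[symmetric] power2_eq_square)
  moreover have "\<bar>r \<bullet> vfreq p\<bar> \<le> norm r"
    using Cauchy_Schwarz_ineq2[of r "vfreq p"] norm_vfreq[of p] p shell_subset[of a] by auto
  ultimately have "rvec k \<bullet> vfreq p = e * norm P + r \<bullet> vfreq p" "\<bar>r \<bullet> vfreq p\<bar> \<le> norm r" by simp_all
  then show ?thesis using e r by linarith
qed

text \<open>The eigenvalue of minus the Laplacian on the n-th shell.\<close>

definition lam :: "nat \<Rightarrow> real" where
  "lam n = 4 * pi\<^sup>2 * (3 * 4 ^ n + 2 * 3 ^ n)"

lemma lap_symbol_shell: "k \<in> shell n \<Longrightarrow> lap_symbol a k = lam n powr a"
  by (simp add: lap_symbol_def lam_def norm_rvec_shell)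

lemma lam_ge: "4 ^ n \<le> lam n"
proof -
  have "(3::real) * 3 \<le> pi * pi" using pi_gt3 by (intro mult_mono) auto
  then have "1 \<le> 4 * pi\<^sup>2" by (simp add: power2_eq_square)
  then have "1 * (3 * 4 ^ n + 2 * 3 ^ n) \<le> 4 * pi\<^sup>2 * (3 * 4 ^ n + 2 * 3 ^ n)"
    by (rule mult_right_mono) simp
  moreover have "(4::real) ^ n \<le> 1 * (3 * 4 ^ n + 2 * 3 ^ n)" by simp
  ultimately show ?thesis unfolding lam_def by linarith
qed

lemma lam_le: "lam n \<le> 320 * 4 ^ n"
proof -
  have "pi * pi \<le> (4::real) * 4" using pi_less_4 by (intro mult_mono) auto
  then have "4 * pi\<^sup>2 \<le> 64" by (simp add: power2_eq_square)
  moreover have "(3::real) ^ n \<le> 4 ^ n" by (rule power_mono) auto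
  ultimately have "4 * pi\<^sup>2 * (3 * 4 ^ n + 2 * 3 ^ n) \<le> 64 * (5 * 4 ^ n)"
    by (intro mult_mono) auto
  then show ?thesis by (simp add: lam_def)
qed

lemma lam_ge_1: "1 \<le> lam n"
  using lam_ge[of n] one_le_power[of "4::real" n] by linarith

lemma lam_pos: "0 < lam n"
  using lam_ge_1[of n] by linarith

lemma lam_Suc_le: "lam (Suc n) \<le> 4 * lam n"
  by (simp add: lam_def)

lemma lam_mono: "m \<le> n \<Longrightarrow> lam m \<le> lam n"
  by (simp add: lam_def add_mono)

text \<open>Unless c is the top shell, monotonicity is enough. If c lies one above a = b, the
  eigenvalue at most quadruples, and the bound \<alpha> \<le> 1 / 2 is exactly what makes 4 powr
  \<alpha> at most 2.\<close>

lemma lam_powr_triad: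
  assumes "p \<in> shell a" "q \<in> shell b" "p + q \<in> shell c" and \<alpha>: "0 \<le> \<alpha>" "\<alpha> \<le> 1 / 2"
  shows "lam c powr \<alpha> \<le> lam a powr \<alpha> + lam b powr \<alpha>"
proof -
  have mono: "lam c powr \<alpha> \<le> lam n powr \<alpha>" if "c \<le> n" for n
    using lam_mono[OF that] lam_pos[of c] \<alpha> by (intro powr_mono2) auto
  have nn: "0 \<le> lam n powr \<alpha>" for n by simp
  have "lam (Suc a) powr \<alpha> \<le> (4 * lam a) powr \<alpha>"
    using lam_Suc_le lam_pos[of "Suc a"] \<alpha> by (intro powr_mono2) auto
  also have "\<dots> = 4 powr \<alpha> * lam a powr \<alpha>" using lam_pos[of a] by (simp add: powr_mult)
  also have "4 powr \<alpha> \<le> 4 powr (1 / 2)" using \<alpha> by (intro powr_mono) auto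
  also have "(4::real) powr (1 / 2) = 2" using powr_half_sqrt[of 4] by simp
  finally have "lam (Suc a) powr \<alpha> \<le> lam a powr \<alpha> + lam a powr \<alpha>" using nn by (simp add: mult_right_mono)
  then show ?thesis
    using triad_levels[OF assms(1-3)] mono[of a] mono[of b] nn[of a] nn[of b] by auto
qed

section \<open>Picard iteration for damped quadratic systems\<close>

lemma integral_has_vector_derivative_Ici:
  fixes g :: "real \<Rightarrow> 'a::banach"
  assumes "continuous_on {0..} g" "0 \<le> t"
  shows "((\<lambda>t. integral {0..t} g) has_vector_derivative g t) (at t within {0..})"
proof -
  have "((\<lambda>t. integral {0..t} g) has_vector_derivative g t) (at t within {0..t + 1})"
    using assms by (intro integral_has_vector_derivative continuous_on_subset[OF assms(1)]) auto
  moreover have "at t within {0..t + 1} = at t within {0..}"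
    by (rule at_within_nhd[of _ "{..<t + 1}"]) auto
  ultimately show ?thesis by simp
qed

lemma continuous_on_integral_Ici:
  fixes g :: "real \<Rightarrow> 'a::banach"
  assumes "continuous_on {0..} g"
  shows "continuous_on {0..} (\<lambda>t. integral {0..t} g)"
  using integral_has_vector_derivative_Ici[OF assms]
  by (auto simp: continuous_on_eq_continuous_within intro: has_vector_derivative_continuous)

text \<open>The full damping acts on a forcing that decays at half its rate. The integral of exp (d
  * \<tau> / 2) is explicit, and dropping its lower boundary term leaves 2 / d and the half rate. So
  the half rate reproduces itself under the Duhamel map.\<close>

lemma damped_integral_bound:
  fixes h :: "real \<Rightarrow> 'a::banach"
  assumes d: "0 < d" and t: "0 \<le> t" and h: "continuous_on {0..t} h"
    and bound: "\<And>\<tau>. \<tau> \<in> {0..t} \<Longrightarrow> norm (h \<tau>) \<le> H * exp (- (d * \<tau> / 2))" and H: "0 \<le> H"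
  shows "norm (exp (- (d * t)) *\<^sub>R integral {0..t} (\<lambda>\<tau>. exp (d * \<tau>) *\<^sub>R h \<tau>)) \<le> 2 / d * H * exp (- (d * t / 2))"
proof -
  define E where "E = exp (d * t / 2)"
  have E: "E > 0" by (simp add: E_def)
  have "((\<lambda>\<tau>. H * exp (d * \<tau> / 2)) has_integral (H * (2 / d * exp (d * t / 2)) - H * (2 / d * exp (d * 0 / 2)))) {0..t}"
    using d t by (intro fundamental_theorem_of_calculus)
      (auto intro!: derivative_eq_intros simp flip: has_real_derivative_iff_has_vector_derivative)
  then have I: "(\<lambda>\<tau>. H * exp (d * \<tau> / 2)) integrable_on {0..t}"
    "integral {0..t} (\<lambda>\<tau>. H * exp (d * \<tau> / 2)) = H * (2 / d * E) - H * (2 / d)"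
    by (simp_all add: has_integral_integrable_integral E_def)
  have "norm (integral {0..t} (\<lambda>\<tau>. exp (d * \<tau>) *\<^sub>R h \<tau>)) \<le> integral {0..t} (\<lambda>\<tau>. H * exp (d * \<tau> / 2))"
  proof (rule integral_norm_bound_integral[OF _ I(1)])
    show "(\<lambda>\<tau>. exp (d * \<tau>) *\<^sub>R h \<tau>) integrable_on {0..t}"
      by (intro integrable_continuous_interval continuous_intros h)
    fix \<tau> assume \<tau>: "\<tau> \<in> {0..t}"
    have "norm (exp (d * \<tau>) *\<^sub>R h \<tau>) \<le> exp (d * \<tau>) * (H * exp (- (d * \<tau> / 2)))"
      using bound[OF \<tau>] by simp
    also have "\<dots> = H * (exp (d * \<tau>) * exp (- (d * \<tau> / 2)))" by simp
    also have "exp (d * \<tau>) * exp (- (d * \<tau> / 2)) = exp (d * \<tau> / 2)"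
      by (simp flip: exp_add)
    finally show "norm (exp (d * \<tau>) *\<^sub>R h \<tau>) \<le> H * exp (d * \<tau> / 2)" .
  qed
  also have "\<dots> = 2 / d * H * E - H * (2 / d)" using I(2) by simp
  also have "\<dots> \<le> 2 / d * H * E" using d H by simp
  finally have *: "norm (integral {0..t} (\<lambda>\<tau>. exp (d * \<tau>) *\<^sub>R h \<tau>)) \<le> 2 / d * H * E" .
  have e: "exp (- (d * t)) * E = exp (- (d * t / 2))" by (simp add: E_def flip: exp_add)
  have "norm (exp (- (d * t)) *\<^sub>R integral {0..t} (\<lambda>\<tau>. exp (d * \<tau>) *\<^sub>R h \<tau>)) \<le> exp (- (d * t)) * (2 / d * H * E)"
    unfolding norm_scaleR using * by (simp only: abs_exp_cancel mult_le_cancel_left_pos exp_gt_zero)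
  also have "\<dots> = 2 / d * H * (exp (- (d * t)) * E)" by simp
  finally show ?thesis unfolding e .
qed

text \<open>Damped quadratic systems \<open>c\<^sub>k' = - d\<^sub>k c\<^sub>k - \<Sum>(p,q)\<in>T\<^sub>k. B\<^sub>k\<^sub>p\<^sub>q c\<^sub>p c\<^sub>q\<close> are solved by Picard
  iteration. Cauchy's method of majorants: if \<open>A\<close> is a supersolution of the stationary majorant
  equation, it dominates the iterates, with half of the damping as decay rate.\<close>

locale quadratic_system =
  fixes T :: "'k \<Rightarrow> ('k \<times> 'k) set" and B :: "'k \<Rightarrow> 'k \<Rightarrow> 'k \<Rightarrow> complex"
    and d :: "'k \<Rightarrow> real" and c0 :: "'k \<Rightarrow> complex" and A :: "'k \<Rightarrow> real"
  assumes finite_T: "finite (T k)"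
    and d_pos: "0 < d k"
    and d_triad: "(p, q) \<in> T k \<Longrightarrow> d k \<le> d p + d q"
    and supersolution: "norm (c0 k) + 2 / d k * (\<Sum>(p, q)\<in>T k. norm (B k p q) * (A p * A q)) \<le> A k"
    and A_nonneg: "0 \<le> A k"
begin

definition nonlin :: "('k \<Rightarrow> real \<Rightarrow> complex) \<Rightarrow> 'k \<Rightarrow> real \<Rightarrow> complex" where
  "nonlin f k t = (\<Sum>(p, q)\<in>T k. B k p q * (f p t * f q t))"

text \<open>The damping factor stands outside the integral, so that t enters the integral only
  through its upper limit; continuity and differentiability then come from the fundamental theorem
  of calculus.\<close>

definition duhamel :: "('k \<Rightarrow> real \<Rightarrow> complex) \<Rightarrow> 'k \<Rightarrow> real \<Rightarrow> complex" where
  "duhamel f k t = exp (- (d k * t)) *\<^sub>R (c0 k - integral {0..t} (\<lambda>\<tau>. exp (d k * \<tau>) *\<^sub>R nonlin f k \<tau>))"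

primrec picard :: "nat \<Rightarrow> 'k \<Rightarrow> real \<Rightarrow> complex" where
  "picard 0 = (\<lambda>k t. 0)"
| "picard (Suc j) = duhamel (picard j)"

text \<open>Picard iteration for the time-independent majorant equation. The factor 2 / d k is the
  one from \<open>damped_integral_bound\<close>.\<close>

primrec majorant :: "nat \<Rightarrow> 'k \<Rightarrow> real" where
  "majorant 0 = (\<lambda>k. 0)"
| "majorant (Suc j) = (\<lambda>k. norm (c0 k) +
     2 / d k * (\<Sum>(p, q)\<in>T k. norm (B k p q) * (majorant j p * majorant j q)))"

definition solution :: "'k \<Rightarrow> real \<Rightarrow> complex" where
  "solution k t = lim (\<lambda>j. picard j k t)"

section \<open>Comparison of the Picard iterates with the majorant\<close>

lemma continuous_on_nonlin:
  "(\<And>k. continuous_on S (f k)) \<Longrightarrow> continuous_on S (nonlin f k)"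
  unfolding nonlin_def[abs_def] case_prod_beta by (intro continuous_intros)

lemma continuous_on_duhamel:
  assumes "\<And>k. continuous_on {0..} (f k)"
  shows "continuous_on {0..} (duhamel f k)"
  unfolding duhamel_def[abs_def]
  by (intro continuous_intros continuous_on_integral_Ici continuous_on_nonlin assms)

lemma continuous_on_picard: "continuous_on {0..} (picard j k)"
  by (induction j arbitrary: k) (simp_all add: continuous_on_duhamel)

text \<open>The difference of products splits as g p * (g q - f q) + (g p - f p) * f q, and the
  majorants recombine in the same way: b p * (b q - a q) + (b p - a p) * a q = b p * b q - a p * a
  q. By \<open>d_triad\<close> the two decay factors multiply to at most that of k. The lemma serves
  both for consecutive iterates and for an iterate against the limit.\<close>

lemma duhamel_diff:
  assumes f: "\<And>k. continuous_on {0..} (f k)" and g: "\<And>k. continuous_on {0..} (g k)"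
    and fb: "\<And>k t. 0 \<le> t \<Longrightarrow> norm (f k t) \<le> a k * exp (- (d k * t / 2))"
    and gb: "\<And>k t. 0 \<le> t \<Longrightarrow> norm (g k t) \<le> b k * exp (- (d k * t / 2))"
    and fg: "\<And>k t. 0 \<le> t \<Longrightarrow> norm (g k t - f k t) \<le> (b k - a k) * exp (- (d k * t / 2))"
    and a: "\<And>k. 0 \<le> a k" and ab: "\<And>k. a k \<le> b k" and t: "0 \<le> t"
  shows "norm (duhamel g k t - duhamel f k t)
    \<le> 2 / d k * (\<Sum>(p, q)\<in>T k. norm (B k p q) * (b p * b q - a p * a q)) * exp (- (d k * t / 2))"
proof -
  define S where "S = (\<Sum>(p, q)\<in>T k. norm (B k p q) * (b p * b q - a p * a q))"
  have b: "0 \<le> b k" for k using a[of k] ab[of k] by linarith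
  have ab2: "0 \<le> b p * b q - a p * a q" for p q
    using mult_mono[OF ab[of p] ab[of q] b a] by simp
  have S: "0 \<le> S" unfolding S_def using ab2 by (auto intro!: sum_nonneg)
  have cn: "continuous_on {0..} (\<lambda>\<tau>. exp (d k * \<tau>) *\<^sub>R nonlin f k \<tau>)" 
    "continuous_on {0..} (\<lambda>\<tau>. exp (d k * \<tau>) *\<^sub>R nonlin g k \<tau>)"
    by (intro continuous_intros continuous_on_nonlin f g)+
  have int: "(\<lambda>\<tau>. exp (d k * \<tau>) *\<^sub>R nonlin f k \<tau>) integrable_on {0..t}" 
    "(\<lambda>\<tau>. exp (d k * \<tau>) *\<^sub>R nonlin g k \<tau>) integrable_on {0..t}"
    by (intro integrable_continuous_interval continuous_on_subset[OF cn(1)] continuous_on_subset[OF cn(2)]; auto)+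
  have "duhamel f k t - duhamel g k t =
      exp (- (d k * t)) *\<^sub>R integral {0..t} (\<lambda>\<tau>. exp (d k * \<tau>) *\<^sub>R (nonlin g k \<tau> - nonlin f k \<tau>))"
    using int by (simp add: duhamel_def scaleR_diff_right integral_diff)
  moreover have "norm (exp (- (d k * t)) *\<^sub>R integral {0..t} (\<lambda>\<tau>. exp (d k * \<tau>) *\<^sub>R (nonlin g k \<tau> - nonlin f k \<tau>)))
      \<le> 2 / d k * S * exp (- (d k * t / 2))"
  proof (rule damped_integral_bound[OF d_pos t _ _ S])
    have "continuous_on {0..} (\<lambda>\<tau>. nonlin g k \<tau> - nonlin f k \<tau>)"
      by (intro continuous_intros continuous_on_nonlin f g)
    then show "continuous_on {0..t} (\<lambda>\<tau>. nonlin g k \<tau> - nonlin f k \<tau>)"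
      by (rule continuous_on_subset) auto
    fix \<tau> assume "\<tau> \<in> {0..t}"
    then have \<tau>: "0 \<le> \<tau>" by simp
    define E where "E p = exp (- (d p * \<tau> / 2))" for p
    have E: "0 \<le> E p" for p by (simp add: E_def)
    have "norm (B k p q * (g p \<tau> * g q \<tau>) - B k p q * (f p \<tau> * f q \<tau>))
        \<le> norm (B k p q) * (b p * b q - a p * a q) * E k" if pq: "(p, q) \<in> T k" for p q
    proof -
      have "g p \<tau> * g q \<tau> - f p \<tau> * f q \<tau> = g p \<tau> * (g q \<tau> - f q \<tau>) + (g p \<tau> - f p \<tau>) * f q \<tau>"
        by (simp add: algebra_simps)
      also have "norm \<dots> \<le> norm (g p \<tau>) * norm (g q \<tau> - f q \<tau>) + norm (g p \<tau> - f p \<tau>) * norm (f q \<tau>)"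
        by (metis norm_mult norm_triangle_ineq)
      also have "\<dots> \<le> (b p * E p) * ((b q - a q) * E q) + ((b p - a p) * E p) * (a q * E q)"
        unfolding E_def by (intro add_mono mult_mono fb gb fg \<tau>) (use a b ab in auto)
      also have "\<dots> = (b p * b q - a p * a q) * (E p * E q)" by (simp add: algebra_simps)
      also have "E p * E q \<le> E k"
      proof -
        have "d k * \<tau> \<le> (d p + d q) * \<tau>" using d_triad[OF pq] \<tau> by (rule mult_right_mono)
        then show ?thesis by (simp add: E_def algebra_simps flip: exp_add)
      qed
      finally have "norm (g p \<tau> * g q \<tau> - f p \<tau> * f q \<tau>) \<le> (b p * b q - a p * a q) * E k"
        using ab2 by (simp add: mult_left_mono)
      then have "norm (B k p q) * norm (g p \<tau> * g q \<tau> - f p \<tau> * f q \<tau>)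
          \<le> norm (B k p q) * ((b p * b q - a p * a q) * E k)" by (rule mult_left_mono) simp
      then show ?thesis by (simp add: norm_mult mult.assoc flip: right_diff_distrib)
    qed
    then have "norm (nonlin g k \<tau> - nonlin f k \<tau>) \<le> (\<Sum>(p, q)\<in>T k. norm (B k p q) * (b p * b q - a p * a q) * E k)"
      unfolding nonlin_def sum_subtractf[symmetric] by (intro sum_norm_le) auto
    then show "norm (nonlin g k \<tau> - nonlin f k \<tau>) \<le> S * exp (- (d k * \<tau> / 2))"
      by (simp add: S_def E_def sum_distrib_right case_prod_beta)
  qed
  ultimately show ?thesis by (simp add: S_def norm_minus_commute)
qed

text \<open>The majorant map is monotone on nonnegative functions. Its iterates from 0 therefore
  increase, and they stay below any supersolution.\<close>

lemma majorant_props: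
  "0 \<le> majorant j k" "majorant j k \<le> majorant (Suc j) k" "majorant j k \<le> A k"
proof -
  have "(\<forall>k. 0 \<le> majorant j k \<and> majorant j k \<le> majorant (Suc j) k \<and> majorant j k \<le> A k)"
  proof (induction j)
    case 0
    have "0 \<le> majorant (Suc 0) k" for k by simp
    then show ?case using A_nonneg by simp
  next
    case (Suc j)
    have d: "0 \<le> 2 / d k" for k using d_pos[of k] by simp
    define m where "m = majorant (Suc j)"
    have m: "majorant j k \<le> m k" "0 \<le> m k" and m0: "0 \<le> majorant j k" for k
      using Suc unfolding m_def by (meson order_trans)+
    have "m k \<le> norm (c0 k) + 2 / d k * (\<Sum>(p, q)\<in>T k. norm (B k p q) * (m p * m q))" for k
      by (subst m_def, subst majorant.simps, intro add_left_mono mult_left_mono d sum_mono)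
        (use m m0 in \<open>auto intro!: mult_left_mono mult_mono\<close>)
    then have 1: "majorant (Suc j) k \<le> majorant (Suc (Suc j)) k" for k
      unfolding majorant.simps(2)[of "Suc j"] m_def .
    have "majorant (Suc j) k \<le> norm (c0 k) + 2 / d k * (\<Sum>(p, q)\<in>T k. norm (B k p q) * (A p * A q))" for k
      unfolding majorant.simps
      by (intro add_left_mono mult_left_mono d sum_mono)
        (use Suc A_nonneg in \<open>auto intro!: mult_left_mono mult_mono simp del: majorant.simps\<close>)
    then have 2: "majorant (Suc j) k \<le> A k" for k using supersolution[of k] by (meson order_trans)
    have 3: "0 \<le> majorant (Suc j) k" for k using Suc by (meson order_trans)
    show ?case using 1 2 3 by blast
  qed
  then show "0 \<le> majorant j k" "majorant j k \<le> majorant (Suc j) k" "majorant j k \<le> A k" by auto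
qed

text \<open>The two bounds need a joint induction: adding the increment bound to the bound for the
  j-th iterate gives the next iterate, and the increments are controlled by both. At the start half
  of the damping of the free evolution is given away.\<close>

lemma picard_bounds:
  assumes "0 \<le> t"
  shows "norm (picard j k t) \<le> majorant j k * exp (- (d k * t / 2))"
    and "norm (picard (Suc j) k t - picard j k t) \<le> (majorant (Suc j) k - majorant j k) * exp (- (d k * t / 2))"
proof -
  have "(\<forall>k t. 0 \<le> t \<longrightarrow> norm (picard j k t) \<le> majorant j k * exp (- (d k * t / 2)) \<and>
     norm (picard (Suc j) k t - picard j k t) \<le> (majorant (Suc j) k - majorant j k) * exp (- (d k * t / 2)))"
  proof (induction j)
    case 0
    have "norm (exp (- (d k * t)) *\<^sub>R c0 k) \<le> norm (c0 k) * exp (- (d k * t / 2))" if "0 \<le> t" for k t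
      using d_pos[of k] that by (simp add: mult.commute mult_left_mono)
    then show ?case by (simp add: duhamel_def nonlin_def)
  next
    case (Suc j)
    have b: "norm (picard (Suc j) k t) \<le> majorant (Suc j) k * exp (- (d k * t / 2))" if "0 \<le> t" for k t
    proof -
      have "norm (picard (Suc j) k t) \<le> norm (picard j k t) + norm (picard (Suc j) k t - picard j k t)"
        by (metis add.commute diff_add_cancel norm_triangle_ineq)
      also have "\<dots> \<le> majorant j k * exp (- (d k * t / 2)) + (majorant (Suc j) k - majorant j k) * exp (- (d k * t / 2))"
        using Suc that by (intro add_mono) auto
      finally show ?thesis by (simp add: algebra_simps)
    qed
    have "norm (picard (Suc (Suc j)) k t - picard (Suc j) k t) \<le> (majorant (Suc (Suc j)) k - majorant (Suc j) k) * exp (- (d k * t / 2))"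
      if t: "0 \<le> t" for k t
    proof -
      have "norm (duhamel (picard (Suc j)) k t - duhamel (picard j) k t) \<le>
        2 / d k * (\<Sum>(p, q)\<in>T k. norm (B k p q) * (majorant (Suc j) p * majorant (Suc j) q - majorant j p * majorant j q)) * exp (- (d k * t / 2))"
        by (rule duhamel_diff[OF continuous_on_picard continuous_on_picard _ b _ majorant_props(1) majorant_props(2) t])
          (use Suc in \<open>auto simp del: picard.simps majorant.simps\<close>)
      also have "2 / d k * (\<Sum>(p, q)\<in>T k. norm (B k p q) * (majorant (Suc j) p * majorant (Suc j) q - majorant j p * majorant j q))
          = majorant (Suc (Suc j)) k - majorant (Suc j) k"
        unfolding majorant.simps(2)[of "Suc j"] majorant.simps(2)[of j, THEN fun_cong, of k]
        by (simp add: right_diff_distrib sum_subtractf case_prod_beta del: majorant.simps)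
      finally show ?thesis by simp
    qed
    then show ?case using b by blast
  qed
  then show "norm (picard j k t) \<le> majorant j k * exp (- (d k * t / 2))"
    and "norm (picard (Suc j) k t - picard j k t) \<le> (majorant (Suc j) k - majorant j k) * exp (- (d k * t / 2))"
    using assms by blast+
qed

section \<open>Passage to the limit in the Picard iteration\<close>

definition majorant_lim :: "'k \<Rightarrow> real" where
  "majorant_lim k = lim (\<lambda>j. majorant j k)"

lemma majorant_tendsto: "(\<lambda>j. majorant j k) \<longlonglongrightarrow> majorant_lim k"
proof -
  have "incseq (\<lambda>j. majorant j k)" by (intro incseq_SucI majorant_props)
  moreover have "bdd_above (range (\<lambda>j. majorant j k))" using majorant_props(3) by (auto intro!: bdd_aboveI)
  ultimately have "convergent (\<lambda>j. majorant j k)" by (auto simp: convergent_def intro: LIMSEQ_incseq_SUP)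
  then show ?thesis unfolding majorant_lim_def by (simp add: convergent_LIMSEQ_iff)
qed

lemma majorant_le_lim: "majorant j k \<le> majorant_lim k" and majorant_lim_le: "majorant_lim k \<le> A k"
proof -
  have "incseq (\<lambda>j. majorant j k)" by (intro incseq_SucI majorant_props)
  then show "majorant j k \<le> majorant_lim k" using majorant_tendsto by (rule incseq_le)
  show "majorant_lim k \<le> A k" using majorant_tendsto by (rule LIMSEQ_le_const2) (use majorant_props in blast)
qed

lemma picard_diff:
  assumes "0 \<le> t" "i \<le> j"
  shows "norm (picard j k t - picard i k t) \<le> (majorant j k - majorant i k) * exp (- (d k * t / 2))"
  using assms(2)
proof (induction j rule: dec_induct)
  case base show ?case by simp
next
  case (step j)
  have "norm (picard (Suc j) k t - picard i k t) \<le> norm (picard (Suc j) k t - picard j k t) + norm (picard j k t - picard i k t)"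
    by (metis diff_add_cancel add_diff_eq norm_triangle_ineq)
  also have "\<dots> \<le> (majorant (Suc j) k - majorant j k) * exp (- (d k * t / 2)) + (majorant j k - majorant i k) * exp (- (d k * t / 2))"
    using step picard_bounds(2)[OF assms(1)] by (intro add_mono) auto
  finally show ?case by (simp add: algebra_simps del: majorant.simps)
qed

text \<open>The increments are dominated by those of a bounded increasing real sequence. Convergence
  is thus obtained frequency by frequency, with no contraction constant and no norm on the space of
  sequences.\<close>

lemma picard_tendsto:
  assumes t: "0 \<le> t"
  shows "(\<lambda>j. picard j k t) \<longlonglongrightarrow> solution k t"
proof -
  have "Cauchy (\<lambda>j. picard j k t)"
  proof (rule metric_CauchyI)
    fix e :: real assume "0 < e"
    then obtain N where N: "\<And>m n. N \<le> m \<Longrightarrow> N \<le> n \<Longrightarrow> dist (majorant m k) (majorant n k) < e"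
      using metric_CauchyD[OF LIMSEQ_imp_Cauchy[OF majorant_tendsto[of k]]] by meson
    have *: "norm (picard j k t - picard i k t) < e" if "i \<le> j" "N \<le> i" for i j
    proof -
      have m: "0 \<le> majorant j k - majorant i k"
        using that incseq_SucI[of "\<lambda>j. majorant j k"] majorant_props(2) by (auto simp: incseq_def)
      have "norm (picard j k t - picard i k t) \<le> (majorant j k - majorant i k) * exp (- (d k * t / 2))"
        by (rule picard_diff[OF t that(1)])
      also have "\<dots> \<le> (majorant j k - majorant i k) * 1" using m d_pos[of k] t by (intro mult_left_mono) auto
      also have "\<dots> < e" using N[of j i] that by (simp add: dist_real_def)
      finally show ?thesis .
    qed
    show "\<exists>M. \<forall>m\<ge>M. \<forall>n\<ge>M. dist (picard m k t) (picard n k t) < e"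
    proof (intro exI allI impI)
      fix m n assume "N \<le> m" "N \<le> n"
      then show "dist (picard m k t) (picard n k t) < e"
        using *[of m n] *[of n m] by (cases "m \<le> n") (auto simp: dist_norm norm_minus_commute)
    qed
  qed
  then show ?thesis unfolding solution_def by (simp add: Cauchy_convergent_iff convergent_LIMSEQ_iff)
qed

lemma solution_picard_bound:
  assumes t: "0 \<le> t"
  shows "norm (solution k t - picard i k t) \<le> (majorant_lim k - majorant i k) * exp (- (d k * t / 2))"
proof (rule tendsto_le[OF sequentially_bot])
  show "(\<lambda>j. (majorant j k - majorant i k) * exp (- (d k * t / 2))) \<longlonglongrightarrow> (majorant_lim k - majorant i k) * exp (- (d k * t / 2))"
    by (intro tendsto_intros majorant_tendsto)
  show "(\<lambda>j. norm (picard j k t - picard i k t)) \<longlonglongrightarrow> norm (solution k t - picard i k t)"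
    by (intro tendsto_intros picard_tendsto t)
  show "\<forall>\<^sub>F j in sequentially. norm (picard j k t - picard i k t) \<le> (majorant j k - majorant i k) * exp (- (d k * t / 2))"
    using picard_diff[OF t] by (auto simp: eventually_sequentially)
qed

lemma solution_bound_lim: "0 \<le> t \<Longrightarrow> norm (solution k t) \<le> majorant_lim k * exp (- (d k * t / 2))"
  using solution_picard_bound[of t k 0] by simp

lemma solution_bound:
  assumes "0 \<le> t" 
  shows "norm (solution k t) \<le> A k * exp (- (d k * t / 2))"
  using solution_bound_lim[OF assms, of k] majorant_lim_le[of k]
  by (meson exp_ge_zero mult_right_mono order_trans)

lemma continuous_on_solution: "continuous_on {0..} (solution k)"
proof (rule uniform_limit_theorem)
  show "\<forall>\<^sub>F n in sequentially. continuous_on {0..} (picard n k)" by (simp add: continuous_on_picard)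
  show "uniform_limit {0..} (\<lambda>n. picard n k) (solution k) sequentially"
  proof (rule uniform_limitI)
    fix e :: real assume "0 < e"
    then have "\<forall>\<^sub>F j in sequentially. dist (majorant j k) (majorant_lim k) < e"
      using majorant_tendsto[of k] by (auto simp: tendsto_iff)
    then show "\<forall>\<^sub>F j in sequentially. \<forall>t\<in>{0..}. dist (picard j k t) (solution k t) < e"
    proof eventually_elim
      case (elim j)
      show ?case
      proof
        fix t :: real assume "t \<in> {0..}"
        then have t: "0 \<le> t" by simp
        have "norm (solution k t - picard j k t) \<le> (majorant_lim k - majorant j k) * exp (- (d k * t / 2))"
          by (rule solution_picard_bound[OF t])
        also have "\<dots> \<le> (majorant_lim k - majorant j k) * 1"
          using majorant_le_lim[of j k] d_pos[of k] t by (intro mult_left_mono) auto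
        also have "\<dots> < e" using elim by (simp add: dist_real_def)
        finally show "dist (picard j k t) (solution k t) < e" by (simp add: dist_norm norm_minus_commute)
      qed
    qed
  qed
qed simp

text \<open>\<open>duhamel_diff\<close> compares the limit with the j-th iterate. For fixed k and t
  its right-hand side is a finite sum of products of convergent majorants, so it tends to 0.\<close>

lemma solution_duhamel:
  assumes t: "0 \<le> t"
  shows "solution k t = duhamel solution k t"
proof -
  have "(\<lambda>j. picard (Suc j) k t) \<longlonglongrightarrow> duhamel solution k t"
  proof (rule LIM_zero_cancel, rule Lim_null_comparison)
    show "\<forall>\<^sub>F j in sequentially. norm (picard (Suc j) k t - duhamel solution k t) \<le> 
       2 / d k * (\<Sum>(p, q)\<in>T k. norm (B k p q) * (majorant_lim p * majorant_lim q - majorant j p * majorant j q)) * exp (- (d k * t / 2))"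
    proof (intro always_eventually allI)
      fix j
      have "norm (duhamel solution k t - duhamel (picard j) k t) \<le> 
       2 / d k * (\<Sum>(p, q)\<in>T k. norm (B k p q) * (majorant_lim p * majorant_lim q - majorant j p * majorant j q)) * exp (- (d k * t / 2))"
        by (rule duhamel_diff[OF continuous_on_picard continuous_on_solution picard_bounds(1)
          solution_bound_lim solution_picard_bound majorant_props(1) majorant_le_lim t])
      then show "norm (picard (Suc j) k t - duhamel solution k t) \<le> 
       2 / d k * (\<Sum>(p, q)\<in>T k. norm (B k p q) * (majorant_lim p * majorant_lim q - majorant j p * majorant j q)) * exp (- (d k * t / 2))"
        by (simp add: norm_minus_commute)
    qed
    have "(\<lambda>j. 2 / d k * (\<Sum>(p, q)\<in>T k. norm (B k p q) * (majorant_lim p * majorant_lim q - majorant j p * majorant j q)) * exp (- (d k * t / 2)))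
      \<longlonglongrightarrow> 2 / d k * (\<Sum>(p, q)\<in>T k. norm (B k p q) * (majorant_lim p * majorant_lim q - majorant_lim p * majorant_lim q)) * exp (- (d k * t / 2))"
      unfolding case_prod_beta by (intro tendsto_intros majorant_tendsto)
    then show "(\<lambda>j. 2 / d k * (\<Sum>(p, q)\<in>T k. norm (B k p q) * (majorant_lim p * majorant_lim q - majorant j p * majorant j q)) * exp (- (d k * t / 2))) \<longlonglongrightarrow> 0"
      by simp
  qed
  moreover have "(\<lambda>j. picard (Suc j) k t) \<longlonglongrightarrow> solution k t"
    using picard_tendsto[OF t, of k] by (rule LIMSEQ_Suc)
  ultimately show ?thesis by (metis LIMSEQ_unique)
qed

lemma solution_0: "solution k 0 = c0 k"
  using solution_duhamel[of 0 k] by (simp add: duhamel_def)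

lemma solution_has_vector_derivative:
  assumes t: "0 < t"
  shows "(solution k has_vector_derivative - (d k *\<^sub>R solution k t) - nonlin solution k t) (at t)"
proof -
  define G where "G \<tau> = exp (d k * \<tau>) *\<^sub>R nonlin solution k \<tau>" for \<tau>
  have G: "continuous_on {0..} G" unfolding G_def
    by (intro continuous_intros continuous_on_nonlin continuous_on_solution)
  have "((\<lambda>t. integral {0..t} G) has_vector_derivative G t) (at t within {0<..})"
    using integral_has_vector_derivative_Ici[OF G, of t] t
    by (auto intro: has_vector_derivative_within_subset)
  then have I: "((\<lambda>t. integral {0..t} G) has_vector_derivative G t) (at t)"
    using t by (simp add: at_within_open[of t "{0<..}"])
  have e: "((\<lambda>t. exp (- (d k * t))) has_vector_derivative - d k * exp (- (d k * t))) (at t)"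
    by (auto intro!: derivative_eq_intros simp flip: has_real_derivative_iff_has_vector_derivative)
  have sc: "((\<lambda>t. exp (- (d k * t)) *\<^sub>R (c0 k - integral {0..t} G)) has_vector_derivative
     exp (- (d k * t)) *\<^sub>R (0 - G t) + (- d k * exp (- (d k * t))) *\<^sub>R (c0 k - integral {0..t} G)) (at t)"
    by (intro has_vector_derivative_scaleR has_vector_derivative_diff has_vector_derivative_const I)
      (use e in \<open>simp add: has_real_derivative_iff_has_vector_derivative\<close>)
  have eq: "duhamel solution k = (\<lambda>t. exp (- (d k * t)) *\<^sub>R (c0 k - integral {0..t} G))"
    by (simp add: fun_eq_iff duhamel_def flip: G_def)
  have "exp (- (d k * t)) *\<^sub>R (0 - G t) + (- d k * exp (- (d k * t))) *\<^sub>R (c0 k - integral {0..t} G)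
     = - (d k *\<^sub>R solution k t) - nonlin solution k t"
    using solution_duhamel[of t k] t by (simp add: eq G_def flip: exp_add)
  with sc eq have D: "(duhamel solution k has_vector_derivative - (d k *\<^sub>R solution k t) - nonlin solution k t) (at t)"
    by simp
  show ?thesis
    by (rule has_vector_derivative_transform_within_open[OF D, of "{0<..}"])
      (use t solution_duhamel in \<open>auto simp: order_less_imp_le\<close>)
qed

text \<open>Each Picard iterate inherits the symmetry from the previous one, and limits preserve it;
  no uniqueness theorem is involved. It will be applied with negation for \<iota>, to obtain real
  vector fields.\<close>

lemma solution_cnj:
  assumes d: "\<And>k. d (\<iota> k) = d k" and c0: "\<And>k. c0 (\<iota> k) = cnj (c0 k)"
    and nonlin: "\<And>f k t. (\<And>k. f (\<iota> k) t = cnj (f k t)) \<Longrightarrow> nonlin f (\<iota> k) t = cnj (nonlin f k t)"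
    and t: "0 \<le> t"
  shows "solution (\<iota> k) t = cnj (solution k t)"
proof -
  have "picard j (\<iota> k) t = cnj (picard j k t)" for j k t
  proof (induction j arbitrary: k t)
    case (Suc j)
    have "nonlin (picard j) (\<iota> k) \<tau> = cnj (nonlin (picard j) k \<tau>)" for \<tau>
      using Suc by (intro nonlin) auto
    then show ?case by (simp add: duhamel_def d c0 integral_cnj scaleR_conv_of_real)
  qed simp
  then have "(\<lambda>j. cnj (picard j k t)) \<longlonglongrightarrow> solution (\<iota> k) t" using picard_tendsto[OF t, of "\<iota> k"] by simp
  moreover have "(\<lambda>j. cnj (picard j k t)) \<longlonglongrightarrow> cnj (solution k t)"
    by (intro tendsto_intros picard_tendsto t)
  ultimately show ?thesis by (rule LIMSEQ_unique)
qed

end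

section \<open>Triads and frequency envelopes\<close>

text \<open>Frequencies outside \<open>Mfreq\<close> get no interactions: an amplitude that starts
  at 0 there is never forced, and the system can be posed on all of the lattice.\<close>

definition triads :: "int ^ 3 \<Rightarrow> ((int ^ 3) \<times> (int ^ 3)) set" where
  "triads k = (if k \<in> Mfreq then {(p, q). p \<in> Mfreq \<and> q \<in> Mfreq \<and> p + q = k} else {})"

text \<open>The divergence contributes the symbol 2 \<pi> i k, contracted with the direction of the
  advecting mode p; the projection contributes the inner product of the directions of q and
  k.\<close>

definition coupling :: "int ^ 3 \<Rightarrow> int ^ 3 \<Rightarrow> int ^ 3 \<Rightarrow> complex" where
  "coupling k p q = 2 * of_real pi * \<i> * of_real ((rvec k \<bullet> vfreq p) * (vfreq k \<bullet> vfreq q))"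

lemma triads_levels:
  assumes "(p, q) \<in> triads k" "k \<in> shell n"
  obtains a b where "p \<in> shell a" "q \<in> shell b" "a \<le> Suc n" "b \<le> Suc n" "n \<le> Suc a" "n \<le> Suc b"
    "(a = b \<and> n = Suc a) \<or> n \<le> a \<or> n \<le> b"
proof -
  obtain a b where ab: "p \<in> shell a" "q \<in> shell b" "p + q = k"
    using assms by (auto simp: triads_def Mfreq_eq split: if_splits)
  then show thesis using triad_levels[of p a q b n] assms(2) by (intro that[of a b]) auto
qed

lemma triads_subset:
  assumes "k \<in> shell n"
  shows "triads k \<subseteq> (\<lambda>p. (p, k - p)) ` (shell (n - 1) \<union> shell n \<union> shell (Suc n))"
proof (rule subrelI)
  fix p q assume pq: "(p, q) \<in> triads k"
  then obtain a where a: "p \<in> shell a" "a \<le> Suc n" "n \<le> Suc a"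
    using triads_levels[OF _ assms] by metis
  \<comment> \<open>At n = 0 the truncated difference merely names shell 0 a second time.\<close>
  have "a = n - 1 \<or> a = n \<or> a = Suc n" using a by linarith
  moreover have "q = k - p" using pq by (auto simp: triads_def split: if_splits)
  ultimately show "(p, q) \<in> (\<lambda>p. (p, k - p)) ` (shell (n - 1) \<union> shell n \<union> shell (Suc n))"
    using a(1) by auto
qed

lemma finite_triads: "finite (triads k)"
proof (cases "k \<in> Mfreq")
  case True
  then show ?thesis using finite_subset[OF triads_subset[OF level_shell]] by (simp add: finite_shell)
qed (simp add: triads_def)

lemma card_triads: "card (triads k) \<le> 72"
proof (cases "k \<in> Mfreq")
  case True
  define n where "n = level k"
  let ?U = "shell (n - 1) \<union> shell n \<union> shell (Suc n)"
  have "card (triads k) \<le> card ((\<lambda>p. (p, k - p)) ` ?U)"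
    using triads_subset[OF level_shell[OF True]] by (intro card_mono) (simp_all add: finite_shell n_def)
  also have "\<dots> \<le> card ?U" by (intro card_image_le) (simp add: finite_shell)
  also have "\<dots> \<le> card (shell (n - 1)) + card (shell n) + card (shell (Suc n))"
    by (meson add_le_mono1 card_Un_le order_trans)
  also have "\<dots> \<le> 72" using card_shell[of "n - 1"] card_shell[of n] card_shell[of "Suc n"] by simp
  finally show ?thesis .
qed (simp add: triads_def)

section \<open>The critical rate and the strength of the coupling\<close>

abbreviation crit_rate :: real where
  "crit_rate \<equiv> ln 3 / (4 * ln 2)"

text \<open>This amounts to 3 < 4. It keeps every admissible \<alpha> in the range where the damping
  is subadditive along triads.\<close>

lemma crit_rate_less_half: "crit_rate < 1 / 2"
proof -
  have "ln (3::real) < ln (2 ^ 2)" by (subst ln_less_cancel_iff) auto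
  also have "\<dots> = 2 * ln 2" by (subst ln_realpow) auto
  finally show ?thesis by (simp add: field_simps)
qed

text \<open>The origin of \<open>crit_rate\<close>: it is the exponent for which 4 ^ n raised to it
  is exactly the square root of 3 ^ n.\<close>

lemma sqrt_3_power_le: "sqrt (3 ^ n) \<le> lam n powr crit_rate"
proof -
  have 4: "ln (4::real) = 2 * ln 2" using ln_realpow[of "2::real" 2] by simp
  have "sqrt (3 ^ n) = (3 ^ n) powr (1 / 2)" by (simp add: powr_half_sqrt)
  also have "\<dots> = exp (real n * ln 3 / 2)" by (simp add: powr_def ln_realpow)
  also have "\<dots> = (4 ^ n) powr crit_rate" by (simp add: powr_def ln_realpow 4)
  also have "\<dots> \<le> lam n powr crit_rate" by (intro powr_mono2 lam_ge) auto
  finally show ?thesis .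
qed

text \<open>Only the factor with k and \<open>vfreq p\<close> is small; the other one is bounded by
  Cauchy-Schwarz. The constant 96 is 8 * 6 * 2, from 2 * pi < 8, from
  \<open>inner_vfreq_bound\<close>, and from comparing 3 ^ a with 4 * 3 ^ n before taking the
  root.\<close>

lemma coupling_bound:
  assumes "(p, q) \<in> triads k" "k \<in> shell n"
  shows "norm (coupling k p q) \<le> 96 * lam n powr crit_rate"
proof -
  obtain a b where ab: "p \<in> shell a" "q \<in> shell b" "a \<le> Suc n" "n \<le> Suc a"
    using triads_levels[OF assms] by metis
  have "(3::real) ^ a \<le> 3 * 3 ^ n" using power_increasing[OF ab(3), of "3::real"] by simp
  moreover have "(0::real) \<le> 3 ^ n" by simp
  ultimately have "(3::real) ^ a \<le> 2\<^sup>2 * 3 ^ n" unfolding power2_eq_square by linarith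
  then have "sqrt (3 ^ a) \<le> sqrt (2\<^sup>2 * 3 ^ n)" by (rule real_sqrt_le_mono)
  also have "\<dots> = 2 * sqrt (3 ^ n)" by (simp add: real_sqrt_mult)
  also have "\<dots> \<le> 2 * lam n powr crit_rate" using sqrt_3_power_le[of n] by simp
  finally have 1: "\<bar>rvec k \<bullet> vfreq p\<bar> \<le> 12 * lam n powr crit_rate"
    using inner_vfreq_bound[OF ab(1) assms(2) ab(4)] by linarith
  have 2: "\<bar>vfreq k \<bullet> vfreq q\<bar> \<le> 1"
    using Cauchy_Schwarz_ineq2[of "vfreq k" "vfreq q"] norm_vfreq[of k] norm_vfreq[of q] assms(2) ab(2)
      shell_subset by fastforce
  have "norm (coupling k p q) = 2 * pi * (\<bar>rvec k \<bullet> vfreq p\<bar> * \<bar>vfreq k \<bullet> vfreq q\<bar>)"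
    by (simp add: coupling_def norm_mult abs_mult)
  also have "\<dots> \<le> 8 * ((12 * lam n powr crit_rate) * 1)"
    using pi_less_4 1 2 by (intro mult_mono) auto
  finally show ?thesis by simp
qed

text \<open>The distance of n and m; one of the two truncated differences is always 0.\<close>

definition gap :: "nat \<Rightarrow> nat \<Rightarrow> nat" where
  "gap n m = (n - m) + (m - n)"

lemma gap_self: "gap n n = 0" and gap_Suc_Suc: "gap (Suc n) (Suc m) = gap n m"
  by (simp_all add: gap_def)

lemma gap_neighbour:
  assumes "n \<le> Suc n'" "n' \<le> Suc n"
  shows "gap n m \<le> Suc (gap n' m)"
  using assms by (simp add: gap_def)

text \<open>The two-sided geometric series. The subtracted term is room for the induction: raising m
  by one puts a new first term (1 / 4) ^ (m + 1) in front, and twice this is at most (1 / 4) ^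
  m.\<close>

lemma sum_gap: "(\<Sum>n<N. (1 / 4 :: real) ^ gap n m) \<le> 3 - (1 / 4) ^ m"
proof (induction m arbitrary: N)
  case 0
  have "(\<Sum>n<N. (1 / 4 :: real) ^ gap n 0) = (1 - (1 / 4) ^ N) / (1 - 1 / 4)"
    by (simp add: gap_def sum_gp_strict)
  also have "\<dots> \<le> 2" by (simp add: field_simps)
  finally show ?case by simp
next
  case (Suc m)
  show ?case
  proof (cases N)
    case 0
    have "(1 / 4 :: real) ^ Suc m \<le> 1" by (rule power_le_one) auto
    then show ?thesis using 0 by simp
  next
    case (Suc N')
    have "(\<Sum>n<N. (1 / 4 :: real) ^ gap n (Suc m)) = (1 / 4) ^ Suc m + (\<Sum>n<N'. (1 / 4 :: real) ^ gap n m)"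
      unfolding Suc sum.lessThan_Suc_shift by (simp add: gap_Suc_Suc) (simp add: gap_def)
    also have "\<dots> \<le> (1 / 4) ^ Suc m + (3 - (1 / 4) ^ m)" using Suc.IH[of N'] by simp
    also have "\<dots> \<le> 3 - (1 / 4) ^ Suc m" by simp
    finally show ?thesis .
  qed
qed

lemma lam_le_gap: "lam n \<le> 4 ^ gap n m * lam m"
proof (cases "n \<le> m")
  case True
  then have "1 * lam n \<le> 4 ^ gap n m * lam m"
    using lam_mono[OF True] lam_pos by (intro mult_mono) (auto intro: order_less_imp_le)
  then show ?thesis by simp
next
  case False
  have "lam (m + i) \<le> 4 ^ i * lam m" for i
  proof (induction i)
    case (Suc i)
    then show ?case using lam_Suc_le[of "m + i"] by simp
  qed simp
  from this[of "n - m"] show ?thesis using False by (simp add: gap_def)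
qed

text \<open>The frequency envelope of a sequence of shell energies: a slowly varying majorant with the same
  weighted sums up to constants.\<close>

locale frequency_envelope =
  fixes s :: real and X :: "nat \<Rightarrow> real"
  assumes s_nonneg: "0 \<le> s" and X_nonneg: "0 \<le> X n"
    and X_summable: "summable (\<lambda>n. lam n powr s * X n)"
begin

text \<open>The weight \<open>lam n powr s\<close> grows by at most 4 powr s per shell. The choice
  makes 4 powr s * \<delta> = 1 / 4, so that the weighted envelope still sums like a geometric
  series.\<close>

definition \<delta> :: real where "\<delta> = 4 powr (- s - 1)"

text \<open>The factor 4 on the energies is a factor 2 on the amplitudes: the data take up half of
  the supersolution, and the other half is left for the nonlinear term.\<close>

definition env :: "nat \<Rightarrow> real" where
  "env n = 4 * (\<Sum>m. \<delta> ^ gap n m * X m)"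

lemma delta_pos: "0 < \<delta>" and delta_le_1: "\<delta> \<le> 1"
  using s_nonneg powr_mono[of "- s - 1" 0 "4::real"] by (simp_all add: \<delta>_def)

lemma lam_gap_powr:
  assumes "0 \<le> \<sigma>" "\<sigma> \<le> s"
  shows "lam n powr \<sigma> * \<delta> ^ gap n m \<le> (1 / 4) ^ gap n m * lam m powr \<sigma>"
proof -
  have "lam n powr \<sigma> \<le> (4 ^ gap n m * lam m) powr \<sigma>"
    using assms lam_le_gap lam_pos by (intro powr_mono2) (auto intro: order_less_imp_le)
  also have "\<dots> = (4 powr \<sigma>) ^ gap n m * lam m powr \<sigma>"
    using lam_pos[of m] by (simp add: powr_mult powr_powr mult.commute flip: powr_realpow)
  also have "\<dots> \<le> (4 powr s) ^ gap n m * lam m powr \<sigma>"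
    using assms by (intro mult_right_mono power_mono) auto
  finally have "lam n powr \<sigma> * \<delta> ^ gap n m \<le> (4 powr s) ^ gap n m * lam m powr \<sigma> * \<delta> ^ gap n m"
    using delta_pos by (intro mult_right_mono) auto
  also have "\<dots> = (4 powr s * \<delta>) ^ gap n m * lam m powr \<sigma>" by (simp add: power_mult_distrib)
  also have "4 powr s * \<delta> = 1 / 4" by (simp add: \<delta>_def powr_minus_divide flip: powr_add)
  finally show ?thesis .
qed

lemma X_summable_le:
  assumes "\<sigma> \<le> s"
  shows "summable (\<lambda>n. lam n powr \<sigma> * X n)"
proof (rule summable_comparison_test'[OF X_summable, of 0])
  fix n
  show "norm (lam n powr \<sigma> * X n) \<le> lam n powr s * X n"
    using X_nonneg[of n] lam_ge_1[of n] assms by (auto intro!: mult_right_mono powr_mono)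
qed

lemma env_summable: "summable (\<lambda>m. \<delta> ^ gap n m * X m)"
proof (rule summable_comparison_test'[OF X_summable_le[OF s_nonneg], of 0])
  fix m
  show "norm (\<delta> ^ gap n m * X m) \<le> lam m powr 0 * X m"
    using X_nonneg[of m] lam_pos[of m] delta_pos delta_le_1 by (auto intro!: mult_left_le_one_le power_le_one)
qed

lemma env_nonneg: "0 \<le> env n"
  unfolding env_def using X_nonneg delta_pos by (intro mult_nonneg_nonneg suminf_nonneg env_summable) auto

lemma X_le_env: "4 * X n \<le> env n"
proof -
  have "(\<Sum>m\<in>{n}. \<delta> ^ gap n m * X m) \<le> (\<Sum>m. \<delta> ^ gap n m * X m)"
    using X_nonneg delta_pos by (intro sum_le_suminf env_summable) auto
  then show ?thesis by (simp add: env_def gap_self)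
qed

text \<open>Moving n by one changes each distance by at most one, hence each term of the series by
  at most one factor \<delta>.\<close>

lemma env_neighbour:
  assumes "n \<le> Suc n'" "n' \<le> Suc n"
  shows "env n' \<le> env n / \<delta>"
proof -
  have "\<delta> * env n' = 4 * (\<Sum>m. \<delta> * (\<delta> ^ gap n' m * X m))"
    by (simp add: env_def suminf_mult env_summable)
  also have "\<dots> \<le> 4 * (\<Sum>m. \<delta> ^ gap n m * X m)"
  proof (intro mult_left_mono suminf_le env_summable summable_mult)
    fix m
    have "\<delta> ^ Suc (gap n' m) \<le> \<delta> ^ gap n m"
      using gap_neighbour[OF assms] delta_pos delta_le_1 by (intro power_decreasing) auto
    then show "\<delta> * (\<delta> ^ gap n' m * X m) \<le> \<delta> ^ gap n m * X m"
      using X_nonneg[of m] by (simp add: mult_right_mono flip: mult.assoc)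
  qed auto
  finally show ?thesis using delta_pos by (simp add: env_def field_simps)
qed

text \<open>Only a pointwise bound in n is wanted, so the gap factor (1 / 4) ^
  \<open>gap n m\<close> is estimated by 1 and the constant does not depend on s. With the critical
  exponent for \<sigma>, the critical norm controls the whole envelope.\<close>

lemma env_bound:
  assumes \<sigma>: "0 \<le> \<sigma>" "\<sigma> \<le> s"
  shows "lam n powr \<sigma> * env n \<le> 4 * (\<Sum>m. lam m powr \<sigma> * X m)"
proof -
  have "lam n powr \<sigma> * env n = 4 * (\<Sum>m. lam n powr \<sigma> * (\<delta> ^ gap n m * X m))"
    by (simp add: env_def suminf_mult env_summable)
  also have "\<dots> \<le> 4 * (\<Sum>m. lam m powr \<sigma> * X m)"
  proof (intro mult_left_mono suminf_le X_summable_le \<sigma> summable_mult env_summable)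
    fix m
    have "(1 / 4) ^ gap n m * lam m powr \<sigma> \<le> 1 * lam m powr \<sigma>"
      by (intro mult_right_mono power_le_one) auto
    then have "lam n powr \<sigma> * \<delta> ^ gap n m \<le> lam m powr \<sigma>" using lam_gap_powr[OF \<sigma>, of n m] by linarith
    then show "lam n powr \<sigma> * (\<delta> ^ gap n m * X m) \<le> lam m powr \<sigma> * X m"
      using X_nonneg[of m] by (simp add: mult_right_mono flip: mult.assoc)
  qed auto
  finally show ?thesis .
qed

text \<open>Here the gap factor is kept. Exchanging the sums and summing over n first, each X m is
  counted at most three times by \<open>sum_gap\<close>.\<close>

lemma summable_env: "summable (\<lambda>n. lam n powr s * env n)"
proof (rule bounded_imp_summable)
  show "0 \<le> lam n powr s * env n" for n using env_nonneg[of n] by simp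
  fix N
  have "(\<Sum>n\<le>N. lam n powr s * env n) = 4 * (\<Sum>n<Suc N. \<Sum>m. lam n powr s * (\<delta> ^ gap n m * X m))"
    unfolding sum_distrib_left lessThan_Suc_atMost
    by (intro sum.cong refl) (simp add: env_def suminf_mult env_summable)
  also have "(\<Sum>n<Suc N. \<Sum>m. lam n powr s * (\<delta> ^ gap n m * X m)) = (\<Sum>m. \<Sum>n<Suc N. lam n powr s * (\<delta> ^ gap n m * X m))"
    by (intro suminf_sum[symmetric] summable_mult env_summable)
  also have "\<dots> \<le> (\<Sum>m. 3 * (lam m powr s * X m))"
  proof (intro suminf_le summable_mult X_summable summable_sum env_summable)
    fix m
    have "(\<Sum>n<Suc N. lam n powr s * (\<delta> ^ gap n m * X m)) \<le> (\<Sum>n<Suc N. (1 / 4) ^ gap n m * (lam m powr s * X m))"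
    proof (rule sum_mono)
      fix n
      show "lam n powr s * (\<delta> ^ gap n m * X m) \<le> (1 / 4) ^ gap n m * (lam m powr s * X m)"
        using mult_right_mono[OF lam_gap_powr[OF s_nonneg order_refl, of n m] X_nonneg[of m]] by (simp add: mult.assoc)
    qed
    also have "\<dots> = (\<Sum>n<Suc N. (1 / 4) ^ gap n m) * (lam m powr s * X m)" by (simp only: sum_distrib_right)
    also have "\<dots> \<le> 3 * (lam m powr s * X m)"
    proof (rule mult_right_mono)
      have "(0::real) \<le> (1 / 4) ^ m" by simp
      then show "(\<Sum>n<Suc N. (1 / 4 :: real) ^ gap n m) \<le> 3" using sum_gap[where N="Suc N" and m=m] by linarith
    qed (use X_nonneg in simp)
    finally show "(\<Sum>n<Suc N. lam n powr s * (\<delta> ^ gap n m * X m)) \<le> 3 * (lam m powr s * X m)" .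
  qed
  finally show "(\<Sum>n\<le>N. lam n powr s * env n) \<le> 4 * (\<Sum>m. 3 * (lam m powr s * X m))" by simp
qed

end

section \<open>Fourier coefficients on the torus\<close>

lemma finite_measure_torus: "finite_measure torus"
  by (rule finite_measureI) (simp add: emeasure_restrict_space space_restrict_space emeasure_lborel_cbox_eq)

interpretation torus: finite_measure torus
  by (rule finite_measure_torus)

lemma borel_measurable_torus: "f \<in> borel_measurable borel \<Longrightarrow> f \<in> borel_measurable torus"
  by (intro measurable_restrict_space1 measurable_completion) simp

lemma continuous_on_fchar: "continuous_on S (fchar k)"
  unfolding fchar_def[abs_def] by (intro continuous_intros)

lemma fchar_measurable [measurable]: "fchar k \<in> borel_measurable borel"
  by (intro borel_measurable_continuous_onI continuous_on_fchar)

lemma fchar_measurable_torus [measurable]: "fchar k \<in> borel_measurable torus"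
  by (intro borel_measurable_torus fchar_measurable)

lemma norm_fchar: "norm (fchar k x) = 1"
proof -
  have "fchar k x = exp (\<i> * of_real (- (2 * pi * (rvec k \<bullet> x))))"
    by (simp add: fchar_def mult_ac)
  then show ?thesis by (simp only: norm_exp_i_times)
qed

lemma fchar_add: "fchar (k + l) x = fchar k x * fchar l x"
  by (simp add: fchar_def rvec_add inner_add_left ring_distribs exp_add exp_diff exp_minus field_simps)

lemma fchar_uminus: "fchar (- k) x = cnj (fchar k x)"
  by (simp add: fchar_def rvec_uminus exp_cnj)

lemma fchar_diff: "fchar (k - l) x = fchar (- l) x * fchar k x"
  using fchar_add[of "- l" k x] by simp

lemma integrable_mult_fchar:
  assumes "integrable torus G"
  shows "integrable torus (\<lambda>x. fchar k x * G x)"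
  by (rule Bochner_Integration.integrable_bound[OF assms])
    (use assms in \<open>auto simp: norm_mult norm_fchar intro!: borel_measurable_times fchar_measurable_torus\<close>)

lemma fchar_integrable: "integrable torus (fchar k)"
  by (rule torus.integrable_const_bound[where B=1]) (auto simp: norm_fchar)

lemma integral_unit_interval_exp:
  "(LINT y|lborel. indicator {0..1::real} y *\<^sub>R exp (- (2 * of_real pi * \<i> * of_real (of_int n * y)))) = (if n = 0 then 1 else 0)"
proof (cases "n = 0")
  case True
  then show ?thesis by simp
next
  case False
  define a :: complex where "a = - (2 * of_real pi * \<i> * of_int n)"
  have a: "a \<noteq> 0" using False by (simp add: a_def)
  have "(LINT y|lborel. indicator {0..1::real} y *\<^sub>R exp (a * of_real y)) = exp (a * of_real 1) / a - exp (a * of_real 0) / a"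
  proof (rule integral_FTC_atLeastAtMost)
    show "((\<lambda>y. exp (a * of_real y) / a) has_vector_derivative exp (a * of_real y)) (at y within {0..1})" for y :: real
      using a by (auto intro!: derivative_eq_intros has_vector_derivative_real_field)
    show "continuous_on {0..1::real} (\<lambda>y. exp (a * of_real y))" by (intro continuous_intros)
  qed simp
  moreover have "exp a = 1" 
    using exp_integer_2pi[of "of_int (- n)"] by (simp add: a_def mult_ac)
  ultimately show ?thesis using False by (simp add: a_def mult_ac)
qed

text \<open>Orthogonality of characters by Fubini: on the cube the character is a product of
  one-dimensional exponentials, and a nonzero frequency has a nonzero entry, whose factor integrates
  to 0.\<close>

lemma integral_fchar: "(LINT x|torus. fchar m x) = (if m = 0 then 1 else 0)"
proof -
  define g :: "real ^ 3 \<Rightarrow> real \<Rightarrow> complex" where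
    "g b y = indicator {0..1} y *\<^sub>R exp (- (2 * of_real pi * \<i> * of_real ((rvec m \<bullet> b) * y)))" for b y
  have g_meas: "g b \<in> borel_measurable borel" for b
    unfolding g_def[abs_def]
    by (intro borel_measurable_scaleR borel_measurable_indicator borel_measurable_continuous_onI continuous_intros) auto
  have g_int: "integrable lborel (g b)" for b
    unfolding g_def[abs_def]
    by (rule borel_integrable_compact) (auto intro!: continuous_intros)
  have prod: "indicator (cbox 0 1) x *\<^sub>R fchar m x = (\<Prod>b\<in>Basis. g b (x \<bullet> b))" for x :: "real ^ 3"
  proof -
    have one: "1 \<bullet> b = 1" if "b \<in> Basis" for b :: "real ^ 3"
      using that by (auto simp: Basis_vec_def inner_axis)
    have "indicator (cbox 0 1) x = (\<Prod>b\<in>Basis. indicator {0..1::real} (x \<bullet> b) :: real)"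
    proof (cases "x \<in> cbox 0 1")
      case True
      then show ?thesis by (auto simp: mem_box indicator_def one intro!: prod.neutral)
    next
      case False
      then obtain b where "b \<in> Basis" "x \<bullet> b \<notin> {0..1}" by (auto simp: mem_box one)
      then show ?thesis using False by (auto intro!: bexI[of _ b])
    qed
    moreover have "fchar m x = (\<Prod>b\<in>Basis. exp (- (2 * of_real pi * \<i> * of_real ((rvec m \<bullet> b) * (x \<bullet> b)))))"
      unfolding fchar_def by (subst euclidean_inner) (simp add: exp_sum sum_distrib_left sum_negf[symmetric])
    ultimately show ?thesis
      by (simp add: g_def prod.distrib scaleR_conv_of_real)
  qed
  interpret product_sigma_finite "\<lambda>_ :: real ^ 3. lborel :: real measure" ..
  have "(LINT x|torus. fchar m x) = (LINT x|lebesgue. indicator (cbox 0 1) x *\<^sub>R fchar m x)"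
    by (rule integral_restrict_space) simp
  also have "\<dots> = (LINT x|lborel. indicator (cbox 0 1) x *\<^sub>R fchar m x)"
    by (rule integral_completion) measurable
  also have "\<dots> = (LINT x|lborel. (\<Prod>b\<in>Basis. g b (x \<bullet> b)))" by (simp only: prod)
  \<comment> \<open>Lebesgue measure is the image of the product measure under the map from
    coordinates to points.\<close>
  also have "\<dots> = (LINT f|Pi\<^sub>M (Basis :: (real ^ 3) set) (\<lambda>_. lborel). (\<Prod>b\<in>Basis. g b ((\<Sum>b\<in>Basis. f b *\<^sub>R b) \<bullet> b)))"
    by (subst lborel_eq, rule integral_distr) (use g_meas in measurable)
  also have "\<dots> = (LINT f|Pi\<^sub>M (Basis :: (real ^ 3) set) (\<lambda>_. lborel). (\<Prod>b\<in>Basis. g b (f b)))"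
    by (simp add: inner_sum_left inner_Basis if_distrib[of "\<lambda>x. _ * x"] sum.delta cong: prod.cong if_cong)
  also have "\<dots> = (\<Prod>b\<in>Basis. (LINT y|lborel. g b y))"
    by (rule product_integral_prod) (simp_all add: g_int)
  also have "\<dots> = (\<Prod>b\<in>(Basis :: (real ^ 3) set). if rvec m \<bullet> b = 0 then 1 else 0)"
  proof (rule prod.cong)
    fix b :: "real ^ 3" assume "b \<in> Basis"
    then obtain j where "b = axis j 1" by (auto simp: Basis_vec_def)
    then have "rvec m \<bullet> b = of_int (m $ j)" by (simp add: inner_axis rvec_def)
    then show "(LINT y|lborel. g b y) = (if rvec m \<bullet> b = 0 then 1 else 0)"
      using integral_unit_interval_exp[of "m $ j"] by (simp add: g_def)
  qed simp
  also have "\<dots> = (if m = 0 then 1 else 0)"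
  proof (cases "m = 0")
    case False
    then obtain b where "b \<in> Basis" "rvec m \<bullet> b \<noteq> 0"
      using rvec_eq_0_iff euclidean_all_zero_iff by metis
    then show ?thesis using False by auto
  qed (simp add: rvec_zero)
  finally show ?thesis .
qed

section \<open>Summation over shells\<close>

lemma sums_shell_finite:
  fixes f :: "int ^ 3 \<Rightarrow> 'a::{t2_space, topological_comm_monoid_add}"
  assumes F: "finite F" "F \<subseteq> Mfreq" and z: "\<And>k. k \<in> Mfreq - F \<Longrightarrow> f k = 0"
  shows "(\<lambda>n. \<Sum>k\<in>shell n. f k) sums (\<Sum>k\<in>F. f k)"
proof -
  have "(\<lambda>n. \<Sum>k\<in>shell n. if k = j then f j else 0) sums f j" if "j \<in> F" for j
  proof -
    have j: "j \<in> shell n \<longleftrightarrow> n = level j" for n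
      using level_shell[of j] level_eq[of j n] that F(2) by auto
    show ?thesis using sums_single[of "level j" "\<lambda>_. f j"] by (simp add: finite_shell sum.delta j)
  qed
  then have "(\<lambda>n. \<Sum>j\<in>F. \<Sum>k\<in>shell n. if k = j then f j else 0) sums (\<Sum>j\<in>F. f j)"
    by (rule sums_sum)
  moreover have "(\<Sum>j\<in>F. \<Sum>k\<in>shell n. if k = j then f j else 0) = (\<Sum>k\<in>shell n. f k)" for n
    using z shell_subset[of n] by (subst sum.swap) (auto simp: F(1) sum.delta' intro!: sum.cong)
  ultimately show ?thesis by simp
qed

lemma finite_subset_shells:
  assumes "finite F" "F \<subseteq> Mfreq"
  obtains N where "F \<subseteq> (\<Union>n<N. shell n)"
proof
  show "F \<subseteq> (\<Union>n<Suc (Max (insert 0 (level ` F))). shell n)"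
  proof
    fix k assume k: "k \<in> F"
    then have "level k \<le> Max (insert 0 (level ` F))" using assms by (intro Max_ge) auto
    then show "k \<in> (\<Union>n<Suc (Max (insert 0 (level ` F))). shell n)"
      using level_shell[of k] k assms(2) by (intro UN_I[of "level k"]) auto
  qed
qed

lemma sum_shells: "(\<Sum>n<N. \<Sum>k\<in>shell n. f k) = (\<Sum>k\<in>(\<Union>n<N. shell n). f k)"
  by (rule sum.UNION_disjoint[symmetric]) (auto simp: finite_shell dest: shell_level_unique)

text \<open>The bridge between the unordered sums in the Sobolev norms and ordinary series. As the
  terms are nonnegative, it suffices that every finite set of frequencies in \<open>Mfreq\<close>
  lies in finitely many shells.\<close>

lemma has_sum_shells:
  fixes g :: "int ^ 3 \<Rightarrow> real"
  assumes g: "\<And>k. 0 \<le> g k" and z: "\<And>k. k \<notin> Mfreq \<Longrightarrow> g k = 0"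
  shows "g summable_on (UNIV - {0}) \<longleftrightarrow> summable (\<lambda>n. \<Sum>k\<in>shell n. g k)"
    and "g summable_on (UNIV - {0}) \<Longrightarrow> infsum g (UNIV - {0}) = (\<Sum>n. \<Sum>k\<in>shell n. g k)"
proof -
  have sub: "(\<Union>n<N. shell n) \<subseteq> UNIV - {0}" for N using zero_notin_shell by auto
  have fin: "finite (\<Union>n<N. shell n)" for N :: nat by (simp add: finite_shell)
  have 1: "summable (\<lambda>n. \<Sum>k\<in>shell n. g k)" if "g summable_on (UNIV - {0})"
  proof (rule bounded_imp_summable)
    fix N
    have "(\<Sum>n<Suc N. \<Sum>k\<in>shell n. g k) \<le> infsum g (UNIV - {0})"
      unfolding sum_shells by (rule finite_sum_le_infsum[OF that fin sub]) (use g in auto)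
    then show "(\<Sum>n\<le>N. \<Sum>k\<in>shell n. g k) \<le> infsum g (UNIV - {0})" by (simp add: lessThan_Suc_atMost)
  qed (use g in \<open>auto intro: sum_nonneg\<close>)
  have b: "sum g F \<le> (\<Sum>n. \<Sum>k\<in>shell n. g k)" 
    if s: "summable (\<lambda>n. \<Sum>k\<in>shell n. g k)" and F: "finite F" for F
  proof -
    obtain N where N: "F \<inter> Mfreq \<subseteq> (\<Union>n<N. shell n)"
      using finite_subset_shells[of "F \<inter> Mfreq"] F by auto
    have "sum g F = sum g (F \<inter> Mfreq)" using F z by (intro sum.mono_neutral_right) auto
    also have "\<dots> \<le> (\<Sum>k\<in>(\<Union>n<N. shell n). g k)" by (rule sum_mono2[OF fin N]) (use g in auto)
    also have "\<dots> \<le> (\<Sum>n. \<Sum>k\<in>shell n. g k)"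
      unfolding sum_shells[symmetric] by (rule sum_le_suminf[OF s]) (use g in \<open>auto intro: sum_nonneg\<close>)
    finally show ?thesis .
  qed
  have 2: "g summable_on (UNIV - {0})" if "summable (\<lambda>n. \<Sum>k\<in>shell n. g k)"
    by (rule nonneg_bdd_above_summable_on) (use g b[OF that] in \<open>auto intro!: bdd_aboveI\<close>)
  show iff: "g summable_on (UNIV - {0}) \<longleftrightarrow> summable (\<lambda>n. \<Sum>k\<in>shell n. g k)"
    using 1 2 by blast
  assume "g summable_on (UNIV - {0})"
  with iff have s: "summable (\<lambda>n. \<Sum>k\<in>shell n. g k)" by simp
  have "infsum g (UNIV - {0}) \<le> (\<Sum>n. \<Sum>k\<in>shell n. g k)"
    by (rule infsum_le_finite_sums[OF 2[OF s]]) (use b[OF s] in auto)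
  moreover have "(\<Sum>n. \<Sum>k\<in>shell n. g k) \<le> infsum g (UNIV - {0})"
    by (rule suminf_le_const[OF s], unfold sum_shells, 
        rule finite_sum_le_infsum[OF 2[OF s] fin sub]) (use g in auto)
  ultimately show "infsum g (UNIV - {0}) = (\<Sum>n. \<Sum>k\<in>shell n. g k)" by simp
qed

section \<open>Vector fields with prescribed amplitudes\<close>

text \<open>\<open>fchar\<close> carries the minus sign of the analysis formula, so synthesis uses -
  k. Taking real parts gives a real field for every c; under conjugate symmetry nothing is
  lost.\<close>

definition field :: "(int ^ 3 \<Rightarrow> complex) \<Rightarrow> real ^ 3 \<Rightarrow> real ^ 3" where
  "field c x = (\<Sum>n. \<Sum>k\<in>shell n. Re (c k * fchar (- k) x) *\<^sub>R vfreq k)"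

definition nonlinearity :: "(int ^ 3 \<Rightarrow> complex) \<Rightarrow> int ^ 3 \<Rightarrow> complex" where
  "nonlinearity c k = (\<Sum>(p, q)\<in>triads k. coupling k p q * (c p * c q))"

lemma norm_scalar_cvec: "norm (c *s cvec v) = norm c * norm v"
  by (simp add: norm_vec_def cvec_def norm_mult L2_set_right_distrib)

lemma field_sums:
  assumes "summable (\<lambda>n. \<Sum>k\<in>shell n. norm (c k))"
  shows "(\<lambda>n. \<Sum>k\<in>shell n. Re (c k * fchar (- k) x) *\<^sub>R vfreq k) sums field c x"
proof -
  have "summable (\<lambda>n. \<Sum>k\<in>shell n. Re (c k * fchar (- k) x) *\<^sub>R vfreq k)"
  proof (rule summable_comparison_test'[OF assms, of 0], rule sum_norm_le)
    fix n k assume "k \<in> shell n"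
    then show "norm (Re (c k * fchar (- k) x) *\<^sub>R vfreq k) \<le> norm (c k)"
      using abs_Re_le_cmod[of "c k * fchar (- k) x"] norm_vfreq[of k] shell_subset[of n]
      by (auto simp: norm_mult norm_fchar)
  qed
  then show ?thesis by (simp add: field_def summable_sums)
qed

lemma field_periodic: "periodic (field c)"
proof -
  have "fchar k (x + axis j 1) = fchar k x" for k x j
  proof -
    have "fchar k (x + axis j 1) = exp (- (2 * of_real pi * \<i> * of_real (rvec k \<bullet> x)) + (2 * of_int (- k $ j) * of_real pi) * \<i>)"
      unfolding fchar_def
      by (rule arg_cong[where f=exp]) (simp add: inner_add_right inner_axis rvec_def algebra_simps)
    also have "\<dots> = fchar k x"
      unfolding exp_add using exp_integer_2pi[of "of_int (- k $ j)"] by (simp add: fchar_def)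
    finally show ?thesis by simp
  qed
  then show ?thesis by (simp add: periodic_def field_def)
qed

lemma borel_measurable_Re_compose: "f \<in> borel_measurable M \<Longrightarrow> (\<lambda>x. Re (f x)) \<in> borel_measurable M"
  by (rule measurable_compose[OF _ borel_measurable_continuous_onI]) (auto intro: continuous_intros)

lemma field_measurable: "field c \<in> borel_measurable torus"
  unfolding field_def[abs_def]
  by (intro borel_measurable_suminf borel_measurable_sum borel_measurable_scaleR borel_measurable_const
      borel_measurable_Re_compose borel_measurable_times fchar_measurable_torus)

locale real_coefficients =
  fixes c :: "int ^ 3 \<Rightarrow> complex"
  assumes abs_summable: "summable (\<lambda>n. \<Sum>k\<in>shell n. norm (c k))"
    and cnj_symmetric: "\<And>k. c (- k) = cnj (c k)"
begin

lemma norm_field_le: "norm (field c x) \<le> (\<Sum>n. \<Sum>k\<in>shell n. norm (c k))"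
proof -
  have *: "norm (\<Sum>k\<in>shell n. Re (c k * fchar (- k) x) *\<^sub>R vfreq k) \<le> (\<Sum>k\<in>shell n. norm (c k))" for n
  proof (rule sum_norm_le)
    fix k assume "k \<in> shell n"
    then show "norm (Re (c k * fchar (- k) x) *\<^sub>R vfreq k) \<le> norm (c k)"
      using abs_Re_le_cmod[of "c k * fchar (- k) x"] norm_vfreq[of k] shell_subset[of n]
      by (auto simp: norm_mult norm_fchar)
  qed
  show ?thesis using field_sums[OF abs_summable, of x] norm_suminf_le[OF * abs_summable]
    by (simp add: sums_iff)
qed

lemma field_integrable: "integrable torus (field c)"
  by (rule torus.integrable_const_bound) (auto intro: norm_field_le field_measurable)

text \<open>By the reality condition every shell sum is real, so the real parts can be dropped.\<close>

lemma field_component_sums: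
  "(\<lambda>n. \<Sum>k\<in>shell n. c k * of_real (vfreq k $ i) * fchar (- k) x) sums of_real (field c x $ i)"
proof -
  have "(\<lambda>n. (\<Sum>k\<in>shell n. Re (c k * fchar (- k) x) *\<^sub>R vfreq k) $ i) sums (field c x $ i)"
    using field_sums[OF abs_summable, of x] bounded_linear.sums[OF bounded_linear_vec_nth] by blast
  then have "(\<lambda>n. complex_of_real ((\<Sum>k\<in>shell n. Re (c k * fchar (- k) x) *\<^sub>R vfreq k) $ i)) sums of_real (field c x $ i)"
    by (simp only: sums_of_real_iff)
  moreover have "complex_of_real ((\<Sum>k\<in>shell n. Re (c k * fchar (- k) x) *\<^sub>R vfreq k) $ i) =
    (\<Sum>k\<in>shell n. c k * of_real (vfreq k $ i) * fchar (- k) x)" (is "_ = ?S") for n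
  proof -
    have "cnj ?S = (\<Sum>k\<in>shell n. c (- k) * of_real (vfreq (- k) $ i) * fchar (- (- k)) x)"
      by (simp add: cnj_symmetric vfreq_uminus fchar_uminus)
    also have "\<dots> = (\<Sum>k\<in>uminus ` shell n. c k * of_real (vfreq k $ i) * fchar (- k) x)"
      by (subst sum.reindex) (auto simp: inj_on_def)
    finally have "cnj ?S = ?S" by (simp add: uminus_image_shell)
    moreover have "z = of_real (Re z)" if "cnj z = z" for z using that by (simp add: complex_eq_iff)
    ultimately have "?S = of_real (Re ?S)" by blast
    also have "Re ?S = (\<Sum>k\<in>shell n. Re (c k * fchar (- k) x) *\<^sub>R vfreq k) $ i"
      by (simp add: algebra_simps)
    finally show ?thesis by simp
  qed
  ultimately show ?thesis by simp
qed

lemma integrable_field_mult: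
  assumes "integrable torus G"
  shows "integrable torus (\<lambda>x. of_real (field c x $ i) * (G x :: complex))"
proof (rule Bochner_Integration.integrable_bound)
  let ?S = "\<Sum>n. \<Sum>k\<in>shell n. norm (c k)"
  show "integrable torus (\<lambda>x. ?S * norm (G x))" using assms by simp
  have "(\<lambda>x. field c x $ i) \<in> borel_measurable torus"
    using borel_measurable_continuous_onI[of "\<lambda>v :: real ^ 3. v $ i"] field_measurable[of c]
    by (auto intro!: measurable_compose[of "field c" torus borel] continuous_intros)
  then show "(\<lambda>x. of_real (field c x $ i) * (G x :: complex)) \<in> borel_measurable torus"
    using assms by (intro borel_measurable_times borel_measurable_of_real) auto
  have "norm (field c x $ i) \<le> ?S" for x
    using norm_field_le[of x] component_le_norm_cart[of "field c x" i] by simp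
  then show "AE x in torus. norm (of_real (field c x $ i) * (G x :: complex)) \<le> norm (?S * norm (G x))"
    by (intro always_eventually allI) (simp add: norm_mult abs_mult mult_right_mono order_trans[OF _ abs_ge_self])
qed

text \<open>Termwise integration against a general integrable function, because it is used twice:
  with a character it yields the Fourier coefficients, and with a field component times a character
  it yields the convolution.\<close>

lemma integral_field_mult_sums:
  assumes G: "integrable torus G"
  shows "(\<lambda>n. \<Sum>k\<in>shell n. c k * of_real (vfreq k $ i) * (LINT x|torus. fchar (- k) x * G x))
    sums (LINT x|torus. of_real (field c x $ i) * G x)"
proof -
  define f where "f n x = (\<Sum>k\<in>shell n. c k * of_real (vfreq k $ i) * (fchar (- k) x * G x))" for n x
  define a where "a n = (\<Sum>k\<in>shell n. norm (c k))" for n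
  have f_int: "integrable torus (f n)" for n
    unfolding f_def by (intro Bochner_Integration.integrable_sum integrable_mult_right integrable_mult_fchar G)
  have f_le: "norm (f n x) \<le> a n * norm (G x)" for n x
    unfolding f_def a_def sum_distrib_right
  proof (rule sum_norm_le)
    fix k assume "k \<in> shell n"
    then have "\<bar>vfreq k $ i\<bar> \<le> 1"
      using component_le_norm_cart[of "vfreq k" i] norm_vfreq[of k] shell_subset[of n] by auto
    then show "norm (c k * of_real (vfreq k $ i) * (fchar (- k) x * G x)) \<le> norm (c k) * norm (G x)"
      by (simp add: norm_mult norm_fchar mult_right_mono mult_left_le)
  qed
  have a: "summable a" using abs_summable by (simp add: a_def[abs_def])
  have "(\<lambda>n. LINT x|torus. f n x) sums (LINT x|torus. (\<Sum>n. f n x))"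
  proof (rule sums_integral[OF f_int])
    show "AE x in torus. summable (\<lambda>n. norm (f n x))"
      by (intro always_eventually allI, rule summable_comparison_test'[OF summable_mult2[OF a], of 0]) 
        (use f_le in auto)
    show "summable (\<lambda>n. LINT x|torus. norm (f n x))"
    proof (rule summable_comparison_test'[OF summable_mult2[OF a], of 0])
      fix n
      have "(LINT x|torus. norm (f n x)) \<le> (LINT x|torus. a n * norm (G x))"
        by (intro integral_mono f_le integrable_norm f_int integrable_mult_right G)
      then show "norm (LINT x|torus. norm (f n x)) \<le> a n * (LINT x|torus. norm (G x))"
        by simp
    qed
  qed
  moreover have "(\<Sum>n. f n x) = of_real (field c x $ i) * G x" for x
    using sums_mult2[OF field_component_sums[of i x], of "G x"]
    by (simp add: f_def sums_iff sum_distrib_right mult.assoc)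
  moreover have "(LINT x|torus. f n x) = (\<Sum>k\<in>shell n. c k * of_real (vfreq k $ i) * (LINT x|torus. fchar (- k) x * G x))" for n
    unfolding f_def by (subst Bochner_Integration.integral_sum) (auto intro!: integrable_mult_right integrable_mult_fchar G)
  ultimately show ?thesis by simp
qed

lemma fourier_field: "fourier (field c) m = (if m \<in> Mfreq then c m *s cvec (vfreq m) else 0)"
proof -
  have "fourier (field c) m $ i = (if m \<in> Mfreq then c m * of_real (vfreq m $ i) else 0)" for i
  proof -
    define f where "f k = (if k = m then c k * of_real (vfreq k $ i) else 0)" for k
    have "(LINT x|torus. fchar (- k) x * fchar m x) = (if k = m then 1 else 0)" for k
      unfolding fchar_diff[symmetric] integral_fchar by auto
    then have "(\<lambda>n. \<Sum>k\<in>shell n. f k) sums (fourier (field c) m $ i)"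
      using integral_field_mult_sums[OF fchar_integrable, of i m]
      by (simp add: f_def fourier_def if_distrib[of "\<lambda>x. _ * x"] cong: if_cong)
    moreover have "(\<lambda>n. \<Sum>k\<in>shell n. f k) sums (\<Sum>k\<in>{m} \<inter> Mfreq. f k)"
      by (rule sums_shell_finite) (auto simp: f_def)
    ultimately have "fourier (field c) m $ i = (\<Sum>k\<in>{m} \<inter> Mfreq. f k)" by (rule sums_unique2)
    then show ?thesis by (simp add: f_def)
  qed
  then show ?thesis by (simp add: vec_eq_iff cvec_def)
qed

text \<open>The p-th mode of the first factor shifts the character, so its integral is the
  coefficient of the second factor at m - p. This vanishes off \<open>Mfreq\<close>, and only the
  finitely many triads of m remain.\<close>

lemma fourier_tensor:
  assumes "m \<in> Mfreq"
  shows "(LINT x|torus. of_real (field c x $ j * field c x $ i) * fchar m x) =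
    (\<Sum>(p, q)\<in>triads m. c p * of_real (vfreq p $ j) * (c q * of_real (vfreq q $ i)))"
proof -
  define f where "f p = c p * of_real (vfreq p $ j) * (fourier (field c) (m - p) $ i)" for p
  have G: "integrable torus (\<lambda>x. of_real (field c x $ i) * fchar m x)"
    by (intro integrable_field_mult fchar_integrable)
  have "(LINT x|torus. fchar (- p) x * (of_real (field c x $ i) * fchar m x)) = fourier (field c) (m - p) $ i" for p
    by (simp add: fourier_def fchar_diff mult_ac)
  then have 1: "(\<lambda>n. \<Sum>p\<in>shell n. f p) sums (LINT x|torus. of_real (field c x $ j) * (of_real (field c x $ i) * fchar m x))"
    using integral_field_mult_sums[OF G, of j] by (simp add: f_def)
  have tri: "(p, m - p) \<in> triads m" if "p \<in> Mfreq" "m - p \<in> Mfreq" for p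
    using that assms by (simp add: triads_def)
  have 2: "(\<lambda>n. \<Sum>p\<in>shell n. f p) sums (\<Sum>p\<in>fst ` triads m. f p)"
  proof (rule sums_shell_finite)
    fix p assume "p \<in> Mfreq - fst ` triads m"
    then have "m - p \<notin> Mfreq" using tri[of p] by force
    then show "f p = 0" by (simp add: f_def fourier_field)
  qed (auto simp: finite_triads, auto simp: triads_def split: if_splits)
  have inj: "inj_on fst (triads m)" by (auto simp: inj_on_def triads_def split: if_splits)
  have "(\<Sum>p\<in>fst ` triads m. f p) = (\<Sum>(p, q)\<in>triads m. c p * of_real (vfreq p $ j) * (c q * of_real (vfreq q $ i)))"
    unfolding sum.reindex[OF inj] o_def
  proof (intro sum.cong refl)
    fix pq assume "pq \<in> triads m"
    moreover obtain p q where "pq = (p, q)" by force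
    ultimately have "pq = (p, m - p)" "m - p \<in> Mfreq" by (auto simp: triads_def split: if_splits)
    then show "f (fst pq) = (case pq of (p, q) \<Rightarrow> c p * of_real (vfreq p $ j) * (c q * of_real (vfreq q $ i)))"
      by (simp add: f_def fourier_field cvec_def)
  qed
  with sums_unique2[OF 1 2] show ?thesis by (simp add: mult.assoc)
qed

end

section \<open>The advection term in amplitudes\<close>

lemma fchar_has_derivative:
  "(fchar k has_derivative (\<lambda>h. - (2 * of_real pi * \<i> * of_real (rvec k \<bullet> h)) * fchar k x)) (at x within S)"
proof -
  define g where "g x = - (2 * of_real pi * \<i> * of_real (rvec k \<bullet> x))" for x
  have g: "(g has_derivative g) (at x within S)"
    unfolding g_def by (auto intro!: derivative_eq_intros)
  have "((\<lambda>x. exp (g x)) has_derivative (\<lambda>h. exp (g x) * g h)) (at x within S)"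
    by (rule has_derivative_compose[OF g DERIV_exp[unfolded has_field_derivative_def]])
  then show ?thesis by (simp add: g_def fchar_def[abs_def] mult_ac)
qed

lemma frechet_derivative_fchar:
  "frechet_derivative (fchar k) (at x) (axis j 1) = - (2 * of_real pi * \<i> * of_int (k $ j)) * fchar k x"
  using frechet_derivative_at[OF fchar_has_derivative[of k x UNIV], symmetric]
  by (simp add: inner_axis rvec_def)

text \<open>The minus sign of the distributional divergence cancels the one from differentiating
  \<open>fchar\<close>, which leaves the symbol 2 \<pi> i m. Projecting the convolution onto
  \<open>vfreq m\<close> then produces \<open>coupling\<close>.\<close>

lemma (in real_coefficients) proj_advection_field:
  assumes "m \<in> Mfreq"
  shows "proj_M (advection (field c)) m = nonlinearity c m *s cvec (vfreq m)"
proof -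
  define K :: complex where "K = 2 * of_real pi * \<i>"
  have adv: "advection (field c) m $ i = (\<Sum>(p, q)\<in>triads m. K * of_real (rvec m \<bullet> vfreq p) * c p * c q * of_real (vfreq q $ i))" for i
  proof -
    have "advection (field c) m $ i = (\<Sum>j\<in>UNIV. K * of_int (m $ j) * (LINT x|torus. of_real (field c x $ j * field c x $ i) * fchar m x))"
      unfolding advection_def div_tensor_def K_def frechet_derivative_fchar sum_negf[symmetric] vec_lambda_beta
      by (intro sum.cong refl, subst integral_mult_right_zero[symmetric], subst integral_minus[symmetric]) (simp add: mult_ac)
    also have "\<dots> = (\<Sum>(p, q)\<in>triads m. \<Sum>j\<in>UNIV. K * of_int (m $ j) * (c p * of_real (vfreq p $ j) * (c q * of_real (vfreq q $ i))))"
      unfolding fourier_tensor[OF assms] sum_distrib_left case_prod_beta by (rule sum.swap)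
    also have "\<dots> = (\<Sum>(p, q)\<in>triads m. K * of_real (rvec m \<bullet> vfreq p) * c p * c q * of_real (vfreq q $ i))"
      unfolding case_prod_beta
      by (intro sum.cong refl) (simp add: inner_vec_def rvec_def sum_distrib_left sum_distrib_right mult_ac)
    finally show ?thesis .
  qed
  have "(\<Sum>i\<in>UNIV. of_real (vfreq m $ i) * advection (field c) m $ i) = 
     (\<Sum>(p, q)\<in>triads m. \<Sum>i\<in>UNIV. of_real (vfreq m $ i) * (K * of_real (rvec m \<bullet> vfreq p) * c p * c q * of_real (vfreq q $ i)))"
    unfolding adv sum_distrib_left case_prod_beta by (rule sum.swap)
  also have "\<dots> = nonlinearity c m"
    unfolding case_prod_beta nonlinearity_def coupling_def K_def inner_vec_def[of "vfreq m"]
    by (intro sum.cong refl) (simp add: sum_distrib_left sum_distrib_right mult_ac)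
  finally show ?thesis using assms by (simp add: proj_M_def)
qed

text \<open>Formulated for any function with coefficients of this shape, so that it covers the data,
  the solution at a fixed time, and the difference of two times.\<close>

lemma Hdot_norm_shells:
  assumes w: "\<And>k. fourier u k = (if k \<in> Mfreq then c k *s cvec (vfreq k) else 0)"
  shows "(\<lambda>k. lap_symbol s k * (norm (fourier u k))\<^sup>2) summable_on (UNIV - {0})
      \<longleftrightarrow> summable (\<lambda>n. lam n powr s * (\<Sum>k\<in>shell n. (norm (c k))\<^sup>2))"
    and "summable (\<lambda>n. lam n powr s * (\<Sum>k\<in>shell n. (norm (c k))\<^sup>2)) \<Longrightarrow>
      Hdot_norm s u = sqrt (\<Sum>n. lam n powr s * (\<Sum>k\<in>shell n. (norm (c k))\<^sup>2))"
proof -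
  define g where "g k = lap_symbol s k * (norm (fourier u k))\<^sup>2" for k
  have g: "0 \<le> g k" "k \<notin> Mfreq \<Longrightarrow> g k = 0" for k
    by (simp_all add: g_def w lap_symbol_def)
  have gs: "(\<Sum>k\<in>shell n. g k) = lam n powr s * (\<Sum>k\<in>shell n. (norm (c k))\<^sup>2)" for n
    unfolding sum_distrib_left g_def
  proof (intro sum.cong refl)
    fix k assume k: "k \<in> shell n"
    then have "k \<in> Mfreq" using shell_subset by auto
    then show "lap_symbol s k * (norm (fourier u k))\<^sup>2 = lam n powr s * (norm (c k))\<^sup>2"
      by (simp add: w lap_symbol_shell[OF k] norm_scalar_cvec norm_vfreq)
  qed
  note h = has_sum_shells[of g, OF g, unfolded gs]
  show iff: "(\<lambda>k. lap_symbol s k * (norm (fourier u k))\<^sup>2) summable_on (UNIV - {0})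
      \<longleftrightarrow> summable (\<lambda>n. lam n powr s * (\<Sum>k\<in>shell n. (norm (c k))\<^sup>2))"
    using h(1) by (simp add: g_def[abs_def])
  assume "summable (\<lambda>n. lam n powr s * (\<Sum>k\<in>shell n. (norm (c k))\<^sup>2))"
  then show "Hdot_norm s u = sqrt (\<Sum>n. lam n powr s * (\<Sum>k\<in>shell n. (norm (c k))\<^sup>2))"
    using h by (simp add: Hdot_norm_def g_def[abs_def])
qed

lemma (in real_coefficients) field_in_HdotM:
  assumes "summable (\<lambda>n. lam n powr s * (\<Sum>k\<in>shell n. (norm (c k))\<^sup>2))"
  shows "field c \<in> HdotM s"
proof -
  let ?S = "\<Sum>n. \<Sum>k\<in>shell n. norm (c k)"
  have "integrable torus (\<lambda>x. (norm (field c x))\<^sup>2)"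
  proof (rule torus.integrable_const_bound)
    show "AE x in torus. norm ((norm (field c x))\<^sup>2) \<le> ?S\<^sup>2"
      using norm_field_le by (simp add: power_mono)
    show "(\<lambda>x. (norm (field c x))\<^sup>2) \<in> borel_measurable torus"
      using field_measurable by measurable
  qed
  moreover have "(LINT x|torus. field c x) = 0"
  proof -
    have "(LINT x|torus. field c x) $ i = 0" for i
    proof -
      have "complex_of_real (LINT x|torus. field c x $ i) = fourier (field c) 0 $ i"
        by (simp add: fourier_def fchar_def rvec_zero)
      also have "\<dots> = 0" by (simp add: fourier_field zero_notin_Mfreq)
      finally have "(LINT x|torus. field c x $ i) = 0" by simp
      then show ?thesis
        using integral_bounded_linear[OF bounded_linear_vec_nth field_integrable, of i] by simp
    qed
    then show ?thesis by (simp add: vec_eq_iff)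
  qed
  moreover have "(\<lambda>k. lap_symbol s k * (norm (fourier (field c) k))\<^sup>2) summable_on (UNIV - {0})"
    using Hdot_norm_shells(1)[of "field c" c, OF fourier_field] assms by simp
  ultimately show ?thesis
    by (auto simp: HdotM_def Hdot_def field_periodic field_measurable fourier_field split: if_splits)
qed

section \<open>Smoothness\<close>

text \<open>On an open set the derivative at a point sees only nearby values in the set. This
  permits replacing a derivative by its series, and \<open>evolution\<close> by the velocity, which
  agrees with it only for positive times.\<close>

lemma Ck_on_cong:
  assumes "open S" "\<And>x. x \<in> S \<Longrightarrow> f x = g x" "Ck_on n S f"
  shows "Ck_on n S g"
  using assms(2,3)
proof (induction n arbitrary: f g)
  case 0
  then show ?case by (metis Ck_on.simps(1) continuous_on_cong)
next
  case (Suc n)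
  have D: "(g has_derivative frechet_derivative f (at x)) (at x)" if x: "x \<in> S" for x
  proof (rule has_derivative_transform_within_open[OF _ assms(1) x])
    show "(f has_derivative frechet_derivative f (at x)) (at x)"
      using Suc.prems(2) x by (simp add: frechet_derivative_works)
  qed (use Suc.prems in auto)
  have "Ck_on n S (\<lambda>x. frechet_derivative g (at x) v)" for v
  proof (rule Suc.IH)
    show "Ck_on n S (\<lambda>x. frechet_derivative f (at x) v)" using Suc.prems(2) by simp
    show "frechet_derivative f (at x) v = frechet_derivative g (at x) v" if "x \<in> S" for x
      using frechet_derivative_at[OF D[OF that]] by simp
  qed
  then show ?case using D by (auto simp: differentiable_def)
qed

text \<open>Decay faster than any power of the frequency, whose length is of order 2 ^ n, uniformly
  for times bounded away from 0. The constant may blow up as \<epsilon> tends to 0, since the data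
  have only Sobolev regularity.\<close>

definition decaying :: "(int ^ 3 \<Rightarrow> real \<Rightarrow> complex) \<Rightarrow> bool" where
  "decaying a \<longleftrightarrow> (\<forall>\<epsilon>>0. \<forall>m. \<exists>C\<ge>0. \<forall>n. \<forall>k\<in>shell n. \<forall>t\<ge>\<epsilon>. norm (a k t) * 2 ^ (m * n) \<le> C)"

definition time_derivative :: "(int ^ 3 \<Rightarrow> real \<Rightarrow> complex) \<Rightarrow> (int ^ 3 \<Rightarrow> real \<Rightarrow> complex) \<Rightarrow> bool" where
  "time_derivative a a' \<longleftrightarrow> (\<forall>k\<in>Mfreq. \<forall>t>0. (a k has_vector_derivative a' k t) (at t))"

text \<open>Only time derivatives are counted: a space derivative multiplies the amplitudes by a
  polynomial in k, which rapid decay absorbs.\<close>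

fun smooth_family :: "nat \<Rightarrow> (int ^ 3 \<Rightarrow> real \<Rightarrow> complex) \<Rightarrow> bool" where
  "smooth_family 0 a \<longleftrightarrow> decaying a"
| "smooth_family (Suc n) a \<longleftrightarrow> decaying a \<and> (\<exists>a'. time_derivative a a' \<and> smooth_family n a')"

lemma decayingE:
  assumes "decaying a" "0 < \<epsilon>"
  obtains C where "0 \<le> C" "\<And>n k t. k \<in> shell n \<Longrightarrow> \<epsilon> \<le> t \<Longrightarrow> norm (a k t) * 2 ^ (m * n) \<le> C"
  using assms unfolding decaying_def by meson

lemma smooth_family_decaying: "smooth_family n a \<Longrightarrow> decaying a"
  by (cases n) auto

lemma smooth_family_Suc: "smooth_family (Suc n) a \<Longrightarrow> smooth_family n a"
  by (induction n arbitrary: a) auto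

lemma two_power_mult_self: "(2::real) ^ n * 2 ^ n = 4 ^ n"
  by (simp flip: power_mult_distrib)

lemma two_power_add_2_mult: "(2::real) ^ ((m + 2) * n) = 2 ^ (m * n) * 4 ^ n"
proof -
  have "(m + 2) * n = m * n + (n + n)" by simp
  then show ?thesis by (simp only: power_add two_power_mult_self)
qed

lemma decaying_mult:
  assumes "decaying a" and \<mu>: "\<And>n k. k \<in> shell n \<Longrightarrow> norm (\<mu> k) \<le> D * 4 ^ n" and D: "0 \<le> D"
  shows "decaying (\<lambda>k t. \<mu> k * a k t)"
  unfolding decaying_def
proof (intro allI impI)
  fix \<epsilon> :: real and m :: nat assume "0 < \<epsilon>"
  \<comment> \<open>Two additional powers of 2 ^ n pay for the multiplier of size 4 ^ n.\<close>
  then obtain C where C: "0 \<le> C" "\<And>n k t. k \<in> shell n \<Longrightarrow> \<epsilon> \<le> t \<Longrightarrow> norm (a k t) * 2 ^ ((m + 2) * n) \<le> C"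
    using decayingE[OF assms(1)] by metis
  have "norm (\<mu> k * a k t) * 2 ^ (m * n) \<le> D * C" if "k \<in> shell n" "\<epsilon> \<le> t" for n k t
  proof -
    have "norm (\<mu> k * a k t) * 2 ^ (m * n) \<le> D * 4 ^ n * norm (a k t) * 2 ^ (m * n)"
      using \<mu>[OF that(1)] by (simp add: norm_mult mult_right_mono)
    also have "\<dots> = D * (norm (a k t) * 2 ^ ((m + 2) * n))"
      unfolding two_power_add_2_mult by simp
    also have "\<dots> \<le> D * C" using C(2)[OF that] D by (rule mult_left_mono)
    finally show ?thesis .
  qed
  then show "\<exists>C\<ge>0. \<forall>n. \<forall>k\<in>shell n. \<forall>t\<ge>\<epsilon>. norm (\<mu> k * a k t) * 2 ^ (m * n) \<le> C"
    using C(1) D by (intro exI[of _ "D * C"]) auto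
qed

lemma decaying_add:
  assumes "decaying a" "decaying b"
  shows "decaying (\<lambda>k t. a k t + b k t)"
  unfolding decaying_def
proof (intro allI impI)
  fix \<epsilon> :: real and m :: nat assume \<epsilon>: "0 < \<epsilon>"
  obtain C where C: "0 \<le> C" "\<And>n k t. k \<in> shell n \<Longrightarrow> \<epsilon> \<le> t \<Longrightarrow> norm (a k t) * 2 ^ (m * n) \<le> C"
    using decayingE[OF assms(1) \<epsilon>] by metis
  obtain D where D: "0 \<le> D" "\<And>n k t. k \<in> shell n \<Longrightarrow> \<epsilon> \<le> t \<Longrightarrow> norm (b k t) * 2 ^ (m * n) \<le> D"
    using decayingE[OF assms(2) \<epsilon>] by metis
  have "norm (a k t + b k t) * 2 ^ (m * n) \<le> C + D" if "k \<in> shell n" "\<epsilon> \<le> t" for n k t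
  proof -
    have "norm (a k t + b k t) * 2 ^ (m * n) \<le> (norm (a k t) + norm (b k t)) * 2 ^ (m * n)"
      by (intro mult_right_mono norm_triangle_ineq) simp
    also have "\<dots> = norm (a k t) * 2 ^ (m * n) + norm (b k t) * 2 ^ (m * n)" by (rule ring_distribs)
    finally show ?thesis using C(2)[OF that] D(2)[OF that] by linarith
  qed
  then show "\<exists>C\<ge>0. \<forall>n. \<forall>k\<in>shell n. \<forall>t\<ge>\<epsilon>. norm (a k t + b k t) * 2 ^ (m * n) \<le> C"
    using C(1) D(1) by (intro exI[of _ "C + D"]) auto
qed

text \<open>One factor carries the entire weight, and the other only has to be bounded. As p lies at
  most one shell below k, moving the weight from k to p costs the fixed factor 2 ^ (m + 2).\<close>

lemma decaying_quadratic:
  assumes "decaying a" "decaying b"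
    and B: "\<And>n k p q. k \<in> shell n \<Longrightarrow> (p, q) \<in> triads k \<Longrightarrow> norm (B k p q) \<le> D * 4 ^ n" and D: "0 \<le> D"
  shows "decaying (\<lambda>k t. \<Sum>(p, q)\<in>triads k. B k p q * (a p t * b q t))"
  unfolding decaying_def
proof (intro allI impI)
  fix \<epsilon> :: real and m :: nat assume \<epsilon>: "0 < \<epsilon>"
  obtain C where C: "0 \<le> C" "\<And>n k t. k \<in> shell n \<Longrightarrow> \<epsilon> \<le> t \<Longrightarrow> norm (a k t) * 2 ^ ((m + 2) * n) \<le> C"
    using decayingE[OF assms(1) \<epsilon>] by metis
  obtain E where E: "0 \<le> E" "\<And>n k t. k \<in> shell n \<Longrightarrow> \<epsilon> \<le> t \<Longrightarrow> norm (b k t) * 2 ^ (0 * n) \<le> E"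
    using decayingE[OF assms(2) \<epsilon>] by metis
  define H where "H = D * (2 ^ (m + 2) * C) * E"
  have H: "0 \<le> H" using C E D by (simp add: H_def)
  have *: "norm (\<Sum>(p, q)\<in>triads k. B k p q * (a p t * b q t)) * 2 ^ (m * n) \<le> 72 * H"
    if k: "k \<in> shell n" and t: "\<epsilon> \<le> t" for n k t
  proof -
    have e: "norm (B k p q * (a p t * b q t)) \<le> H / 2 ^ (m * n)" if pq: "(p, q) \<in> triads k" for p q
    proof -
      obtain i j where ij: "p \<in> shell i" "q \<in> shell j" "n \<le> Suc i" using triads_levels[OF pq k] by metis
      have "norm (a p t) * 2 ^ ((m + 2) * n) \<le> norm (a p t) * 2 ^ ((m + 2) * Suc i)"
        using ij(3) by (intro mult_left_mono power_increasing mult_le_mono2) auto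
      also have "\<dots> = 2 ^ (m + 2) * (norm (a p t) * 2 ^ ((m + 2) * i))"
        by (simp add: power_add mult_ac)
      also have "\<dots> \<le> 2 ^ (m + 2) * C" using C(2)[OF ij(1) t] by (intro mult_left_mono) auto
      finally have A: "norm (a p t) * 2 ^ ((m + 2) * n) \<le> 2 ^ (m + 2) * C" .
      have B': "norm (B k p q) / 4 ^ n \<le> D" using B[OF k pq] by (simp add: field_simps)
      have E': "norm (b q t) \<le> E" using E(2)[OF ij(2) t] by simp
      have "norm (B k p q * (a p t * b q t)) * 2 ^ (m * n)
          = norm (B k p q) / 4 ^ n * (norm (a p t) * 2 ^ ((m + 2) * n)) * norm (b q t)"
        unfolding two_power_add_2_mult by (simp add: norm_mult)
      also have "\<dots> \<le> D * (2 ^ (m + 2) * C) * E"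
        by (intro mult_mono B' A E') (use C(1) D in simp_all)
      finally show ?thesis by (simp add: H_def field_simps)
    qed
    have "norm (\<Sum>(p, q)\<in>triads k. B k p q * (a p t * b q t)) \<le> (\<Sum>pq\<in>triads k. H / 2 ^ (m * n))"
      using e by (intro sum_norm_le) auto
    also have "\<dots> = card (triads k) * (H / 2 ^ (m * n))" by simp
    also have "\<dots> \<le> 72 * (H / 2 ^ (m * n))"
      using card_triads[of k] H by (intro mult_right_mono) auto
    finally show ?thesis by (simp add: field_simps)
  qed
  show "\<exists>C\<ge>0. \<forall>n. \<forall>k\<in>shell n. \<forall>t\<ge>\<epsilon>. norm (\<Sum>(p, q)\<in>triads k. B k p q * (a p t * b q t)) * 2 ^ (m * n) \<le> C"
    using * H by (intro exI[of _ "72 * H"]) auto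
qed

lemma smooth_family_mult:
  assumes "smooth_family N a" "\<And>n k. k \<in> shell n \<Longrightarrow> norm (\<mu> k) \<le> D * 4 ^ n" "0 \<le> D"
  shows "smooth_family N (\<lambda>k t. \<mu> k * a k t)"
  using assms(1)
proof (induction N arbitrary: a)
  case 0
  then show ?case by (simp add: decaying_mult[OF _ assms(2,3)])
next
  case (Suc N)
  then obtain a' where a': "time_derivative a a'" "smooth_family N a'" "decaying a" by auto
  have "time_derivative (\<lambda>k t. \<mu> k * a k t) (\<lambda>k t. \<mu> k * a' k t)"
    using a'(1) by (auto simp: time_derivative_def intro!: has_vector_derivative_mult_right)
  then show ?case using Suc.IH[OF a'(2)] decaying_mult[OF a'(3) assms(2,3)] by auto
qed

lemma smooth_family_add:
  assumes "smooth_family N a" "smooth_family N b"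
  shows "smooth_family N (\<lambda>k t. a k t + b k t)"
  using assms
proof (induction N arbitrary: a b)
  case 0
  then show ?case using decaying_add by simp
next
  case (Suc N)
  then obtain a' b' where a': "time_derivative a a'" "smooth_family N a'" "decaying a"
    and b': "time_derivative b b'" "smooth_family N b'" "decaying b" by auto
  have "time_derivative (\<lambda>k t. a k t + b k t) (\<lambda>k t. a' k t + b' k t)"
    using a'(1) b'(1) by (auto simp: time_derivative_def intro!: has_vector_derivative_add)
  then show ?case using Suc.IH[OF a'(2) b'(2)] decaying_add[OF a'(3) b'(3)] by auto
qed

lemma smooth_family_quadratic:
  assumes "smooth_family N a" "smooth_family N b"
    and B: "\<And>n k p q. k \<in> shell n \<Longrightarrow> (p, q) \<in> triads k \<Longrightarrow> norm (B k p q) \<le> D * 4 ^ n" and D: "0 \<le> D"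
  shows "smooth_family N (\<lambda>k t. \<Sum>(p, q)\<in>triads k. B k p q * (a p t * b q t))"
  using assms(1,2)
proof (induction N arbitrary: a b)
  case 0
  then show ?case by (simp add: decaying_quadratic[OF _ _ B D])
next
  case (Suc N)
  then obtain a' b' where a': "time_derivative a a'" "smooth_family N a'" "decaying a"
    and b': "time_derivative b b'" "smooth_family N b'" "decaying b" by auto
  let ?Q = "\<lambda>a b k t. \<Sum>(p, q)\<in>triads k. B k p q * (a p t * b q t :: complex)"
  have "time_derivative (?Q a b) (\<lambda>k t. ?Q a b' k t + ?Q a' b k t)"
    unfolding time_derivative_def
  proof (intro ballI allI impI)
    fix k and t :: real assume "k \<in> Mfreq" "0 < t"
    have "(?Q a b k has_vector_derivative (\<Sum>(p, q)\<in>triads k. B k p q * (a p t * b' q t + a' p t * b q t))) (at t)"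
      unfolding case_prod_beta
    proof (intro has_vector_derivative_sum has_vector_derivative_mult_right has_vector_derivative_mult)
      fix pq assume "pq \<in> triads k"
      then have "fst pq \<in> Mfreq" "snd pq \<in> Mfreq" by (auto simp: triads_def split: if_splits)
      then show "(a (fst pq) has_vector_derivative a' (fst pq) t) (at t)" "(b (snd pq) has_vector_derivative b' (snd pq) t) (at t)"
        using a'(1) b'(1) \<open>0 < t\<close> by (auto simp: time_derivative_def)
    qed
    moreover have "(\<Sum>(p, q)\<in>triads k. B k p q * (a p t * b' q t + a' p t * b q t)) = ?Q a b' k t + ?Q a' b k t"
      by (simp add: case_prod_beta ring_distribs sum.distrib)
    ultimately show "(?Q a b k has_vector_derivative ?Q a b' k t + ?Q a' b k t) (at t)" by simp
  qed
  moreover have "smooth_family N (\<lambda>k t. ?Q a b' k t + ?Q a' b k t)"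
    by (rule smooth_family_add[OF Suc.IH[OF smooth_family_Suc[OF Suc.prems(1)] b'(2)]
          Suc.IH[OF a'(2) smooth_family_Suc[OF Suc.prems(2)]]])
  ultimately show ?case using decaying_quadratic[OF a'(3) b'(3) B D] by auto
qed

section \<open>Termwise differentiation of the field in time and space\<close>

lemma decaying_abs_bound:
  assumes "decaying a" "0 < \<epsilon>"
  obtains C where "0 \<le> C" "\<And>n t. \<epsilon> \<le> t \<Longrightarrow> (\<Sum>k\<in>shell n. norm (a k t)) \<le> C * (1 / 2) ^ n"
proof -
  obtain C where C: "0 \<le> C" "\<And>n k t. k \<in> shell n \<Longrightarrow> \<epsilon> \<le> t \<Longrightarrow> norm (a k t) * 2 ^ (1 * n) \<le> C"
    using decayingE[OF assms] by metis
  have "(\<Sum>k\<in>shell n. norm (a k t)) \<le> (24 * C) * (1 / 2) ^ n" if t: "\<epsilon> \<le> t" for n t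
  proof -
    have "(\<Sum>k\<in>shell n. norm (a k t)) \<le> (\<Sum>k\<in>shell n. C * (1 / 2) ^ n)"
      using C(2)[OF _ t] by (intro sum_mono) (simp add: field_simps)
    also have "\<dots> = card (shell n) * (C * (1 / 2) ^ n)" by simp
    also have "\<dots> \<le> 24 * (C * (1 / 2) ^ n)" using card_shell[of n] C(1) by (intro mult_right_mono) auto
    finally show ?thesis by simp
  qed
  then show thesis using C(1) that[of "24 * C"] by simp
qed

lemma decaying_summable:
  assumes "decaying a" "0 < t"
  shows "summable (\<lambda>n. \<Sum>k\<in>shell n. norm (a k t))"
proof -
  obtain C where C: "\<And>n u. t \<le> u \<Longrightarrow> (\<Sum>k\<in>shell n. norm (a k u)) \<le> C * (1 / 2) ^ n"
    using decaying_abs_bound[OF assms] by metis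
  show ?thesis
  proof (rule summable_comparison_test'[of "\<lambda>n. C * (1 / 2) ^ n" 0])
    show "summable (\<lambda>n. C * (1 / 2) ^ n)" by (intro summable_mult summable_geometric) simp
    have "0 \<le> (\<Sum>k\<in>shell n. norm (a k t))" for n by (rule sum_nonneg) simp
    then show "norm (\<Sum>k\<in>shell n. norm (a k t)) \<le> C * (1 / 2) ^ n" for n using C[of t n] by simp
  qed
qed

definition evolution :: "(int ^ 3 \<Rightarrow> real \<Rightarrow> complex) \<Rightarrow> real \<times> (real ^ 3) \<Rightarrow> real ^ 3" where
  "evolution a z = field (\<lambda>k. a k (fst z)) (snd z)"

text \<open>The amplitudes of the derivative of the field along h, with time and space components. A
  derivative of a field is thus again a field, and all orders follow by induction.\<close>

definition direction :: "(int ^ 3 \<Rightarrow> real \<Rightarrow> complex) \<Rightarrow> (int ^ 3 \<Rightarrow> real \<Rightarrow> complex) \<Rightarrow>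
    real \<times> (real ^ 3) \<Rightarrow> int ^ 3 \<Rightarrow> real \<Rightarrow> complex" where
  "direction a a' h k t = of_real (fst h) * a' k t + 2 * of_real pi * \<i> * of_real (rvec k \<bullet> snd h) * a k t"

lemma norm_rvec_le: "k \<in> shell n \<Longrightarrow> norm (rvec k) \<le> 3 * 2 ^ n"
proof -
  assume k: "k \<in> shell n"
  have 4: "((2::real) ^ n)\<^sup>2 = 4 ^ n" by (simp add: power2_eq_square flip: power_mult_distrib)
  have "(3::real) ^ n \<le> 4 ^ n" by (rule power_mono) auto
  then have "3 * 4 ^ n + 2 * 3 ^ n \<le> 3\<^sup>2 * (4::real) ^ n"
    using zero_le_power[of "4::real" n] unfolding power2_eq_square by linarith
  then have "(norm (rvec k))\<^sup>2 \<le> (3 * 2 ^ n)\<^sup>2"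
    unfolding norm_rvec_shell[OF k] power_mult_distrib 4 .
  then show ?thesis by (rule power2_le_imp_le) simp
qed

lemma smooth_family_direction:
  assumes "smooth_family N a" "smooth_family N a'"
  shows "smooth_family N (direction a a' h)"
proof -
  have 1: "norm (complex_of_real (fst h)) \<le> \<bar>fst h\<bar> * 4 ^ n" for n
    using mult_left_mono[OF one_le_power[of "4::real" n], of "\<bar>fst h\<bar>"] by simp
  have 2: "norm (2 * complex_of_real pi * \<i> * of_real (rvec k \<bullet> snd h)) \<le> (24 * norm (snd h)) * 4 ^ n"
    if k: "k \<in> shell n" for n k
  proof -
    have "\<bar>rvec k \<bullet> snd h\<bar> \<le> norm (rvec k) * norm (snd h)" by (rule Cauchy_Schwarz_ineq2)
    also have "\<dots> \<le> (3 * 4 ^ n) * norm (snd h)"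
      using norm_rvec_le[OF k] power_mono[of "2::real" 4 n] by (intro mult_right_mono) auto
    finally have "2 * pi * \<bar>rvec k \<bullet> snd h\<bar> \<le> 8 * ((3 * 4 ^ n) * norm (snd h))"
      using pi_less_4 by (intro mult_mono) auto
    then show ?thesis by (simp add: norm_mult mult_ac)
  qed
  show ?thesis
    unfolding direction_def[abs_def]
    by (rule smooth_family_add[OF smooth_family_mult[OF assms(2) 1] smooth_family_mult[OF assms(1) 2]]) auto
qed

lemma norm_direction_le:
  assumes k: "k \<in> shell n"
  shows "norm (direction a a' h k t) \<le> (norm (a' k t) + 24 * 2 ^ n * norm (a k t)) * norm h"
proof -
  have "\<bar>rvec k \<bullet> snd h\<bar> \<le> norm (rvec k) * norm (snd h)" by (rule Cauchy_Schwarz_ineq2)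
  also have "\<dots> \<le> (3 * 2 ^ n) * norm h"
    using norm_rvec_le[OF k] norm_snd_le[of "snd h" "fst h"] by (intro mult_mono) auto
  finally have "2 * pi * \<bar>rvec k \<bullet> snd h\<bar> \<le> 8 * ((3 * 2 ^ n) * norm h)"
    using pi_less_4 by (intro mult_mono) auto
  then have 1: "norm (2 * of_real pi * \<i> * of_real (rvec k \<bullet> snd h) * a k t) \<le> 24 * 2 ^ n * norm h * norm (a k t)"
    by (simp add: norm_mult mult_right_mono)
  have 2: "norm (of_real (fst h) * a' k t) \<le> norm h * norm (a' k t)"
    using norm_fst_le[of "fst h" "snd h"] by (simp add: norm_mult mult_right_mono)
  show ?thesis unfolding direction_def
    using norm_triangle_mono[OF 2 1] by (simp add: algebra_simps)
qed

lemma evolution_term_derivative: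
  assumes "(a k has_vector_derivative a' k (fst z)) (at (fst z))"
  shows "((\<lambda>z. Re (a k (fst z) * fchar (- k) (snd z)) *\<^sub>R vfreq k) has_derivative
    (\<lambda>h. Re (direction a a' h k (fst z) * fchar (- k) (snd z)) *\<^sub>R vfreq k)) (at z)"
proof -
  have 1: "((\<lambda>z. a k (fst z)) has_derivative (\<lambda>h. fst h *\<^sub>R a' k (fst z))) (at z)"
    by (rule has_derivative_compose[OF has_derivative_fst[OF has_derivative_ident] assms[unfolded has_vector_derivative_def]])
  have 2: "((\<lambda>z. fchar (- k) (snd z)) has_derivative (\<lambda>h. - (2 * of_real pi * \<i> * of_real (rvec (- k) \<bullet> snd h)) * fchar (- k) (snd z))) (at z)"
    by (rule has_derivative_compose[OF has_derivative_snd[OF has_derivative_ident] fchar_has_derivative])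
  have "((\<lambda>z. Re (a k (fst z) * fchar (- k) (snd z)) *\<^sub>R vfreq k) has_derivative
    (\<lambda>h. Re (a k (fst z) * (- (2 * of_real pi * \<i> * of_real (rvec (- k) \<bullet> snd h)) * fchar (- k) (snd z)) +
       fst h *\<^sub>R a' k (fst z) * fchar (- k) (snd z)) *\<^sub>R vfreq k)) (at z)"
    by (intro has_derivative_scaleR_left bounded_linear.has_derivative[OF bounded_linear_Re] has_derivative_mult 1 2)
  then show ?thesis
    by (simp add: direction_def rvec_uminus scaleR_conv_of_real algebra_simps)
qed

lemma norm_partial_sum_minus_limit:
  fixes f :: "nat \<Rightarrow> 'a::banach"
  assumes "f sums l" "\<And>i. norm (f i) \<le> b i" "summable b"
  shows "norm (sum f {..<n} - l) \<le> (\<Sum>i. b (i + n))"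
proof -
  have "(\<lambda>i. f (i + n)) sums (l - sum f {..<n})" using assms(1) by (rule sums_split_initial_segment)
  then have "norm (l - sum f {..<n}) \<le> (\<Sum>i. b (i + n))"
    using norm_suminf_le[of "\<lambda>i. f (i + n)" "\<lambda>i. b (i + n)"] assms(2,3)
    by (simp add: sums_iff summable_iff_shift)
  then show ?thesis by (simp add: norm_minus_commute)
qed

lemma evolution_has_derivative:
  assumes a: "decaying a" and a': "decaying a'" and D: "time_derivative a a'" and z: "0 < fst z"
  shows "(evolution a has_derivative (\<lambda>h. evolution (direction a a' h) z)) (at z)"
proof -
  \<comment> \<open>Half of the given time leaves an open convex neighbourhood on which the decay
    bounds are uniform.\<close>
  define \<epsilon> where "\<epsilon> = fst z / 2"
  have \<epsilon>: "0 < \<epsilon>" using z by (simp add: \<epsilon>_def)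
  define S where "S = {\<epsilon><..} \<times> (UNIV :: (real ^ 3) set)"
  have S: "open S" "convex S" "z \<in> S"
    using z by (auto simp: S_def \<epsilon>_def open_Times intro!: convex_Times) (auto simp: mem_Times_iff)
  define f where "f n z = (\<Sum>k\<in>shell n. Re (a k (fst z) * fchar (- k) (snd z)) *\<^sub>R vfreq k)" for n z
  define f' where "f' n z h = (\<Sum>k\<in>shell n. Re (direction a a' h k (fst z) * fchar (- k) (snd z)) *\<^sub>R vfreq k)" for n z h
  have dir: "decaying (direction a a' h)" for h
    using smooth_family_direction[of 0 a a'] a a' by simp
  have sums: "(\<lambda>n. f n z) sums evolution a z" "(\<lambda>n. f' n z h) sums evolution (direction a a' h) z"
    if "z \<in> S" for z h
    using that \<epsilon> unfolding f_def f'_def evolution_def S_def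
    by (intro field_sums decaying_summable a dir; auto)+
  \<comment> \<open>Two powers for a, because its space derivative loses one factor 2 ^ n; one power
    suffices for a'. Both leave the summable bound (1 / 2) ^ n.\<close>
  obtain C where C: "0 \<le> C" "\<And>n k t. k \<in> shell n \<Longrightarrow> \<epsilon> \<le> t \<Longrightarrow> norm (a k t) * 2 ^ (2 * n) \<le> C"
    using decayingE[OF a \<epsilon>] by metis
  obtain C' where C': "0 \<le> C'" "\<And>n k t. k \<in> shell n \<Longrightarrow> \<epsilon> \<le> t \<Longrightarrow> norm (a' k t) * 2 ^ (1 * n) \<le> C'"
    using decayingE[OF a' \<epsilon>] by metis
  define b where "b n = 24 * (C' + 24 * C) * (1 / 2) ^ n" for n :: nat
  have b: "summable b" unfolding b_def by (intro summable_mult summable_geometric) simp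
  have f'_le: "norm (f' n z h) \<le> b n * norm h" if "z \<in> S" for n z h
  proof -
    have t: "\<epsilon> \<le> fst z" using that by (auto simp: S_def)
    have "norm (f' n z h) \<le> (\<Sum>k\<in>shell n. (C' + 24 * C) * (1 / 2) ^ n * norm h)"
      unfolding f'_def
    proof (rule sum_norm_le)
      fix k assume k: "k \<in> shell n"
      have 4: "(2::real) ^ (2 * n) = 2 ^ n * 2 ^ n" by (simp add: power_mult power_mult_distrib[symmetric])
      have "norm (Re (direction a a' h k (fst z) * fchar (- k) (snd z)) *\<^sub>R vfreq k) \<le> norm (direction a a' h k (fst z))"
        using abs_Re_le_cmod[of "direction a a' h k (fst z) * fchar (- k) (snd z)"] norm_vfreq[of k] shell_subset[of n] k
        by (auto simp: norm_mult norm_fchar)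
      also have "\<dots> \<le> (norm (a' k (fst z)) + 24 * 2 ^ n * norm (a k (fst z))) * norm h"
        by (rule norm_direction_le[OF k])
      also have "\<dots> \<le> (C' + 24 * C) * (1 / 2) ^ n * norm h"
        using C(2)[OF k t] C'(2)[OF k t] unfolding 4
        by (intro mult_right_mono) (simp_all add: field_simps)
      finally show "norm (Re (direction a a' h k (fst z) * fchar (- k) (snd z)) *\<^sub>R vfreq k) \<le> (C' + 24 * C) * (1 / 2) ^ n * norm h" .
    qed
    also have "\<dots> = card (shell n) * ((C' + 24 * C) * (1 / 2) ^ n * norm h)" by simp
    also have "\<dots> \<le> 24 * ((C' + 24 * C) * (1 / 2) ^ n * norm h)"
      using card_shell[of n] C(1) C'(1) by (intro mult_right_mono) auto
    also have "\<dots> = b n * norm h" by (simp only: b_def mult.assoc)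
    finally show ?thesis .
  qed
  have "\<exists>g. \<forall>z\<in>S. (\<lambda>n. f n z) sums g z \<and> (g has_derivative (\<lambda>h. evolution (direction a a' h) z)) (at z within S)"
  proof (rule has_derivative_series[where f = f and f' = f' and x = z and l = "evolution a z"])
    show "convex S" "z \<in> S" "(\<lambda>n. f n z) sums evolution a z" by (fact S sums(1)[OF S(3)])+
  next
    fix n z assume "z \<in> S"
    then have "0 < fst z" using \<epsilon> by (auto simp: S_def)
    then have "(f n has_derivative f' n z) (at z)" unfolding f_def f'_def
      by (intro has_derivative_sum evolution_term_derivative)
         (use D shell_subset[of n] in \<open>auto simp: time_derivative_def\<close>)
    then show "(f n has_derivative f' n z) (at z within S)" by (rule has_derivative_at_withinI)
  next
    fix e :: real assume "0 < e"
    then obtain N where N: "\<And>n. N \<le> n \<Longrightarrow> norm (\<Sum>i. b (i + n)) < e" using suminf_exist_split[OF _ b] by blast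
    show "\<forall>\<^sub>F n in sequentially. \<forall>z\<in>S. \<forall>h. norm (sum (\<lambda>i. f' i z h) {..<n} - evolution (direction a a' h) z) \<le> e * norm h"
      unfolding eventually_sequentially
    proof (intro exI allI impI ballI)
      fix n z h assume n: "N \<le> n" and z: "z \<in> S"
      have "norm (sum (\<lambda>i. f' i z h) {..<n} - evolution (direction a a' h) z) \<le> (\<Sum>i. b (i + n) * norm h)"
        by (rule norm_partial_sum_minus_limit[OF sums(2)[OF z] f'_le[OF z] summable_mult2[OF b]])
      also have "\<dots> = (\<Sum>i. b (i + n)) * norm h"
        using b by (intro suminf_mult2[symmetric]) (simp add: summable_iff_shift)
      also have "\<dots> \<le> e * norm h" using N[OF n] by (intro mult_right_mono) auto
      finally show "norm (sum (\<lambda>i. f' i z h) {..<n} - evolution (direction a a' h) z) \<le> e * norm h" .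
    qed
  qed
  then obtain g where g: "\<And>z. z \<in> S \<Longrightarrow> (\<lambda>n. f n z) sums g z"
    "\<And>z. z \<in> S \<Longrightarrow> (g has_derivative (\<lambda>h. evolution (direction a a' h) z)) (at z within S)" by blast
  have eq: "g z = evolution a z" if "z \<in> S" for z using g(1)[OF that] sums(1)[OF that] by (rule sums_unique2)
  have "(g has_derivative (\<lambda>h. evolution (direction a a' h) z)) (at z)"
    using g(2)[OF S(3)] unfolding at_within_open[OF S(3) S(1)] .
  then show ?thesis by (rule has_derivative_transform_within_open[OF _ S(1) S(3)]) (rule eq)
qed

text \<open>One time derivative is kept in reserve, because already the continuity in the base case
  is obtained from differentiability.\<close>

lemma smooth_family_Ck_on:
  assumes "smooth_family (Suc n) a"
  shows "Ck_on n ({0<..} \<times> UNIV) (evolution a)"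
  using assms
proof (induction n arbitrary: a)
  case 0
  then obtain a' where "decaying a" "decaying a'" "time_derivative a a'" by auto
  then have "isCont (evolution a) z" if "z \<in> {0<..} \<times> UNIV" for z
    using evolution_has_derivative[of a a' z] that has_derivative_continuous by (auto simp: mem_Times_iff)
  then show ?case by (simp add: continuous_at_imp_continuous_on)
next
  case (Suc n)
  then obtain a' where a': "decaying a" "smooth_family (Suc n) a'" "time_derivative a a'"
    by (metis smooth_family.simps(2))
  then have D: "(evolution a has_derivative (\<lambda>h. evolution (direction a a' h) z)) (at z)"
    if "z \<in> {0<..} \<times> UNIV" for z
    using evolution_has_derivative[of a a' z] that smooth_family_decaying[OF a'(2)] by (auto simp: mem_Times_iff)
  have "Ck_on n ({0<..} \<times> UNIV) (\<lambda>z. frechet_derivative (evolution a) (at z) h)" for h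
  proof (rule Ck_on_cong)
    show "Ck_on n ({0<..} \<times> UNIV) (evolution (direction a a' h))"
      by (intro Suc.IH smooth_family_direction a' smooth_family_Suc[OF Suc.prems])
    show "evolution (direction a a' h) z = frechet_derivative (evolution a) (at z) h" if "z \<in> {0<..} \<times> UNIV" for z
      using frechet_derivative_at[OF D[OF that]] by metis
  qed (simp add: open_Times)
  then show ?case using D unfolding Ck_on.simps differentiable_def by blast
qed

text \<open>With y = (4 ^ n) powr r and N so large that r * N \<ge> m, the power 2 ^ (m * n) is at
  most y ^ N, and y ^ N is dominated by the exponential through (1 + x / N) ^ N \<le> exp x.\<close>

lemma exp_powr_decay:
  fixes c r :: real
  assumes c: "0 < c" and r: "0 < r"
  obtains C where "0 \<le> C" "\<And>n. exp (- (c * (4 ^ n) powr r)) * 2 ^ (m * n) \<le> C"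
proof -
  obtain N :: nat where N: "real m / r + 1 < real N" using reals_Archimedean2 by blast
  have N0: "0 < N" using N r by (metis add.commute add_pos_nonneg divide_nonneg_pos less_trans of_nat_0_le_iff of_nat_0_less_iff zero_less_one)
  have "real m / r < real N" using N by simp
  then have mN: "real m \<le> r * real N" using r by (simp add: field_simps)
  have "exp (- (c * (4 ^ n) powr r)) * 2 ^ (m * n) \<le> (real N / c) ^ N" for n :: nat
  proof -
    define y :: real where "y = (4 ^ n) powr r"
    have y: "0 < y" by (simp add: y_def)
    have "(2::real) ^ (m * n) \<le> (4 ^ n) ^ m"
      using power_mono[of "2::real" 4 "m * n"] by (simp add: power_mult[symmetric] mult.commute)
    also have "\<dots> = (4 ^ n) powr real m" by (simp add: powr_realpow)
    also have "\<dots> \<le> (4 ^ n) powr (r * real N)" using mN by (intro powr_mono) auto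
    also have "\<dots> = y ^ N" using y by (simp add: y_def powr_powr[symmetric] powr_realpow)
    finally have 1: "(2::real) ^ (m * n) \<le> y ^ N" .
    have "(c * y / N) ^ N \<le> (1 + c * y / N) ^ N" using c y by (intro power_mono) auto
    also have "\<dots> \<le> exp (c * y)"
      using c y N0 by (intro exp_ge_one_plus_x_over_n_power_n) (auto intro: order_trans[of _ 0])
    finally have "c ^ N * y ^ N \<le> exp (c * y) * N ^ N" using N0 by (simp add: power_divide power_mult_distrib field_simps)
    then have "y ^ N \<le> exp (c * y) * (real N / c) ^ N" using c by (simp add: power_divide field_simps)
    with 1 have "2 ^ (m * n) \<le> exp (c * y) * (real N / c) ^ N" by linarith
    then have "exp (- (c * y)) * 2 ^ (m * n) \<le> exp (- (c * y)) * (exp (c * y) * (real N / c) ^ N)"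
      by (intro mult_left_mono) auto
    also have "\<dots> = (real N / c) ^ N" by (simp add: exp_minus)
    finally show ?thesis by (simp add: y_def)
  qed
  then show thesis using that[of "(real N / c) ^ N"] c by simp
qed

section \<open>The amplitude system\<close>

lemma level_uminus: "level (- k) = level k"
  by (simp add: level_def uminus_shell_iff)

lemma uminus_Mfreq_iff: "- k \<in> Mfreq \<longleftrightarrow> k \<in> Mfreq"
  by (simp add: Mfreq_eq uminus_shell_iff)

lemma triads_uminus: "triads (- k) = (\<lambda>(p, q). (- p, - q)) ` triads k"
proof -
  have *: "(- p, - q) \<in> triads (- k)" if "(p, q) \<in> triads k" for p q k
    using that by (auto simp: triads_def uminus_Mfreq_iff split: if_splits)
  have "(p, q) \<in> (\<lambda>(p, q). (- p, - q)) ` triads k" if "(p, q) \<in> triads (- k)" for p q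
    using *[OF that] by (intro image_eqI[of _ _ "(- p, - q)"]) auto
  then show ?thesis using * by auto
qed

text \<open>The coupling is imaginary and odd under a simultaneous sign change of the frequencies,
  since \<open>vfreq\<close> is even; so reflection acts on it as conjugation.\<close>

lemma nonlinearity_cnj:
  assumes "\<And>k. f (- k) = cnj (f k)"
  shows "nonlinearity f (- k) = cnj (nonlinearity f k)"
proof -
  have inj: "inj_on (\<lambda>(p, q). (- p, - q)) (triads k)" by (auto simp: inj_on_def)
  have "coupling (- k) (- p) (- q) = cnj (coupling k p q)" for p q
    by (simp add: coupling_def vfreq_uminus rvec_uminus)
  then show ?thesis
    unfolding nonlinearity_def triads_uminus sum.reindex[OF inj]
    by (simp add: case_prod_beta assms)
qed

lemma crit_exp_eq: "crit_exp \<alpha> / 2 = crit_rate - \<alpha>"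
  by (simp add: crit_exp_def field_simps)

text \<open>The power of 4 in the smallness condition is the envelope ratio \<delta>, written out
  because the envelope is attached to the data only after the locale is formed.\<close>

locale small_data =
  fixes \<alpha> s \<nu> :: real and c0 :: "int ^ 3 \<Rightarrow> complex" and U :: real
  assumes \<alpha>: "0 < \<alpha>" "\<alpha> < crit_rate" and s: "crit_exp \<alpha> < s" and \<nu>: "0 < \<nu>"
    and c0_cnj: "\<And>k. c0 (- k) = cnj (c0 k)"
    and c0_summable: "summable (\<lambda>n. lam n powr s * (\<Sum>k\<in>shell n. (norm (c0 k))\<^sup>2))"
    and c0_zero: "\<And>k. k \<notin> Mfreq \<Longrightarrow> c0 k = 0"
    and U_def: "U = sqrt (\<Sum>n. lam n powr crit_exp \<alpha> * (\<Sum>k\<in>shell n. (norm (c0 k))\<^sup>2))"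
    and U_small: "2000000 * U \<le> (4 powr (- s - 1))\<^sup>2 * \<nu>"
begin

lemma crit_exp_pos: "0 < crit_exp \<alpha>" and s_pos: "0 < s"
  using \<alpha> s crit_exp_eq[of \<alpha>] by linarith+

sublocale frequency_envelope s "\<lambda>n. \<Sum>k\<in>shell n. (norm (c0 k))\<^sup>2"
  by unfold_locales (use s_pos c0_summable in \<open>auto intro: sum_nonneg\<close>)

lemma alpha_less_half: "\<alpha> < 1 / 2" and crit_rate_le_1: "crit_rate \<le> 1"
  using \<alpha> crit_rate_less_half by linarith+

lemma U_nonneg: "0 \<le> U"
  unfolding U_def using s by (intro real_sqrt_ge_zero suminf_nonneg X_summable_le) (auto intro!: mult_nonneg_nonneg sum_nonneg)

lemma U_small': "2000000 * U \<le> \<delta>\<^sup>2 * \<nu>"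
  using U_small by (simp add: \<delta>_def)

definition damping :: "int ^ 3 \<Rightarrow> real" where
  "damping k = \<nu> * lam (level k) powr \<alpha>"

definition amplitude :: "int ^ 3 \<Rightarrow> real" where
  "amplitude k = (if k \<in> Mfreq then sqrt (env (level k)) else 0)"

lemma damping_pos: "0 < damping k"
  using \<nu> lam_pos by (simp add: damping_def less_imp_neq[symmetric])

text \<open>Criticality in the form in which it is used: coupling strength times envelope amplitude
  is at most 2 * U times the damping rate without \<nu>. It is the square root of
  \<open>env_bound\<close>, since half of the critical exponent is \<open>crit_rate\<close> -
  \<alpha>.\<close>

lemma env_crit: "lam n powr crit_rate * sqrt (env n) \<le> 2 * U * lam n powr \<alpha>"
proof -
  have "lam n powr crit_exp \<alpha> * env n \<le> 4 * U\<^sup>2"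
    using env_bound[of "crit_exp \<alpha>" n] crit_exp_pos s U_nonneg
    by (simp add: U_def suminf_nonneg X_summable_le sum_nonneg)
  then have "sqrt (lam n powr crit_exp \<alpha> * env n) \<le> sqrt (4 * U\<^sup>2)" by (rule real_sqrt_le_mono)
  also have "sqrt (4 * U\<^sup>2) = 2 * U" using U_nonneg by (simp add: real_sqrt_mult)
  also have "sqrt (lam n powr crit_exp \<alpha> * env n) = lam n powr (crit_rate - \<alpha>) * sqrt (env n)"
    using lam_pos[of n] by (simp add: real_sqrt_mult powr_half_sqrt[symmetric] powr_powr crit_exp_eq)
  finally have f: "lam n powr (crit_rate - \<alpha>) * sqrt (env n) * lam n powr \<alpha> \<le> 2 * U * lam n powr \<alpha>"
    by (rule mult_right_mono) simp
  have pw: "lam n powr (crit_rate - \<alpha>) * lam n powr \<alpha> = lam n powr crit_rate"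
    by (simp flip: powr_add)
  show ?thesis using f unfolding pw[symmetric] by (simp only: mult_ac)
qed

lemma amplitude_shell: "k \<in> shell n \<Longrightarrow> amplitude k = sqrt (env n)"
  using shell_subset[of n] by (auto simp: amplitude_def level_eq)

lemma amplitude_triad:
  assumes "(p, q) \<in> triads k" "k \<in> shell n"
  shows "amplitude p \<le> sqrt (env n / \<delta>)" "amplitude q \<le> sqrt (env n / \<delta>)"
proof -
  obtain a b where "p \<in> shell a" "q \<in> shell b" "a \<le> Suc n" "b \<le> Suc n" "n \<le> Suc a" "n \<le> Suc b"
    using triads_levels[OF assms] by metis
  then show "amplitude p \<le> sqrt (env n / \<delta>)" "amplitude q \<le> sqrt (env n / \<delta>)"
    using env_neighbour by (auto simp: amplitude_shell intro!: real_sqrt_le_mono)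
qed

lemma amplitude_nonneg: "0 \<le> amplitude k"
  by (simp add: amplitude_def env_nonneg)

text \<open>The data use half of A by \<open>X_le_env\<close>. For the rest, slow variation moves
  both factors to shell n at the cost of 1 / \<delta>, and \<open>env_crit\<close> cancels the
  damping. With 72 triads, coupling 96 and two factors 2 the result is 27648 * U / (\<delta> *
  \<nu>) times A, below the other half by smallness.\<close>

lemma amplitude_supersolution:
  "norm (c0 k) + 2 / damping k * (\<Sum>(p, q)\<in>triads k. norm (coupling k p q) * (amplitude p * amplitude q)) \<le> amplitude k"
proof (cases "k \<in> Mfreq")
  case False
  then show ?thesis by (simp add: c0_zero triads_def amplitude_def)
next
  case True
  define n where "n = level k"
  have k: "k \<in> shell n" using level_shell[OF True] by (simp add: n_def)
  define A where "A = sqrt (env n)"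
  have A: "0 \<le> A" "A\<^sup>2 = env n" using env_nonneg[of n] by (simp_all add: A_def)
  have "(norm (c0 k))\<^sup>2 \<le> (\<Sum>k\<in>shell n. (norm (c0 k))\<^sup>2)"
    by (rule member_le_sum[OF k]) (auto simp: finite_shell)
  also have "\<dots> \<le> (A / 2)\<^sup>2" using X_le_env[of n] A(2) by (simp add: power_divide)
  finally have 1: "norm (c0 k) \<le> A / 2" by (rule power2_le_imp_le) (use A(1) in simp)
  have "(\<Sum>(p, q)\<in>triads k. norm (coupling k p q) * (amplitude p * amplitude q))
    \<le> (\<Sum>pq\<in>triads k. 96 * lam n powr crit_rate * (A\<^sup>2 / \<delta>))"
  proof (rule sum_mono, clarify)
    fix p q assume pq: "(p, q) \<in> triads k"
    have "amplitude p * amplitude q \<le> sqrt (env n / \<delta>) * sqrt (env n / \<delta>)"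
      using amplitude_triad[OF pq k] amplitude_nonneg by (intro mult_mono) (auto simp: env_nonneg less_imp_le[OF delta_pos])
    also have "\<dots> = A\<^sup>2 / \<delta>" using A(2) env_nonneg[of n] delta_pos by simp
    finally show "norm (coupling k p q) * (amplitude p * amplitude q) \<le> 96 * lam n powr crit_rate * (A\<^sup>2 / \<delta>)"
      using coupling_bound[OF pq k] amplitude_nonneg by (intro mult_mono) auto
  qed
  also have "\<dots> = card (triads k) * (96 * lam n powr crit_rate * (A\<^sup>2 / \<delta>))" by simp
  also have "\<dots> \<le> 72 * (96 * lam n powr crit_rate * (A\<^sup>2 / \<delta>))"
    using card_triads[of k] delta_pos by (intro mult_right_mono) auto
  also have "\<dots> = 6912 / \<delta> * A * (lam n powr crit_rate * A)" by (simp add: power2_eq_square)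
  also have "\<dots> \<le> 6912 / \<delta> * A * (2 * U * lam n powr \<alpha>)"
    using env_crit[of n] A(1) delta_pos by (intro mult_left_mono) (auto simp: A_def)
  finally have "2 / damping k * (\<Sum>(p, q)\<in>triads k. norm (coupling k p q) * (amplitude p * amplitude q))
     \<le> 2 / damping k * (6912 / \<delta> * A * (2 * U * lam n powr \<alpha>))"
    using damping_pos[of k] by (intro mult_left_mono) auto
  also have "\<dots> = A * (27648 * U / (\<delta> * \<nu>))"
    using lam_pos[of n] \<nu> by (simp add: damping_def n_def[symmetric] field_simps)
  also have "\<dots> \<le> A * (1 / 2)"
  proof (rule mult_left_mono[OF _ A(1)])
    have "55296 * U \<le> 2000000 * U" using U_nonneg by simp
    also have "\<dots> \<le> \<delta>\<^sup>2 * \<nu>" by (rule U_small')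
    also have "\<dots> \<le> \<delta> * \<nu>"
      using delta_pos delta_le_1 \<nu> by (intro mult_right_mono) (auto simp: power2_eq_square mult_left_le)
    finally show "27648 * U / (\<delta> * \<nu>) \<le> 1 / 2" using delta_pos \<nu> by (simp add: field_simps)
  qed
  finally show ?thesis using 1 by (simp add: amplitude_shell[OF k] A_def)
qed

sublocale quadratic_system triads coupling damping c0 amplitude
proof
  fix k p q assume pq: "(p, q) \<in> triads k"
  then have "p \<in> shell (level p)" "q \<in> shell (level q)" "p + q \<in> shell (level k)" "k = p + q"
    by (auto simp: triads_def level_shell split: if_splits)
  then have "lam (level k) powr \<alpha> \<le> lam (level p) powr \<alpha> + lam (level q) powr \<alpha>"
    using \<alpha>(1) alpha_less_half by (intro lam_powr_triad) auto
  then have "\<nu> * lam (level k) powr \<alpha> \<le> \<nu> * (lam (level p) powr \<alpha> + lam (level q) powr \<alpha>)"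
    using \<nu> by (intro mult_left_mono) auto
  then show "damping k \<le> damping p + damping q" by (simp add: damping_def ring_distribs)
qed (rule finite_triads damping_pos amplitude_supersolution amplitude_nonneg)+

lemma nonlin_eq: "nonlin f k t = nonlinearity (\<lambda>k. f k t) k"
  by (simp add: nonlin_def nonlinearity_def)

lemma solution_symmetric: "0 \<le> t \<Longrightarrow> solution (- k) t = cnj (solution k t)"
  by (rule solution_cnj) (simp_all add: damping_def level_uminus c0_cnj nonlin_eq nonlinearity_cnj)

lemma solution_shell_bound:
  assumes "k \<in> shell n" "0 \<le> t"
  shows "norm (solution k t) \<le> sqrt (env n) * exp (- (\<nu> * lam n powr \<alpha> * t / 2))"
  using solution_bound[OF assms(2), of k] assms(1) by (simp add: amplitude_shell damping_def level_eq)

lemma solution_le_env: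
  assumes "k \<in> shell n" "0 \<le> t"
  shows "norm (solution k t) \<le> sqrt (env n)"
proof -
  have "sqrt (env n) * exp (- (\<nu> * lam n powr \<alpha> * t / 2)) \<le> sqrt (env n) * 1"
    using assms \<nu> env_nonneg[of n] by (intro mult_left_mono) auto
  then show ?thesis using solution_shell_bound[OF assms] by simp
qed

lemma solution_zero: "k \<notin> Mfreq \<Longrightarrow> 0 \<le> t \<Longrightarrow> solution k t = 0"
  using solution_bound[of t k] by (simp add: amplitude_def)

text \<open>Because \<alpha> < \<open>crit_rate\<close>, the estimate \<open>env_crit\<close> bounds
  all amplitudes by 2 * U. The decay factor left over from the damping then beats every power for t
  \<ge> \<epsilon>.\<close>

lemma decaying_solution: "decaying solution"
  unfolding decaying_def
proof (intro allI impI)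
  fix \<epsilon> :: real and m :: nat assume \<epsilon>: "0 < \<epsilon>"
  obtain C where C: "0 \<le> C" "\<And>n. exp (- (\<nu> * \<epsilon> / 2 * (4 ^ n) powr \<alpha>)) * 2 ^ (m * n) \<le> C"
    using exp_powr_decay[of "\<nu> * \<epsilon> / 2" \<alpha> m] \<epsilon> \<nu> \<alpha> by auto
  have "norm (solution k t) * 2 ^ (m * n) \<le> 2 * U * C" if k: "k \<in> shell n" and t: "\<epsilon> \<le> t" for n k t
  proof -
    have "lam n powr \<alpha> * sqrt (env n) \<le> lam n powr crit_rate * sqrt (env n)"
      using \<alpha> lam_ge_1[of n] env_nonneg[of n] by (intro mult_right_mono powr_mono) auto
    also have "\<dots> \<le> 2 * U * lam n powr \<alpha>" by (rule env_crit)
    finally have A: "sqrt (env n) \<le> 2 * U" using lam_pos[of n] by (simp add: mult.commute)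
    have "(4 ^ n) powr \<alpha> * \<epsilon> \<le> lam n powr \<alpha> * t"
      using lam_ge[of n] \<alpha> t \<epsilon> by (intro mult_mono powr_mono2) auto
    then have "\<nu> / 2 * ((4 ^ n) powr \<alpha> * \<epsilon>) \<le> \<nu> / 2 * (lam n powr \<alpha> * t)"
      using \<nu> by (intro mult_left_mono) auto
    then have E: "exp (- (\<nu> * lam n powr \<alpha> * t / 2)) \<le> exp (- (\<nu> * \<epsilon> / 2 * (4 ^ n) powr \<alpha>))"
      by (simp add: mult_ac)
    have "norm (solution k t) \<le> 2 * U * exp (- (\<nu> * \<epsilon> / 2 * (4 ^ n) powr \<alpha>))"
      using solution_shell_bound[OF k, of t] mult_mono[OF A E] t \<epsilon> U_nonneg by (simp add: order_trans)
    then have "norm (solution k t) * 2 ^ (m * n) \<le> 2 * U * exp (- (\<nu> * \<epsilon> / 2 * (4 ^ n) powr \<alpha>)) * 2 ^ (m * n)"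
      by (rule mult_right_mono) simp
    also have "\<dots> = 2 * U * (exp (- (\<nu> * \<epsilon> / 2 * (4 ^ n) powr \<alpha>)) * 2 ^ (m * n))" by simp
    also have "\<dots> \<le> 2 * U * C" using C(2)[of n] U_nonneg by (intro mult_left_mono) auto
    finally show ?thesis .
  qed
  then show "\<exists>C\<ge>0. \<forall>n. \<forall>k\<in>shell n. \<forall>t\<ge>\<epsilon>. norm (solution k t) * 2 ^ (m * n) \<le> C"
    using C(1) U_nonneg by (intro exI[of _ "2 * U * C"]) auto
qed

text \<open>Bootstrap through the equation: the time derivative is linear plus quadratic in the
  solution. The coefficients are O(4 ^ n), because \<alpha> and \<open>crit_rate\<close> are at most
  1; this is where 320 from \<open>lam_le\<close> and 30720 = 96 * 320 come from.\<close>

lemma smooth_family_solution: "smooth_family N solution"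
proof (induction N)
  case 0
  then show ?case by (simp add: decaying_solution)
next
  case (Suc N)
  have lam1: "lam n powr r \<le> 320 * 4 ^ n" if "r \<le> 1" for n r
    using powr_mono[OF that lam_ge_1[of n]] lam_le[of n] lam_pos[of n] by simp
  define c' where "c' k t = of_real (- damping k) * solution k t
      + (\<Sum>(p, q)\<in>triads k. - coupling k p q * (solution p t * solution q t))" for k t
  have "time_derivative solution c'"
    unfolding time_derivative_def
  proof (intro ballI allI impI)
    fix k and t :: real assume "0 < t"
    then show "(solution k has_vector_derivative c' k t) (at t)"
      using solution_has_vector_derivative[of t k]
      by (simp add: c'_def nonlin_def scaleR_conv_of_real sum_negf case_prod_beta)
  qed
  moreover have "smooth_family N c'"
    unfolding c'_def
  proof (rule smooth_family_add[OF smooth_family_mult[OF Suc.IH] smooth_family_quadratic[OF Suc.IH Suc.IH]])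
    fix n k assume k: "k \<in> shell n"
    show "norm (complex_of_real (- damping k)) \<le> (\<nu> * 320) * 4 ^ n"
      using lam1[of \<alpha> n] alpha_less_half \<nu>
      unfolding norm_of_real damping_def level_eq[OF k] by (simp add: abs_mult)
    fix p q assume "(p, q) \<in> triads k"
    then show "norm (- coupling k p q) \<le> 30720 * 4 ^ n"
      using coupling_bound[of p q k n] k lam1[OF crit_rate_le_1, of n] unfolding norm_minus_cancel by linarith
  qed (use \<nu> in auto)
  ultimately show ?case by (auto simp: decaying_solution)
qed

lemma real_coefficients_solution: "0 < t \<Longrightarrow> real_coefficients (\<lambda>k. solution k t)"
  by unfold_locales (simp_all add: decaying_summable[OF decaying_solution] solution_symmetric)

section \<open>Shell energies and the monotonicity of the norms\<close>

definition shell_energy :: "nat \<Rightarrow> real \<Rightarrow> real" where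
  "shell_energy n t = (\<Sum>k\<in>shell n. (norm (solution k t))\<^sup>2)"

lemma shell_energy_nonneg: "0 \<le> shell_energy n t"
  by (simp add: shell_energy_def sum_nonneg)

lemma sum_shell_le: 
  assumes "\<And>k. k \<in> shell n \<Longrightarrow> f k \<le> b" "0 \<le> b"
  shows "(\<Sum>k\<in>shell n. f k) \<le> 24 * (b :: real)"
proof -
  have "(\<Sum>k\<in>shell n. f k) \<le> card (shell n) * b" using assms(1) by (rule sum_bounded_above)
  also have "\<dots> \<le> 24 * b" using card_shell[of n] assms(2) by (intro mult_right_mono) auto
  finally show ?thesis .
qed

lemma shell_energy_le:
  assumes t: "0 \<le> t"
  shows "shell_energy n t \<le> 24 * (env n * exp (- (\<nu> * lam n powr \<alpha> * t)))"
  unfolding shell_energy_def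
proof (rule sum_shell_le)
  fix k assume "k \<in> shell n"
  then have "(norm (solution k t))\<^sup>2 \<le> (sqrt (env n) * exp (- (\<nu> * lam n powr \<alpha> * t / 2)))\<^sup>2"
    using solution_shell_bound t by (intro power_mono) auto
  then show "(norm (solution k t))\<^sup>2 \<le> env n * exp (- (\<nu> * lam n powr \<alpha> * t))"
    using env_nonneg[of n] by (simp add: power_mult_distrib flip: exp_double)
qed (simp add: env_nonneg)

lemma shell_energy_le_env: "0 \<le> t \<Longrightarrow> shell_energy n t \<le> 24 * env n"
proof -
  assume t: "0 \<le> t"
  have "env n * exp (- (\<nu> * lam n powr \<alpha> * t)) \<le> env n * 1"
    using t \<nu> env_nonneg[of n] by (intro mult_left_mono) auto
  then show ?thesis using shell_energy_le[OF t, of n] by simp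
qed

lemma summable_env_le: "\<sigma> \<le> s \<Longrightarrow> summable (\<lambda>n. lam n powr \<sigma> * env n)"
  by (rule summable_comparison_test'[OF summable_env, of 0])
    (use lam_ge_1 env_nonneg in \<open>auto intro!: mult_right_mono powr_mono\<close>)

lemma summable_shell_energy:
  assumes "\<sigma> \<le> s" "0 \<le> t"
  shows "summable (\<lambda>n. lam n powr \<sigma> * shell_energy n t)"
proof (rule summable_comparison_test'[of "\<lambda>n. 24 * (lam n powr \<sigma> * env n)" 0])
  show "summable (\<lambda>n. 24 * (lam n powr \<sigma> * env n))" by (intro summable_mult summable_env_le assms)
  fix n
  have "lam n powr \<sigma> * shell_energy n t \<le> lam n powr \<sigma> * (24 * env n)"
    using shell_energy_le_env[OF assms(2), of n] by (intro mult_left_mono) auto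
  then show "norm (lam n powr \<sigma> * shell_energy n t) \<le> 24 * (lam n powr \<sigma> * env n)"
    using shell_energy_nonneg[of n t] by simp
qed

definition energy :: "real \<Rightarrow> real \<Rightarrow> real" where
  "energy \<sigma> t = (\<Sum>n. lam n powr \<sigma> * shell_energy n t)"

lemma continuous_on_suminf_dominated:
  fixes g :: "nat \<Rightarrow> real \<Rightarrow> real"
  assumes "\<And>n. continuous_on S (g n)" "\<And>n t. t \<in> S \<Longrightarrow> norm (g n t) \<le> b n" "summable b"
  shows "continuous_on S (\<lambda>t. \<Sum>n. g n t)"
proof (rule uniform_limit_theorem)
  show "uniform_limit S (\<lambda>n t. \<Sum>i<n. g i t) (\<lambda>t. \<Sum>n. g n t) sequentially"
    by (rule Weierstrass_m_test[OF assms(2,3)])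
  show "\<forall>\<^sub>F n in sequentially. continuous_on S (\<lambda>t. \<Sum>i<n. g i t)"
    by (intro always_eventually allI continuous_intros assms)
qed simp

lemma continuous_on_energy:
  assumes "\<sigma> \<le> s"
  shows "continuous_on {0..} (energy \<sigma>)"
  unfolding energy_def[abs_def]
proof (rule continuous_on_suminf_dominated)
  show "continuous_on {0..} (\<lambda>t. lam n powr \<sigma> * shell_energy n t)" for n
    unfolding shell_energy_def by (intro continuous_intros continuous_on_solution)
  show "summable (\<lambda>n. 24 * (lam n powr \<sigma> * env n))" by (intro summable_mult summable_env_le assms)
  fix n t assume "t \<in> {0::real..}"
  then have "lam n powr \<sigma> * shell_energy n t \<le> lam n powr \<sigma> * (24 * env n)"
    using shell_energy_le_env[of t n] by (intro mult_left_mono) auto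
  then show "norm (lam n powr \<sigma> * shell_energy n t) \<le> 24 * (lam n powr \<sigma> * env n)"
    using shell_energy_nonneg[of n t] by simp
qed

definition neighbour_energy :: "nat \<Rightarrow> real \<Rightarrow> real" where
  "neighbour_energy n t = shell_energy (n - 1) t + shell_energy n t + shell_energy (Suc n) t"

lemma norm_solution_le_neighbour:
  assumes "k \<in> shell m" "m \<le> Suc n" "n \<le> Suc m"
  shows "(norm (solution k t))\<^sup>2 \<le> neighbour_energy n t"
proof -
  have "(norm (solution k t))\<^sup>2 \<le> shell_energy m t"
    unfolding shell_energy_def by (rule member_le_sum[OF assms(1)]) (auto simp: finite_shell)
  moreover have "m = n - 1 \<or> m = n \<or> m = Suc n" using assms by linarith
  ultimately show ?thesis
    using shell_energy_nonneg[of "n - 1" t] shell_energy_nonneg[of n t] shell_energy_nonneg[of "Suc n" t]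
    unfolding neighbour_energy_def by (elim disjE) auto
qed

text \<open>The modes k and p are measured by the energy of the neighbouring shells, and only q by
  the envelope. The flux is therefore quadratic in the actual solution, with the critical norm as
  small prefactor. The constant is 72 * 96 * 2.\<close>

lemma nonlinear_flux:
  assumes k: "k \<in> shell n" and t: "0 \<le> t"
  shows "norm (solution k t) * norm (nonlin solution k t) \<le> 13824 * (U / \<delta>) * lam n powr \<alpha> * neighbour_energy n t"
proof -
  define Z where "Z = neighbour_energy n t"
  have Z: "0 \<le> Z" using norm_solution_le_neighbour[OF k, of n t] by (simp add: Z_def order_trans[OF zero_le_power2])
  have kZ: "norm (solution k t) \<le> sqrt Z"
    using norm_solution_le_neighbour[OF k, of n t] by (simp add: Z_def real_le_rsqrt)
  have dd: "\<delta>\<^sup>2 \<le> \<delta>" using delta_pos delta_le_1 by (simp add: power2_eq_square mult_left_le)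
  have "norm (nonlin solution k t) \<le> (\<Sum>pq\<in>triads k. 192 * (U / \<delta>) * lam n powr \<alpha> * sqrt Z)"
    unfolding nonlin_def
  proof (rule sum_norm_le, clarify)
    fix p q assume pq: "(p, q) \<in> triads k"
    obtain a b where ab: "p \<in> shell a" "q \<in> shell b" "a \<le> Suc n" "n \<le> Suc a"
      using triads_levels[OF pq k] by metis
    have p: "norm (solution p t) \<le> sqrt Z"
      using norm_solution_le_neighbour[OF ab(1,3,4)] by (simp add: Z_def real_le_rsqrt)
    have "norm (solution q t) \<le> amplitude q"
      using solution_le_env[OF ab(2) t] by (simp add: amplitude_shell[OF ab(2)])
    also have "\<dots> \<le> sqrt (env n / \<delta>)" by (rule amplitude_triad(2)[OF pq k])
    \<comment> \<open>A factor is wasted so that the root of \<delta> disappears.\<close>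
    also have "\<dots> \<le> sqrt (env n / \<delta>\<^sup>2)"
      using dd delta_pos env_nonneg[of n] by (intro real_sqrt_le_mono divide_left_mono) auto
    also have "\<dots> = sqrt (env n) / \<delta>" using delta_pos by (simp add: real_sqrt_divide)
    finally have q: "norm (solution q t) \<le> sqrt (env n) / \<delta>" .
    have "norm (coupling k p q * (solution p t * solution q t)) \<le> 96 * lam n powr crit_rate * (sqrt Z * (sqrt (env n) / \<delta>))"
      unfolding norm_mult using coupling_bound[OF pq k] p q Z by (intro mult_mono) auto
    also have "\<dots> = 96 / \<delta> * sqrt Z * (lam n powr crit_rate * sqrt (env n))" by simp
    also have "\<dots> \<le> 96 / \<delta> * sqrt Z * (2 * U * lam n powr \<alpha>)"
      using env_crit[of n] Z delta_pos by (intro mult_left_mono) auto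
    finally show "norm (coupling k p q * (solution p t * solution q t)) \<le> 192 * (U / \<delta>) * lam n powr \<alpha> * sqrt Z"
      by (simp add: mult_ac)
  qed
  also have "\<dots> = card (triads k) * (192 * (U / \<delta>) * lam n powr \<alpha> * sqrt Z)" by simp
  also have "\<dots> \<le> 72 * (192 * (U / \<delta>) * lam n powr \<alpha> * sqrt Z)"
    using card_triads[of k] U_nonneg delta_pos Z by (intro mult_right_mono) auto
  finally have "norm (solution k t) * norm (nonlin solution k t) \<le> sqrt Z * (72 * (192 * (U / \<delta>) * lam n powr \<alpha> * sqrt Z))"
    using kZ Z by (intro mult_mono) auto
  also have "\<dots> = 13824 * (U / \<delta>) * lam n powr \<alpha> * (sqrt Z * sqrt Z)" by (simp add: mult_ac)
  finally show ?thesis using Z by (simp add: Z_def)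
qed

definition shell_energy_deriv :: "nat \<Rightarrow> real \<Rightarrow> real" where
  "shell_energy_deriv n t = (\<Sum>k\<in>shell n. 2 * (solution k t \<bullet> (- (damping k *\<^sub>R solution k t) - nonlin solution k t)))"

lemma shell_energy_has_derivative:
  assumes "0 < t"
  shows "(shell_energy n has_real_derivative shell_energy_deriv n t) (at t)"
proof -
  have "((\<lambda>t. (norm (solution k t))\<^sup>2) has_real_derivative 2 * (solution k t \<bullet> (- (damping k *\<^sub>R solution k t) - nonlin solution k t))) (at t)" for k
  proof -
    have "((\<lambda>t. solution k t \<bullet> solution k t) has_derivative (\<lambda>h. solution k t \<bullet> (h *\<^sub>R (- (damping k *\<^sub>R solution k t) - nonlin solution k t))
        + (h *\<^sub>R (- (damping k *\<^sub>R solution k t) - nonlin solution k t)) \<bullet> solution k t)) (at t)"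
      by (intro has_derivative_inner solution_has_vector_derivative[OF assms, unfolded has_vector_derivative_def])
    then show ?thesis
      unfolding has_field_derivative_def power2_norm_eq_inner
      by (rule has_derivative_eq_rhs) (simp add: fun_eq_iff inner_commute algebra_simps)
  qed
  then show ?thesis
    unfolding shell_energy_def[abs_def] shell_energy_deriv_def by (intro DERIV_sum)
qed

text \<open>The damping enters with its exact value, the nonlinear term by Cauchy-Schwarz. The
  constant is 2 * 24 * 13824, for the derivative of a square and the number of frequencies in a
  shell.\<close>

lemma shell_energy_deriv_le:
  assumes t: "0 \<le> t"
  shows "shell_energy_deriv n t \<le> - (2 * \<nu> * lam n powr \<alpha> * shell_energy n t) +
    663552 * (U / \<delta>) * lam n powr \<alpha> * neighbour_energy n t"
proof -
  have Z: "0 \<le> neighbour_energy n t"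
    unfolding neighbour_energy_def by (intro add_nonneg_nonneg shell_energy_nonneg)
  have "shell_energy_deriv n t \<le> (\<Sum>k\<in>shell n. - (2 * \<nu> * lam n powr \<alpha> * (norm (solution k t))\<^sup>2) + 2 * (norm (solution k t) * norm (nonlin solution k t)))"
    unfolding shell_energy_deriv_def
  proof (rule sum_mono)
    fix k assume k: "k \<in> shell n"
    have "- (solution k t \<bullet> nonlin solution k t) \<le> norm (solution k t) * norm (nonlin solution k t)"
      using Cauchy_Schwarz_ineq2[of "solution k t" "nonlin solution k t"] by linarith
    then show "2 * (solution k t \<bullet> (- (damping k *\<^sub>R solution k t) - nonlin solution k t))
      \<le> - (2 * \<nu> * lam n powr \<alpha> * (norm (solution k t))\<^sup>2) + 2 * (norm (solution k t) * norm (nonlin solution k t))"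
      by (simp add: inner_diff_right damping_def level_eq[OF k] power2_norm_eq_inner algebra_simps)
  qed
  also have "\<dots> = - (2 * \<nu> * lam n powr \<alpha> * shell_energy n t) + 2 * (\<Sum>k\<in>shell n. norm (solution k t) * norm (nonlin solution k t))"
    by (simp add: shell_energy_def sum.distrib sum_distrib_left sum_negf sum_subtractf)
  also have "(\<Sum>k\<in>shell n. norm (solution k t) * norm (nonlin solution k t)) \<le> 24 * (13824 * (U / \<delta>) * lam n powr \<alpha> * neighbour_energy n t)"
    by (rule sum_shell_le) (use nonlinear_flux[OF _ t] Z U_nonneg delta_pos in auto)
  finally show ?thesis by simp
qed

text \<open>The right-hand side is the flux through the last shell; for \<open>t > 0\<close> it vanishes as \<open>N\<close> tends to
  infinity, by the exponential decay of the amplitudes.\<close>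

lemma partial_energy_deriv_le:
  assumes \<sigma>: "0 \<le> \<sigma>" "\<sigma> \<le> s" and t: "0 \<le> t"
  shows "(\<Sum>n<N. lam n powr \<sigma> * shell_energy_deriv n t) \<le> \<nu> * (lam N powr (\<sigma> + \<alpha>) * shell_energy N t)"
proof -
  define W where "W n = lam n powr (\<sigma> + \<alpha>) * shell_energy n t" for n
  define G where "G = (\<Sum>n<N. W n)"
  have W: "0 \<le> W n" for n by (simp add: W_def shell_energy_nonneg)
  have G: "0 \<le> G" unfolding G_def by (intro sum_nonneg W)
  have pw: "lam n powr \<sigma> * lam n powr \<alpha> = lam n powr (\<sigma> + \<alpha>)" for n by (simp add: powr_add)
  \<comment> \<open>The cost of carrying the dissipation weight up one shell. The summand 1 in the
    exponent of \<delta> makes room for \<alpha>.\<close>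
  have four: "(4::real) powr (\<sigma> + \<alpha>) \<le> 1 / \<delta>"
  proof -
    have "(4::real) powr (\<sigma> + \<alpha>) \<le> 4 powr (s + 1)"
      using \<sigma> alpha_less_half by (intro powr_mono) auto
    also have "\<dots> = 1 / \<delta>" by (simp add: \<delta>_def powr_minus_divide[symmetric] add.commute)
    finally show ?thesis .
  qed
  have prev: "lam n powr (\<sigma> + \<alpha>) * shell_energy (n - 1) t \<le> 1 / \<delta> * W (n - 1)" for n
  proof -
    have "lam n \<le> 4 * lam (n - 1)"
      using lam_Suc_le[of "n - 1"] lam_pos[of n] by (cases n) auto
    then have "lam n powr (\<sigma> + \<alpha>) \<le> (4 * lam (n - 1)) powr (\<sigma> + \<alpha>)"
      using lam_pos[of n] \<sigma> \<alpha> by (intro powr_mono2) auto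
    also have "\<dots> = 4 powr (\<sigma> + \<alpha>) * lam (n - 1) powr (\<sigma> + \<alpha>)"
      using lam_pos[of "n - 1"] by (simp add: powr_mult)
    also have "\<dots> \<le> 1 / \<delta> * lam (n - 1) powr (\<sigma> + \<alpha>)" using four by (rule mult_right_mono) simp
    finally show ?thesis using shell_energy_nonneg[of "n - 1" t]
      unfolding W_def mult.assoc[symmetric] by (rule mult_right_mono)
  qed
  have succ: "lam n powr (\<sigma> + \<alpha>) * shell_energy (Suc n) t \<le> W (Suc n)" for n
    unfolding W_def using lam_mono[of n "Suc n"] lam_pos[of n] \<sigma> \<alpha>
    by (intro mult_right_mono powr_mono2 shell_energy_nonneg) auto
  \<comment> \<open>W 0 occurs twice in the truncated shift, hence the 2.\<close>
  have sum_prev: "(\<Sum>n<N. W (n - 1)) \<le> 2 * G"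
  proof (cases N)
    case 0
    then show ?thesis by (simp add: G_def)
  next
    case (Suc M)
    have "(\<Sum>n<N. W (n - 1)) = W 0 + (\<Sum>n<M. W n)" unfolding Suc sum.lessThan_Suc_shift by simp
    also have "\<dots> \<le> G + G"
    proof (rule add_mono)
      show "W 0 \<le> G" unfolding G_def Suc by (rule member_le_sum) (auto simp: W)
      show "(\<Sum>n<M. W n) \<le> G" unfolding G_def Suc using W[of M] by simp
    qed
    finally show ?thesis by simp
  qed
  \<comment> \<open>The upward shift leaves the range at the top; W N is the only term that the
    partial dissipation G cannot absorb.\<close>
  have sum_next: "(\<Sum>n<N. W (Suc n)) \<le> G + W N"
    using sum.lessThan_Suc_shift[of W N] W[of 0] by (simp add: G_def)
  have "(\<Sum>n<N. lam n powr \<sigma> * (lam n powr \<alpha> * neighbour_energy n t)) \<le> (\<Sum>n<N. 1 / \<delta> * W (n - 1) + W n + W (Suc n))"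
  proof (rule sum_mono)
    fix n
    have "lam n powr \<sigma> * (lam n powr \<alpha> * neighbour_energy n t) = lam n powr (\<sigma> + \<alpha>) * shell_energy (n - 1) t + W n + lam n powr (\<sigma> + \<alpha>) * shell_energy (Suc n) t"
      unfolding mult.assoc[symmetric] pw by (simp add: neighbour_energy_def W_def ring_distribs)
    then show "lam n powr \<sigma> * (lam n powr \<alpha> * neighbour_energy n t) \<le> 1 / \<delta> * W (n - 1) + W n + W (Suc n)"
      using prev[of n] succ[of n] by linarith
  qed
  also have "\<dots> = 1 / \<delta> * (\<Sum>n<N. W (n - 1)) + G + (\<Sum>n<N. W (Suc n))"
    by (simp add: sum.distrib G_def sum_divide_distrib)
  also have "\<dots> \<le> 1 / \<delta> * (2 * G) + G + (G + W N)"
    using sum_prev sum_next delta_pos by (intro add_mono mult_left_mono) auto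
  also have "\<dots> \<le> 4 / \<delta> * G + W N"
  proof -
    have "G \<le> 1 / \<delta> * G" using delta_pos delta_le_1 G by (simp add: field_simps mult_left_le)
    moreover have "1 / \<delta> * (2 * G) = 2 * (1 / \<delta> * G)" "4 / \<delta> * G = 4 * (1 / \<delta> * G)" by simp_all
    ultimately show ?thesis by linarith
  qed
  finally have flux: "(\<Sum>n<N. lam n powr \<sigma> * (lam n powr \<alpha> * neighbour_energy n t)) \<le> 4 / \<delta> * G + W N" .
  define K where "K = 663552 * (U / \<delta>)"
  have K: "0 \<le> K" using U_nonneg delta_pos by (simp add: K_def)
  have "(\<Sum>n<N. lam n powr \<sigma> * shell_energy_deriv n t) \<le>
    (\<Sum>n<N. - (2 * \<nu> * W n) + K * (lam n powr \<sigma> * (lam n powr \<alpha> * neighbour_energy n t)))"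
  proof (rule sum_mono)
    fix n
    have "lam n powr \<sigma> * shell_energy_deriv n t \<le> lam n powr \<sigma> * (- (2 * \<nu> * lam n powr \<alpha> * shell_energy n t) + K * lam n powr \<alpha> * neighbour_energy n t)"
      using shell_energy_deriv_le[OF t, of n] by (intro mult_left_mono) (auto simp: K_def)
    also have "\<dots> = - (2 * \<nu> * W n) + K * (lam n powr \<sigma> * (lam n powr \<alpha> * neighbour_energy n t))"
      unfolding W_def pw[symmetric] by (simp add: algebra_simps)
    finally show "lam n powr \<sigma> * shell_energy_deriv n t \<le> - (2 * \<nu> * W n) + K * (lam n powr \<sigma> * (lam n powr \<alpha> * neighbour_energy n t))" .
  qed
  also have "\<dots> = - (2 * \<nu> * G) + K * (\<Sum>n<N. lam n powr \<sigma> * (lam n powr \<alpha> * neighbour_energy n t))"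
    by (simp add: sum.distrib sum_distrib_left G_def sum_negf sum_subtractf)
  also have "\<dots> \<le> - (2 * \<nu> * G) + K * (4 / \<delta> * G + W N)"
    using flux K by (intro add_left_mono mult_left_mono)
  also have "\<dots> = - (2 * \<nu> - 4 * K / \<delta>) * G + K * W N" by (simp add: algebra_simps)
  also have "\<dots> \<le> \<nu> * W N"
  proof -
    have K2: "K * \<delta> = 663552 * U" using delta_pos by (simp add: K_def)
    \<comment> \<open>Absorbing the flux into the dissipation requires 2 * 663552 * U \<le>
      \<open>\<delta>\<^sup>2 * \<nu>\<close>. This is the strongest demand on U and the reason for
      2000000. One \<delta> comes from the envelope, the other from the shift of weights.\<close>
    have "4 * K * \<delta> \<le> 2 * \<nu> * \<delta>\<^sup>2" using U_small' U_nonneg K2 by (simp add: mult.commute)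
    then have "4 * K / \<delta> \<le> 2 * \<nu>" using delta_pos by (simp add: field_simps power2_eq_square)
    then have 1: "0 \<le> (2 * \<nu> - 4 * K / \<delta>) * G" using G by (intro mult_nonneg_nonneg) auto
    have "K * \<delta> \<le> \<nu> * \<delta>\<^sup>2" using U_small' U_nonneg K2 by (simp add: mult.commute)
    then have "K \<le> \<nu> * \<delta>" using delta_pos by (simp add: power2_eq_square)
    also have "\<dots> \<le> \<nu>" using delta_le_1 \<nu> by (simp add: mult_left_le)
    finally have "K * W N \<le> \<nu> * W N" using W by (rule mult_right_mono)
    then show ?thesis using 1 by linarith
  qed
  finally show ?thesis by (simp add: W_def)
qed

text \<open>The energy itself is never differentiated. The partial sums grow at rate at most \<eta>
  N for all t \<ge> t1, so subtracting \<eta> N * t makes them nonincreasing, and this survives the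
  limit because \<eta> N tends to 0.\<close>

lemma energy_antimono_pos:
  assumes \<sigma>: "0 \<le> \<sigma>" "\<sigma> \<le> s" and t: "0 < t1" "t1 \<le> t2"
  shows "energy \<sigma> t2 \<le> energy \<sigma> t1"
proof -
  define \<eta> where "\<eta> N = 24 / t1 * (lam N powr \<sigma> * env N)" for N
  define P where "P N t = (\<Sum>n<N. lam n powr \<sigma> * shell_energy n t)" for N t
  have \<eta>: "\<eta> \<longlonglongrightarrow> 0"
    unfolding \<eta>_def using tendsto_mult_right[OF summable_LIMSEQ_zero[OF summable_env_le[OF \<sigma>(2)]], of "24 / t1"] by (simp add: mult_ac)
  have W_le: "\<nu> * (lam N powr (\<sigma> + \<alpha>) * shell_energy N t) \<le> \<eta> N" if "t1 \<le> t" for N t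
  proof -
    define x where "x = \<nu> * lam N powr \<alpha>"
    have x: "0 \<le> x" using \<nu> by (simp add: x_def)
    \<comment> \<open>Exponential decay pays for the additional weight
      \<open>lam N powr \<alpha>\<close> of the last shell, at the price 1 / t1. The remaining
      weight \<sigma> is one for which the envelope is summable.\<close>
    have "x * exp (- (x * t)) \<le> 1 / t1"
    proof -
      have "x * t1 \<le> x * t" using that x by (rule mult_left_mono)
      also have "\<dots> \<le> exp (x * t)" using exp_ge_add_one_self[of "x * t"] by linarith
      finally show ?thesis using t(1) by (simp add: exp_minus field_simps)
    qed
    then have "(24 * lam N powr \<sigma> * env N) * (x * exp (- (x * t))) \<le> (24 * lam N powr \<sigma> * env N) * (1 / t1)"
      using env_nonneg[of N] by (intro mult_left_mono) auto
    moreover have "\<nu> * (lam N powr (\<sigma> + \<alpha>) * shell_energy N t) \<le> \<nu> * (lam N powr (\<sigma> + \<alpha>) * (24 * (env N * exp (- (\<nu> * lam N powr \<alpha> * t)))))"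
      using shell_energy_le[of t N] that t \<nu> by (intro mult_left_mono) auto
    ultimately show ?thesis by (simp add: \<eta>_def x_def powr_add mult_ac)
  qed
  have "P N t2 - \<eta> N * t2 \<le> P N t1 - \<eta> N * t1" for N
  proof (rule DERIV_nonpos_imp_nonincreasing[OF t(2)])
    fix u assume u: "t1 \<le> u" "u \<le> t2"
    have "((\<lambda>t. P N t - \<eta> N * t) has_real_derivative (\<Sum>n<N. lam n powr \<sigma> * shell_energy_deriv n u) - \<eta> N) (at u)"
      unfolding P_def using u t
      by (auto intro!: derivative_eq_intros shell_energy_has_derivative simp: mult.commute)
    moreover have "(\<Sum>n<N. lam n powr \<sigma> * shell_energy_deriv n u) - \<eta> N \<le> 0"
      using partial_energy_deriv_le[OF \<sigma>, of u N] W_le[OF u(1), of N] u t by simp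
    ultimately show "\<exists>y. ((\<lambda>t. P N t - \<eta> N * t) has_real_derivative y) (at u) \<and> y \<le> 0" by blast
  qed
  moreover have "(\<lambda>N. P N t - \<eta> N * t) \<longlonglongrightarrow> energy \<sigma> t - 0 * t" if "0 \<le> t" for t
    unfolding P_def energy_def
    by (intro tendsto_diff tendsto_mult \<eta> tendsto_const summable_LIMSEQ summable_shell_energy \<sigma> that)
  ultimately show ?thesis
    using LIMSEQ_le[of "\<lambda>N. P N t2 - \<eta> N * t2" _ "\<lambda>N. P N t1 - \<eta> N * t1"] t by force
qed

text \<open>The derivative bounds hold for positive times only; the initial time is reached by
  continuity of the energy from the right.\<close>

lemma energy_le_initial:
  assumes \<sigma>: "0 \<le> \<sigma>" "\<sigma> \<le> s" and t: "0 < t"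
  shows "energy \<sigma> t \<le> energy \<sigma> 0"
proof (rule tendsto_lowerbound)
  have "(energy \<sigma> \<longlongrightarrow> energy \<sigma> 0) (at 0 within {0..})"
    using continuous_on_energy[OF \<sigma>(2)] by (simp add: continuous_on)
  then show "(energy \<sigma> \<longlongrightarrow> energy \<sigma> 0) (at_right 0)" by (rule tendsto_within_subset) auto
  show "\<forall>\<^sub>F r in at_right 0. energy \<sigma> t \<le> energy \<sigma> r"
    unfolding eventually_at_right[OF t] using energy_antimono_pos[OF \<sigma>] t by (intro exI[of _ t]) auto
qed simp

end

section \<open>The velocity field\<close>

lemma Hdot_integrable:
  assumes "u \<in> Hdot s"
  shows "integrable torus u"
proof (rule Bochner_Integration.integrable_bound)
  show "integrable torus (\<lambda>x. 1 + (norm (u x))\<^sup>2)"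
    using assms by (intro Bochner_Integration.integrable_add) (auto simp: Hdot_def)
  show "u \<in> borel_measurable torus" using assms by (simp add: Hdot_def)
  have "norm (u x) \<le> 1 + (norm (u x))\<^sup>2" for x
    using sum_squares_bound[of 1 "norm (u x)"] norm_ge_zero[of "u x"] unfolding power2_eq_square by linarith
  then show "AE x in torus. norm (u x) \<le> norm (1 + (norm (u x))\<^sup>2)" by simp
qed

lemma fourier_diff:
  assumes "u \<in> Hdot s" "v \<in> Hdot s"
  shows "fourier (\<lambda>x. u x - v x) k = fourier u k - fourier v k"
proof -
  have int: "integrable torus (\<lambda>x. of_real (w x $ i) * fchar k x)" if "w \<in> Hdot s" for w :: "real ^ 3 \<Rightarrow> real ^ 3" and i
  proof -
    have "integrable torus (\<lambda>x. complex_of_real (w x $ i))"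
      using integrable_bounded_linear[OF bounded_linear_vec_nth Hdot_integrable[OF that], of i]
      by (rule integrable_of_real)
    from integrable_mult_fchar[OF this, of k] show ?thesis by (simp add: mult.commute)
  qed
  show ?thesis
    unfolding fourier_def vec_eq_iff
    by (simp add: left_diff_distrib Bochner_Integration.integral_diff[OF int[OF assms(1)] int[OF assms(2)]])
qed

text \<open>At time \<open>0\<close> the Fourier series need not converge absolutely, so that the convolution formula for the
  advection is only available for positive times.\<close>

lemma set_integral_modify_point:
  fixes h :: "real \<Rightarrow> 'a::euclidean_space"
  assumes h: "continuous_on {0..t} h" and gh: "\<And>\<tau>. 0 < \<tau> \<Longrightarrow> \<tau> \<le> t \<Longrightarrow> g \<tau> = h \<tau>" and t: "0 < t"
  shows "set_integrable lborel {0..t} g" "(LBINT \<tau>:{0..t}. g \<tau>) = integral {0..t} h"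
proof -
  have hi: "integrable lborel (\<lambda>\<tau>. indicator {0..t} \<tau> *\<^sub>R h \<tau>)"
    by (rule borel_integrable_compact) (use h in auto)
  have zi: "integrable lborel (\<lambda>\<tau>. indicator {0::real} \<tau> *\<^sub>R (g 0 - h 0))"
    by (rule integrable_indicator) auto
  have z: "(LINT \<tau>|lborel. indicator {0::real} \<tau> *\<^sub>R (g 0 - h 0)) = 0" by simp
  have eq: "(\<lambda>\<tau>. indicator {0..t} \<tau> *\<^sub>R g \<tau>) = (\<lambda>\<tau>. indicator {0..t} \<tau> *\<^sub>R h \<tau> + indicator {0} \<tau> *\<^sub>R (g 0 - h 0))"
    using gh t by (auto simp: fun_eq_iff indicator_def)
  show "set_integrable lborel {0..t} g"
    unfolding set_integrable_def eq by (intro Bochner_Integration.integrable_add hi zi)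
  have "(LBINT \<tau>:{0..t}. g \<tau>) = (LBINT \<tau>:{0..t}. h \<tau>)"
    unfolding set_lebesgue_integral_def eq using hi zi z by (simp add: Bochner_Integration.integral_add)
  also have "\<dots> = integral {0..t} h"
    by (rule set_borel_integral_eq_integral) (use hi in \<open>simp add: set_integrable_def\<close>)
  finally show "(LBINT \<tau>:{0..t}. g \<tau>) = integral {0..t} h" .
qed

lemma cvec_scaleR: "(r *\<^sub>R z) *s w = r *\<^sub>R (z *s w)" for w :: "complex ^ 3"
  by (simp add: vec_eq_iff)

lemma bounded_linear_scalar_left: "bounded_linear (\<lambda>z :: complex. z *s (w :: complex ^ 3))"
proof (rule bounded_linear_intro)
  fix z show "norm (z *s w) \<le> norm z * norm w"
    by (simp add: norm_vec_def norm_mult L2_set_right_distrib)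
qed (simp_all add: vec_eq_iff ring_distribs)

locale small_initial_field = small_data +
  fixes u0 :: "real ^ 3 \<Rightarrow> real ^ 3"
  assumes u0: "u0 \<in> HdotM s"
    and fourier_u0: "\<And>k. fourier u0 k = (if k \<in> Mfreq then c0 k *s cvec (vfreq k) else 0)"
begin

text \<open>The initial condition is an equality of functions, whereas a Fourier series would at
  best return another representative of the class; hence u0 itself is used at time 0.\<close>

definition velocity :: "real \<Rightarrow> real ^ 3 \<Rightarrow> real ^ 3" where
  "velocity t = (if t \<le> 0 then u0 else field (\<lambda>k. solution k t))"

lemma fourier_velocity:
  "0 \<le> t \<Longrightarrow> fourier (velocity t) k = (if k \<in> Mfreq then solution k t *s cvec (vfreq k) else 0)"
  using real_coefficients.fourier_field[OF real_coefficients_solution]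
  by (cases "t = 0") (auto simp: velocity_def fourier_u0 solution_0)

lemma velocity_in_HdotM: "0 \<le> t \<Longrightarrow> velocity t \<in> HdotM s"
  using real_coefficients.field_in_HdotM[OF real_coefficients_solution] summable_shell_energy[of s t]
  by (cases "t = 0") (auto simp: velocity_def u0 shell_energy_def)

lemma Hdot_norm_velocity:
  "\<sigma> \<le> s \<Longrightarrow> 0 \<le> t \<Longrightarrow> Hdot_norm \<sigma> (velocity t) = sqrt (energy \<sigma> t)"
  using Hdot_norm_shells(2)[OF fourier_velocity] summable_shell_energy
  by (simp add: energy_def shell_energy_def)

lemma velocity_continuous: "continuous_HdotM s velocity"
  unfolding continuous_HdotM_def
proof (intro allI impI conjI velocity_in_HdotM)
  fix t :: real assume t: "0 \<le> t"
  define D where "D n r = lam n powr s * (\<Sum>k\<in>shell n. (norm (solution k r - solution k t))\<^sup>2)" for n r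
  have D_le: "norm (D n r) \<le> 96 * (lam n powr s * env n)" if "0 \<le> r" for n r
  proof -
    \<comment> \<open>Both amplitudes lie below the same envelope at all times, so the tail of the
      series is small uniformly in r.\<close>
    have "(\<Sum>k\<in>shell n. (norm (solution k r - solution k t))\<^sup>2) \<le> 24 * (4 * env n)"
    proof (rule sum_shell_le)
      fix k assume k: "k \<in> shell n"
      have "norm (solution k r - solution k t) \<le> 2 * sqrt (env n)"
        using solution_le_env[OF k that] solution_le_env[OF k t] norm_triangle_ineq4[of "solution k r" "solution k t"] by linarith
      then have "(norm (solution k r - solution k t))\<^sup>2 \<le> (2 * sqrt (env n))\<^sup>2" by (rule power_mono) simp
      then show "(norm (solution k r - solution k t))\<^sup>2 \<le> 4 * env n" using env_nonneg[of n] by (simp add: power_mult_distrib)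
    qed (simp add: env_nonneg)
    then have "D n r \<le> lam n powr s * (96 * env n)" unfolding D_def by (intro mult_left_mono) auto
    moreover have "0 \<le> D n r" unfolding D_def by (intro mult_nonneg_nonneg sum_nonneg) auto
    ultimately show ?thesis by simp
  qed
  have summ: "summable (\<lambda>n. 96 * (lam n powr s * env n))" by (intro summable_mult summable_env)
  have "continuous_on {0..} (\<lambda>r. \<Sum>n. D n r)"
    by (rule continuous_on_suminf_dominated[OF _ _ summ])
      (use D_le in \<open>auto simp: D_def intro!: continuous_intros continuous_on_solution\<close>)
  then have "((\<lambda>r. \<Sum>n. D n r) \<longlongrightarrow> (\<Sum>n. D n t)) (at t within {0..})"
    using t by (simp add: continuous_on)
  then have lim: "((\<lambda>r. sqrt (\<Sum>n. D n r)) \<longlongrightarrow> 0) (at t within {0..})"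
    using tendsto_real_sqrt by (fastforce simp: D_def)
  have eq: "Hdot_norm s (\<lambda>x. velocity r x - velocity t x) = sqrt (\<Sum>n. D n r)" if r: "0 \<le> r" for r
  proof -
    have Hd: "velocity r \<in> Hdot s" "velocity t \<in> Hdot s"
      using velocity_in_HdotM r t by (auto simp: HdotM_def)
    have "fourier (\<lambda>x. velocity r x - velocity t x) k = (if k \<in> Mfreq then (solution k r - solution k t) *s cvec (vfreq k) else 0)" for k
      unfolding fourier_diff[OF Hd] using r t by (simp add: fourier_velocity vec_eq_iff left_diff_distrib)
    moreover have "summable (\<lambda>n. D n r)"
      by (rule summable_comparison_test'[OF summ, of 0]) (rule D_le[OF r])
    ultimately show ?thesis unfolding D_def by (rule Hdot_norm_shells(2))
  qed
  show "((\<lambda>r. Hdot_norm s (\<lambda>x. velocity r x - velocity t x)) \<longlongrightarrow> 0) (at t within {0..})"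
    by (rule Lim_transform_eventually[OF lim]) (auto simp: eventually_at_filter eq)
qed

text \<open>The scalar Duhamel formula is carried to vectors by the linear map from z to z times
  \<open>vfreq k\<close>. At positive times the projected advection is the scalar nonlinearity; time
  0 is a null set. Off \<open>Mfreq\<close> everything vanishes.\<close>

lemma velocity_mild: "global_mild_solution \<alpha> \<nu> s u0 velocity"
  unfolding global_mild_solution_def
proof (intro conjI allI impI)
  show "continuous_HdotM s velocity" by (rule velocity_continuous)
  show "velocity 0 = u0" by (simp add: velocity_def)
  fix t :: real and k assume t: "0 < t"
  let ?g = "\<lambda>\<tau>. semigroup \<alpha> (\<nu> * (t - \<tau>)) (proj_M (advection (velocity \<tau>))) k"
  define h where "h \<tau> = (exp (- (damping k * (t - \<tau>))) *\<^sub>R nonlin solution k \<tau>) *s cvec (vfreq k)" for \<tau>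
  have nl: "continuous_on {0..t} (nonlin solution k)"
    by (rule continuous_on_subset[OF continuous_on_nonlin[OF continuous_on_solution]]) auto
  have nle: "continuous_on {0..t} (\<lambda>\<tau>. exp (- (damping k * (t - \<tau>))) *\<^sub>R nonlin solution k \<tau>)"
    by (intro continuous_intros nl)
  have h: "continuous_on {0..t} h"
    unfolding h_def by (rule bounded_linear.continuous_on[OF bounded_linear_scalar_left nle])
  have gh: "?g \<tau> = h \<tau>" if "0 < \<tau>" "\<tau> \<le> t" for \<tau>
  proof (cases "k \<in> Mfreq")
    case True
    have "proj_M (advection (velocity \<tau>)) k = nonlin solution k \<tau> *s cvec (vfreq k)"
      using real_coefficients.proj_advection_field[OF real_coefficients_solution[OF that(1)] True] that(1)
      by (simp add: velocity_def nonlin_eq)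
    moreover have "\<nu> * (t - \<tau>) * lap_symbol \<alpha> k = damping k * (t - \<tau>)"
      by (simp add: damping_def lap_symbol_shell[OF level_shell[OF True]])
    ultimately show ?thesis by (simp add: semigroup_def h_def cvec_scaleR)
  next
    case False
    then show ?thesis by (simp add: semigroup_def proj_M_def h_def nonlin_def triads_def)
  qed
  show "set_integrable lborel {0..t} ?g" by (rule set_integral_modify_point(1)[OF h gh t])
  have "(LBINT \<tau>:{0..t}. ?g \<tau>) = integral {0..t} h" by (rule set_integral_modify_point(2)[OF h gh t])
  also have "\<dots> = integral {0..t} (\<lambda>\<tau>. exp (- (damping k * (t - \<tau>))) *\<^sub>R nonlin solution k \<tau>) *s cvec (vfreq k)"
    using integral_linear[OF integrable_continuous_interval[OF nle] bounded_linear_scalar_left, of "cvec (vfreq k)"]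
    by (simp add: h_def[abs_def] o_def)
  also have "integral {0..t} (\<lambda>\<tau>. exp (- (damping k * (t - \<tau>))) *\<^sub>R nonlin solution k \<tau>)
      = exp (- (damping k * t)) *\<^sub>R integral {0..t} (\<lambda>\<tau>. exp (damping k * \<tau>) *\<^sub>R nonlin solution k \<tau>)"
    by (simp add: right_diff_distrib algebra_simps exp_diff exp_minus divide_inverse flip: integral_cmul)
  also have "\<dots> = exp (- (damping k * t)) *\<^sub>R c0 k - solution k t"
    using solution_duhamel[of t k] t by (simp add: duhamel_def scaleR_diff_right)
  finally have I: "(LBINT \<tau>:{0..t}. ?g \<tau>) = (exp (- (damping k * t)) *\<^sub>R c0 k - solution k t) *s cvec (vfreq k)" .
  show "fourier (velocity t) k = semigroup \<alpha> (\<nu> * t) (fourier u0) k - (LBINT \<tau>:{0..t}. ?g \<tau>)"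
  proof (cases "k \<in> Mfreq")
    case True
    then have "\<nu> * t * lap_symbol \<alpha> k = damping k * t"
      by (simp add: damping_def lap_symbol_shell[OF level_shell[OF True]])
    then show ?thesis unfolding I using t True
      by (simp add: fourier_velocity fourier_u0 semigroup_def cvec_scaleR[symmetric] vec_eq_iff left_diff_distrib)
  next
    case False
    then show ?thesis unfolding I using t by (simp add: fourier_velocity fourier_u0 semigroup_def c0_zero solution_zero)
  qed
qed

lemma velocity_smooth: "smooth_on ({0<..} \<times> UNIV) (\<lambda>(t, x). velocity t x)"
  unfolding smooth_on_def
proof
  fix n
  show "Ck_on n ({0<..} \<times> UNIV) (\<lambda>(t, x). velocity t x)"
    by (rule Ck_on_cong[OF _ _ smooth_family_Ck_on[OF smooth_family_solution]])
      (auto simp: open_Times evolution_def velocity_def)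
qed

lemma velocity_norm_le:
  assumes "0 \<le> \<sigma>" "\<sigma> \<le> s" "0 < t"
  shows "Hdot_norm \<sigma> (velocity t) \<le> Hdot_norm \<sigma> u0"
  using energy_le_initial[OF assms] Hdot_norm_velocity[OF assms(2), of t] Hdot_norm_velocity[OF assms(2), of 0] assms(3)
  by (simp add: velocity_def)

end

section \<open>From a datum in the constraint space to amplitudes, and the conclusion\<close>

definition scalar_coefficient :: "(real ^ 3 \<Rightarrow> real ^ 3) \<Rightarrow> int ^ 3 \<Rightarrow> complex" where
  "scalar_coefficient u k = (if k \<in> Mfreq then \<Sum>i\<in>UNIV. of_real (vfreq k $ i) * fourier u k $ i else 0)"

lemma fourier_HdotM:
  assumes "u \<in> HdotM s"
  shows "fourier u k = (if k \<in> Mfreq then scalar_coefficient u k *s cvec (vfreq k) else 0)"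
proof (cases "k \<in> Mfreq")
  case True
  then obtain c where c: "fourier u k = c *s cvec (vfreq k)" using assms by (auto simp: HdotM_def)
  have "(\<Sum>i\<in>UNIV. of_real (vfreq k $ i) * (c *s cvec (vfreq k)) $ i) = c * of_real (vfreq k \<bullet> vfreq k)"
    by (simp add: inner_vec_def cvec_def sum_distrib_left mult_ac)
  also have "vfreq k \<bullet> vfreq k = 1" using norm_vfreq[OF True] by (simp add: norm_eq_1)
  finally show ?thesis using True c by (simp add: scalar_coefficient_def)
next
  case False
  then show ?thesis using assms by (auto simp: HdotM_def)
qed

lemma fourier_uminus: "fourier u (- k) $ i = cnj (fourier u k $ i)"
proof -
  have "fourier u (- k) $ i = (LINT x|torus. cnj (of_real (u x $ i) * fchar k x))"
    by (simp add: fourier_def fchar_uminus)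
  also have "\<dots> = cnj (fourier u k $ i)" unfolding Bochner_Integration.integral_cnj fourier_def by simp
  finally show ?thesis .
qed

lemma scalar_coefficient_uminus: "scalar_coefficient u (- k) = cnj (scalar_coefficient u k)"
  by (simp add: scalar_coefficient_def uminus_Mfreq_iff vfreq_uminus fourier_uminus)

theorem theorem1p10:
  fixes \<alpha> s :: real
  assumes "0 < \<alpha>" and "\<alpha> < ln 3 / (4 * ln 2)" and "s > crit_exp \<alpha>"
  shows "\<exists>M>0. \<forall>\<nu>>0. \<forall>u0 \<in> HdotM s.
    Hdot_norm (crit_exp \<alpha>) u0 < M * \<nu> \<longrightarrow>
    (\<exists>u. global_mild_solution \<alpha> \<nu> s u0 u \<and>
         smooth_on ({0<..} \<times> UNIV) (\<lambda>(t, x). u t x) \<and>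
         (\<forall>t>0. Hdot_norm (crit_exp \<alpha>) (u t) \<le> Hdot_norm (crit_exp \<alpha>) u0 \<and>
                Hdot_norm s (u t) \<le> Hdot_norm s u0))"
  \<comment> \<open>\<open>4 powr (- s - 1)\<close> is the ratio \<open>\<delta>\<close> of the envelope; the numerical factor absorbs 24 frequencies per
    shell, 72 triads per frequency and the coupling constant 96.\<close>
proof (intro exI[of _ "(4 powr (- s - 1))\<^sup>2 / 2000000"] conjI allI ballI impI)
  show "0 < (4 powr (- s - 1))\<^sup>2 / (2000000 :: real)" by simp
  fix \<nu> :: real and u0 assume \<nu>: "0 < \<nu>" and u0: "u0 \<in> HdotM s"
    and small: "Hdot_norm (crit_exp \<alpha>) u0 < (4 powr (- s - 1))\<^sup>2 / 2000000 * \<nu>"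
  define c0 where "c0 = scalar_coefficient u0"
  have F: "fourier u0 k = (if k \<in> Mfreq then c0 k *s cvec (vfreq k) else 0)" for k
    unfolding c0_def by (rule fourier_HdotM[OF u0])
  have summ: "summable (\<lambda>n. lam n powr s * (\<Sum>k\<in>shell n. (norm (c0 k))\<^sup>2))"
    using Hdot_norm_shells(1)[of u0 c0 s, OF F] u0 by (simp add: HdotM_def Hdot_def)
  have "summable (\<lambda>n. lam n powr crit_exp \<alpha> * (\<Sum>k\<in>shell n. (norm (c0 k))\<^sup>2))"
    by (rule summable_comparison_test'[OF summ, of 0])
      (use assms(3) lam_ge_1 in \<open>auto intro!: mult_right_mono powr_mono sum_nonneg simp: abs_mult abs_of_nonneg sum_nonneg\<close>)
  then have U: "Hdot_norm (crit_exp \<alpha>) u0 = sqrt (\<Sum>n. lam n powr crit_exp \<alpha> * (\<Sum>k\<in>shell n. (norm (c0 k))\<^sup>2))"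
    by (rule Hdot_norm_shells(2)[OF F])
  interpret small_initial_field \<alpha> s \<nu> c0 "Hdot_norm (crit_exp \<alpha>) u0" u0
  proof
    show "2000000 * Hdot_norm (crit_exp \<alpha>) u0 \<le> (4 powr (- s - 1))\<^sup>2 * \<nu>" using small by simp
    show "c0 (- k) = cnj (c0 k)" for k by (simp add: c0_def scalar_coefficient_uminus)
    show "c0 k = 0" if "k \<notin> Mfreq" for k using that by (simp add: c0_def scalar_coefficient_def)
  qed (fact assms \<nu> u0 F summ U)+
  show "\<exists>u. global_mild_solution \<alpha> \<nu> s u0 u \<and>
         smooth_on ({0<..} \<times> UNIV) (\<lambda>(t, x). u t x) \<and>
         (\<forall>t>0. Hdot_norm (crit_exp \<alpha>) (u t) \<le> Hdot_norm (crit_exp \<alpha>) u0 \<and>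
                Hdot_norm s (u t) \<le> Hdot_norm s u0)"
  proof (intro exI[of _ velocity] conjI allI impI velocity_mild velocity_smooth)
    fix t :: real assume "0 < t"
    then show "Hdot_norm (crit_exp \<alpha>) (velocity t) \<le> Hdot_norm (crit_exp \<alpha>) u0"
      and "Hdot_norm s (velocity t) \<le> Hdot_norm s u0"
      using velocity_norm_le crit_exp_pos s_pos s by simp_all
  qed
qed

end
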